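(* Let $\mathbb{F}$ be a prime field and let $f \in \mathbb{F}[x_1,\ldots,x_n]$ be a quartic polynomial ($\deg(f)=4$) with $\mathrm{bias}(f)=\delta$. Then there exist $4c = \mathrm{poly}(|\mathbb{F}|/\delta)$ polynomials $\{\ell_i,q_i,q'_i,g_i\}_{i=1}^{c}$, where the $\ell_i$ are linear, the $q_i$ and $q'_i$ are quadratic and the $g_i$ are cubic, such that $$f = \sum_{j=1}^{c} \ell_j \cdot g_j + \sum_{j=1}^{c} q_j \cdot q'_j .$$
   Context: For $f:\mathbb{F}^n\to\mathbb{F}$, $\mathrm{bias}(f) = \left|\mathbb{E}_{a \in \mathbb{F}^n}[\omega^{f(a)}]\right|$ with $\omega = e^{2\pi i/|\mathbb{F}|}$. Polynomials are identified with the functions $\mathbb{F}^n\to\mathbb{F}$ they define (i.e. one works modulo $x_i^{p}-x_i$, $p=|\mathbb{F}|$), and the degree of a function is the least degree of a polynomial representing it. In the conclusion, "linear", "quadratic", "cubic" mean degree at most $1,2,3$ (linear functions may have a constant term). $\mathrm{poly}(|\mathbb{F}|/\delta)$ denotes a quantity bounded by $P(|\mathbb{F}|/\delta)$ for a fixed polynomial $P$ independent of $\mathbb{F}$, $n$, $f$, $\delta$. *)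

theory Defs
  imports Complex_Main "HOL-Library.FuncSet" "HOL-Library.Poly_Mapping"
    "HOL-Computational_Algebra.Polynomial" "HOL-Number_Theory.Cong"
begin

text \<open>
  The prime field of order \<open>p\<close> is the set \<open>{0..<int p}\<close> of integers with arithmetic modulo \<open>p\<close>.
  The field is a term rather than a type, so that one bound can be asserted uniformly in \<open>p\<close>.
\<close>

definition prime_field :: "nat \<Rightarrow> int set" where
  "prime_field p = {0..<int p}"

definition points :: "nat \<Rightarrow> nat \<Rightarrow> (nat \<Rightarrow> int) set" where
  "points p n = {..<n} \<rightarrow>\<^sub>E prime_field p"

definition bias :: "nat \<Rightarrow> nat \<Rightarrow> ((nat \<Rightarrow> int) \<Rightarrow> int) \<Rightarrow> real" where
  "bias p n f =
    cmod ((\<Sum>a\<in>points p n. exp (2 * of_real pi * \<i> / of_nat p) powi f a) / of_nat (card (points p n)))"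

text \<open>
  A formal polynomial is a finitely supported map from exponent vectors to coefficients; the
  variables are indexed by \<open>{..<n}\<close>, and the coefficients are reduced, so that the support
  \<open>keys P\<close> consists of exactly the monomials that are nonzero modulo \<open>p\<close>.
\<close>

definition mpolys :: "nat \<Rightarrow> nat \<Rightarrow> ((nat \<Rightarrow>\<^sub>0 nat) \<Rightarrow>\<^sub>0 int) set" where
  "mpolys p n =
    {P. \<forall>m\<in>Poly_Mapping.keys P.
          Poly_Mapping.lookup P m \<in> prime_field p \<and> Poly_Mapping.keys m \<subseteq> {..<n}}"

definition meval :: "nat \<Rightarrow> ((nat \<Rightarrow>\<^sub>0 nat) \<Rightarrow>\<^sub>0 int) \<Rightarrow> (nat \<Rightarrow> int) \<Rightarrow> int" where
  "meval p P x =
    (\<Sum>m\<in>Poly_Mapping.keys P. Poly_Mapping.lookup P m *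
       (\<Prod>i\<in>Poly_Mapping.keys m. x i ^ Poly_Mapping.lookup m i)) mod int p"

text \<open>The zero polynomial gets total degree \<open>0\<close>.\<close>

definition total_degree :: "((nat \<Rightarrow>\<^sub>0 nat) \<Rightarrow>\<^sub>0 int) \<Rightarrow> nat" where
  "total_degree P =
    Max (insert 0 ((\<lambda>m. \<Sum>i\<in>Poly_Mapping.keys m. Poly_Mapping.lookup m i) ` Poly_Mapping.keys P))"

definition represents ::
    "nat \<Rightarrow> nat \<Rightarrow> ((nat \<Rightarrow>\<^sub>0 nat) \<Rightarrow>\<^sub>0 int) \<Rightarrow> ((nat \<Rightarrow> int) \<Rightarrow> int) \<Rightarrow> bool" where
  "represents p n P f \<longleftrightarrow> P \<in> mpolys p n \<and> (\<forall>x\<in>points p n. f x = meval p P x)"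

text \<open>
  Over a prime field every function from \<open>points p n\<close> to \<open>prime_field p\<close> is represented by some
  polynomial, so the minimum below is attained for every such \<open>f\<close>.
\<close>

definition fun_degree :: "nat \<Rightarrow> nat \<Rightarrow> ((nat \<Rightarrow> int) \<Rightarrow> int) \<Rightarrow> nat" where
  "fun_degree p n f = (LEAST d. \<exists>P. represents p n P f \<and> total_degree P = d)"

definition funs_deg_le :: "nat \<Rightarrow> nat \<Rightarrow> nat \<Rightarrow> ((nat \<Rightarrow> int) \<Rightarrow> int) set" where
  "funs_deg_le p n d = {f \<in> points p n \<rightarrow> prime_field p. fun_degree p n f \<le> d}"

end

theory Submission
  imports Defs "HOL-Library.Function_Algebras"
begin

text \<open>
  Degrees are measured by iterated differences, which makes sense on every finite subgroup \<open>V\<close> of an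
  abelian group, and subspaces are measured by their index.

  If \<open>f\<close> is biased, then a dense set of its differences is biased, and \<open>f x\<close> can be read off, for most
  \<open>x\<close>, from few differences \<open>fdiff a f x\<close> with random \<open>a\<close>. Biased quadratic functions have small rank.
  A property of \<open>fdiff a f\<close> that is subadditive in \<open>a\<close> and holds for a dense set of \<open>a\<close> holds on a large
  subgroup. So for a biased cubic \<open>f\<close> there is a large subgroup on whose cosets few differences are affine
  and determine \<open>f\<close> most of the time; on a smaller coset these are constant, hence so is \<open>f\<close>, because two
  functions of low degree that agree often enough are equal. Consequently \<open>f\<close> is quadratic on all cosets.

  For a biased quartic \<open>f\<close> this shows in the same way that, on a coset of a large subgroup, few quadratic
  functions \<open>q\<close> determine \<open>f\<close> most of the time. After passing to a smaller subgroup, all nontrivial combinations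
  of the \<open>q\<close> have large rank. Then the values of \<open>q\<close> on five-dimensional cubes are equidistributed, subject
  to the identities forced by the degree. Completing cubes shows that \<open>f = F (q)\<close> exactly, and that all third
  differences of \<open>F\<close> vanish; so \<open>F\<close> is a quadratic polynomial. Finally, extending \<open>f\<close> to a subgroup that
  is larger by one dimension costs one product of a linear and a cubic function, by Newton's formula.
\<close>

subsection \<open>Subgroups and indices\<close>

text \<open>Small primes are one obstacle: for p = 2 or 3 a quartic function cannot be recovered
  from its multilinear form, since 2 and 3 need not be invertible. Hence only differences, polar
  forms and Newton's formula with \<open>j < p\<close> occur, and derivatives are never integrated.
  The other obstacle is the polynomial bound. Regularising k functions to rank s costs k (s + 1)
  dimensions, and this is affordable because s may be linear in k: a five-dimensional cube has 15
  coordinates per function, and rank 30 k + 4 already gives every vector of coordinates at least 3/4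
  of its expected frequency. Cubes have five directions because a quartic function is killed by five
  differences, and because 5 = 2 + 2 + 1: through the polar form a pair of directions moves the
  values of \<open>q\<close> by a prescribed vector, and so does a single direction through its own
  increment. Three such moves make a third difference of \<open>F\<close>. Arbitrary abelian groups
  are used because the same notions are applied to the domain, to five-tuples of directions and to
  the space of values of \<open>q\<close>.\<close>

definition add_subgroup :: "'a::ab_group_add set \<Rightarrow> bool" where
  "add_subgroup V \<longleftrightarrow> 0 \<in> V \<and> (\<forall>x\<in>V. \<forall>y\<in>V. x - y \<in> V)"

lemma add_subgroup_zero: "add_subgroup V \<Longrightarrow> 0 \<in> V"
  by (simp add: add_subgroup_def)

lemma add_subgroup_diff: "add_subgroup V \<Longrightarrow> x \<in> V \<Longrightarrow> y \<in> V \<Longrightarrow> x - y \<in> V"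
  by (simp add: add_subgroup_def)

lemma add_subgroup_uminus: "add_subgroup V \<Longrightarrow> x \<in> V \<Longrightarrow> - x \<in> V"
  using add_subgroup_diff[of V 0 x] add_subgroup_zero by auto

lemma add_subgroup_add: "add_subgroup V \<Longrightarrow> x \<in> V \<Longrightarrow> y \<in> V \<Longrightarrow> x + y \<in> V"
  using add_subgroup_diff[of V x "- y"] add_subgroup_uminus[of V y] by auto

lemma add_subgroup_sum:
  assumes "add_subgroup V" "\<And>i. i \<in> I \<Longrightarrow> f i \<in> V"
  shows "sum f I \<in> V"
  using assms(2)
  by (induction I rule: infinite_finite_induct)
     (auto simp: add_subgroup_zero[OF assms(1)] intro: add_subgroup_add[OF assms(1)])

lemma add_subgroup_Int: "add_subgroup V \<Longrightarrow> add_subgroup W \<Longrightarrow> add_subgroup (V \<inter> W)"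
  by (auto simp: add_subgroup_def)

lemma add_subgroup_card_pos: "add_subgroup V \<Longrightarrow> finite V \<Longrightarrow> card V > 0"
  using add_subgroup_zero card_gt_0_iff by blast

lemma sum_subgroup_shift:
  assumes "add_subgroup V" "a \<in> V"
  shows "(\<Sum>x\<in>V. \<phi> (x + a)) = (\<Sum>x\<in>V. \<phi> x)"
  by (rule sum.reindex_bij_witness[of _ "\<lambda>x. x - a" "\<lambda>x. x + a"])
     (use assms in \<open>auto intro: add_subgroup_diff add_subgroup_add\<close>)

text \<open>Base points run over all of \<open>V\<close>, so no system of coset representatives has
  to be chosen; for a subgroup \<open>W\<close> each coset is simply met \<open>card W\<close>
  times. The averaging arguments over cosets rest on this.\<close>

lemma sum_over_cosets:
  fixes \<phi> :: "'a::ab_group_add \<Rightarrow> 'b::comm_semiring_1"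
  assumes "add_subgroup V" "W \<subseteq> V"
  shows "(\<Sum>y\<in>V. \<Sum>w\<in>W. \<phi> (y + w)) = of_nat (card W) * (\<Sum>x\<in>V. \<phi> x)"
proof -
  have "(\<Sum>y\<in>V. \<Sum>w\<in>W. \<phi> (y + w)) = (\<Sum>w\<in>W. \<Sum>y\<in>V. \<phi> (y + w))"
    by (rule sum.swap)
  also have "\<dots> = (\<Sum>w\<in>W. \<Sum>x\<in>V. \<phi> x)"
    using assms by (intro sum.cong refl sum_subgroup_shift) auto
  finally show ?thesis
    by simp
qed

lemma card_le_fibres:
  assumes "finite A" "finite B" "f ` A \<subseteq> B"
    and "\<And>b. b \<in> B \<Longrightarrow> card {a \<in> A. f a = b} \<le> n"
  shows "card A \<le> card B * n"
proof -
  have "card A = (\<Sum>b\<in>B. card {a \<in> A. f a = b})"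
    using sum.group[OF assms(1-3), of "\<lambda>_. 1::nat"] by simp
  also have "\<dots> \<le> (\<Sum>b\<in>B. n)"
    by (intro sum_mono assms)
  finally show ?thesis
    by simp
qed

text \<open>Addition maps \<open>K \<times> L\<close> into \<open>V\<close>, and subtracting a fixed
  first component embeds each nonempty fibre into \<open>K \<inter> L\<close>.\<close>

lemma card_subgroup_Int:
  assumes "add_subgroup V" "finite V" "add_subgroup K" "K \<subseteq> V" "add_subgroup L" "L \<subseteq> V"
  shows "card K * card L \<le> card V * card (K \<inter> L)"
proof -
  have fin: "finite K" "finite L"
    using assms finite_subset by auto
  have "card (K \<times> L) \<le> card V * card (K \<inter> L)"
  proof (rule card_le_fibres[where f = "\<lambda>(k, l). k + l"])
    show "(\<lambda>(k, l). k + l) ` (K \<times> L) \<subseteq> V"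
      using assms by (auto intro: add_subgroup_add)
    fix b
    let ?F = "{a \<in> K \<times> L. (case a of (k, l) \<Rightarrow> k + l) = b}"
    show "card ?F \<le> card (K \<inter> L)"
    proof (cases "?F = {}")
      case False
      then obtain k l where kl: "k \<in> K" "l \<in> L" "k + l = b"
        by auto
      show ?thesis
      proof (rule card_inj_on_le[where f = "\<lambda>(k', l'). k' - k"])
        show "inj_on (\<lambda>(k', l'). k' - k) ?F"
          by (auto simp: inj_on_def)
        have "k' - k = l - l'" if "k' + l' = b" for k' l'
          using kl(3) that by (simp add: algebra_simps)
        then show "(\<lambda>(k', l'). k' - k) ` ?F \<subseteq> K \<inter> L"
          using kl assms(3,5) by (auto intro: add_subgroup_diff)
      qed (use fin in auto)
    qed (simp only: card.empty le0)
  qed (use fin assms in auto)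
  then show ?thesis
    by (simp add: card_cartesian_product)
qed

text \<open>For a vector space over the prime field this is codimension at most \<open>r\<close>.
  Counting elements avoids dimensions and bases.\<close>

definition index_le :: "nat \<Rightarrow> nat \<Rightarrow> 'a::ab_group_add set \<Rightarrow> 'a set \<Rightarrow> bool" where
  "index_le p r V K \<longleftrightarrow> add_subgroup K \<and> K \<subseteq> V \<and> card V \<le> p ^ r * card K"

lemma index_le_subgroup: "index_le p r V K \<Longrightarrow> add_subgroup K"
  and index_le_subset: "index_le p r V K \<Longrightarrow> K \<subseteq> V"
  by (simp_all add: index_le_def)

lemma index_le_refl: "add_subgroup V \<Longrightarrow> index_le p 0 V V"
  by (simp add: index_le_def)

lemma index_le_mono: "index_le p r V K \<Longrightarrow> r \<le> s \<Longrightarrow> 1 \<le> p \<Longrightarrow> index_le p s V K"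
  unfolding index_le_def by (meson le_trans mult_le_mono1 power_increasing)

lemma index_le_trans: "index_le p r V W \<Longrightarrow> index_le p s W K \<Longrightarrow> index_le p (r + s) V K"
  unfolding index_le_def
  by (auto simp: power_add mult.assoc intro: order_trans[OF _ mult_le_mono2])

lemma index_le_Int:
  assumes "add_subgroup V" "finite V" "index_le p r V K" "index_le p s V L"
  shows "index_le p (r + s) V (K \<inter> L)"
proof -
  note K = assms(3)[unfolded index_le_def] and L = assms(4)[unfolded index_le_def]
  have "card V * card V \<le> (p ^ r * card K) * (p ^ s * card L)"
    using K L by (intro mult_mono) auto
  also have "\<dots> = p ^ (r + s) * (card K * card L)"
    by (simp add: power_add)
  also have "\<dots> \<le> p ^ (r + s) * (card V * card (K \<inter> L))"
    using card_subgroup_Int[OF assms(1,2)] K L by (intro mult_le_mono2) auto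
  finally have "card V * card V \<le> card V * (p ^ (r + s) * card (K \<inter> L))"
    by (simp add: mult_ac)
  then show ?thesis
    using add_subgroup_card_pos[OF assms(1,2)] K L
    by (auto simp: index_le_def intro: add_subgroup_Int)
qed

lemma index_le_INT:
  fixes I :: "nat set"
  assumes "add_subgroup V" "finite V" "finite I" "\<And>i. i \<in> I \<Longrightarrow> index_le p r V (K i)"
  shows "index_le p (card I * r) V (V \<inter> (\<Inter>i\<in>I. K i))"
  using assms(3,4)
proof (induction I rule: finite_induct)
  case empty
  then show ?case
    using assms(1) by (simp add: index_le_refl)
next
  case (insert j I)
  have "index_le p (r + card I * r) V (K j \<inter> (V \<inter> (\<Inter>i\<in>I. K i)))"
    by (rule index_le_Int[OF assms(1,2)]) (use insert in auto)
  also have "K j \<inter> (V \<inter> (\<Inter>i\<in>I. K i)) = V \<inter> (\<Inter>i\<in>insert j I. K i)"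
    by auto
  finally show ?case
    using insert by simp
qed

text \<open>The residues of the values \<open>h i x\<close> take at most \<open>p ^ card I\<close>
  patterns, and elements with the same pattern differ by an element of the kernel. Additivity is
  asked for only modulo \<open>p\<close>, because the functions that occur are additive only in this
  sense.\<close>

lemma index_le_kernel:
  fixes I :: "nat set" and h :: "nat \<Rightarrow> 'a::ab_group_add \<Rightarrow> int"
  assumes "add_subgroup V" "finite V" "finite I" "p > 0"
    and add: "\<And>i x y. i \<in> I \<Longrightarrow> x \<in> V \<Longrightarrow> y \<in> V \<Longrightarrow> int p dvd h i (x - y) - (h i x - h i y)"
  shows "index_le p (card I) V {x \<in> V. \<forall>i\<in>I. int p dvd h i x}" (is "index_le _ _ _ ?K")
proof -
  have fin: "finite ?K"
    using assms by simp
  have diff: "int p dvd h i (x - y) \<longleftrightarrow> h i x mod int p = h i y mod int p"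
    if "i \<in> I" "x \<in> V" "y \<in> V" for i x y
    using add[OF that] by (metis dvd_diff_right_iff mod_eq_dvd_iff dvd_diff_commute dvd_diff_left_iff)
  have sub: "add_subgroup ?K"
    unfolding add_subgroup_def
  proof (intro conjI ballI)
    have "int p dvd h i 0" if "i \<in> I" for i
      using diff[OF that, of 0 0] assms(1) by (simp add: add_subgroup_zero)
    then show "0 \<in> ?K"
      using assms(1) by (auto simp: add_subgroup_zero)
    fix x y assume "x \<in> ?K" "y \<in> ?K"
    then show "x - y \<in> ?K"
      using assms(1) diff by (auto simp: add_subgroup_diff)
  qed
  have "card V \<le> card (PiE I (\<lambda>_. {0..<int p})) * card ?K"
  proof (rule card_le_fibres[where f = "\<lambda>x. \<lambda>i\<in>I. h i x mod int p"])
    show "(\<lambda>x. \<lambda>i\<in>I. h i x mod int p) ` V \<subseteq> PiE I (\<lambda>_. {0..<int p})"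
      using assms(4) by auto
    fix b
    let ?F = "{a \<in> V. (\<lambda>i\<in>I. h i a mod int p) = b}"
    show "card ?F \<le> card ?K"
    proof (cases "?F = {}")
      case False
      then obtain x0 where x0: "x0 \<in> ?F"
        by auto
      show ?thesis
      proof (rule card_inj_on_le[where f = "\<lambda>x. x - x0"])
        show "(\<lambda>x. x - x0) ` ?F \<subseteq> ?K"
        proof safe
          fix x i assume x: "x \<in> V" "b = (\<lambda>i\<in>I. h i x mod int p)"
          then show "x - x0 \<in> V"
            using x0 assms(1) by (auto simp: add_subgroup_diff)
          assume i: "i \<in> I"
          then have "h i x mod int p = h i x0 mod int p"
            using x x0 by (auto dest!: fun_cong[where x = i])
          then show "int p dvd h i (x - x0)"
            using diff i x x0 by auto
        qed
      qed (auto simp: inj_on_def fin)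
    qed (simp only: card.empty le0)
  qed (use assms in \<open>auto intro: finite_PiE\<close>)
  also have "card (PiE I (\<lambda>_. {0..<int p})) = p ^ card I"
    using assms by (simp add: card_PiE)
  finally show ?thesis
    using sub by (auto simp: index_le_def)
qed

subsection \<open>Finite differences and degrees\<close>

definition fdiff :: "'a::ab_group_add \<Rightarrow> ('a \<Rightarrow> int) \<Rightarrow> 'a \<Rightarrow> int" where
  "fdiff a f = (\<lambda>x. f (x + a) - f x)"

text \<open>\<open>deg_lt p V k f\<close> says that \<open>f\<close>, restricted to \<open>V\<close> and read modulo \<open>p\<close>, has degree less
  than \<open>k\<close>; in particular degree less than \<open>0\<close> means that it vanishes.\<close>
primrec deg_lt :: "nat \<Rightarrow> 'a::ab_group_add set \<Rightarrow> nat \<Rightarrow> ('a \<Rightarrow> int) \<Rightarrow> bool" where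
  "deg_lt p V 0 f \<longleftrightarrow> (\<forall>x\<in>V. int p dvd f x)"
| "deg_lt p V (Suc k) f \<longleftrightarrow> (\<forall>a\<in>V. deg_lt p V k (fdiff a f))"

lemma deg_lt_zero [simp]: "deg_lt p V k (\<lambda>x. 0)"
  by (induction k) (simp_all add: fdiff_def)

lemma deg_lt_add: "deg_lt p V k f \<Longrightarrow> deg_lt p V k g \<Longrightarrow> deg_lt p V k (\<lambda>x. f x + g x)"
proof (induction k arbitrary: f g)
  case (Suc k)
  have "fdiff a (\<lambda>x. f x + g x) = (\<lambda>x. fdiff a f x + fdiff a g x)" for a
    by (simp add: fdiff_def fun_eq_iff)
  then show ?case
    using Suc by simp
qed simp

lemma deg_lt_cmult: "deg_lt p V k f \<Longrightarrow> deg_lt p V k (\<lambda>x. c * f x)"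
proof (induction k arbitrary: f)
  case (Suc k)
  have "fdiff a (\<lambda>x. c * f x) = (\<lambda>x. c * fdiff a f x)" for a
    by (simp add: fdiff_def fun_eq_iff algebra_simps)
  then show ?case
    using Suc by simp
qed simp

lemma deg_lt_uminus: "deg_lt p V k f \<Longrightarrow> deg_lt p V k (\<lambda>x. - f x)"
  using deg_lt_cmult[of p V k f "-1"] by simp

lemma deg_lt_diff: "deg_lt p V k f \<Longrightarrow> deg_lt p V k g \<Longrightarrow> deg_lt p V k (\<lambda>x. f x - g x)"
  using deg_lt_add[of p V k f "\<lambda>x. - g x"] deg_lt_uminus by auto

lemma deg_lt_sum:
  "(\<And>i. i \<in> I \<Longrightarrow> deg_lt p V k (f i)) \<Longrightarrow> deg_lt p V k (\<lambda>x. \<Sum>i\<in>I. f i x)"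
  by (induction I rule: infinite_finite_induct) (auto intro: deg_lt_add)

lemma deg_lt_cong:
  assumes "add_subgroup V" "\<And>x. x \<in> V \<Longrightarrow> int p dvd f x - g x"
  shows "deg_lt p V k f \<longleftrightarrow> deg_lt p V k g"
  using assms(2)
proof (induction k arbitrary: f g)
  case 0
  then show ?case
    by (metis deg_lt.simps(1) dvd_diff_left_iff dvd_diff_right_iff dvd_diff_commute)
next
  case (Suc k)
  have "int p dvd fdiff a f x - fdiff a g x" if "a \<in> V" "x \<in> V" for a x
  proof -
    have "int p dvd (f (x + a) - g (x + a)) - (f x - g x)"
      by (rule dvd_diff) (use that Suc.prems add_subgroup_add[OF assms(1)] in auto)
    then show ?thesis
      by (simp add: fdiff_def algebra_simps)
  qed
  then have "deg_lt p V k (fdiff a f) \<longleftrightarrow> deg_lt p V k (fdiff a g)" if "a \<in> V" for a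
    using that by (intro Suc.IH)
  then show ?case
    by simp
qed

lemma deg_lt_congI:
  "deg_lt p V k g \<Longrightarrow> add_subgroup V \<Longrightarrow> (\<And>x. x \<in> V \<Longrightarrow> int p dvd f x - g x) \<Longrightarrow> deg_lt p V k f"
  using deg_lt_cong[of V p f g k] by simp

lemma deg_lt_SucI:
  assumes "add_subgroup V" "deg_lt p V k f"
  shows "deg_lt p V (Suc k) f"
  using assms(2)
proof (induction k arbitrary: f)
  case 0
  then show ?case
    using assms(1) by (auto simp: fdiff_def intro!: dvd_diff add_subgroup_add)
next
  case (Suc k)
  then have "deg_lt p V (Suc k) (fdiff a f)" if "a \<in> V" for a
    using that by simp
  then show ?case
    by simp
qed

lemma deg_lt_mono: "add_subgroup V \<Longrightarrow> deg_lt p V k f \<Longrightarrow> k \<le> l \<Longrightarrow> deg_lt p V l f"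
  by (induction l rule: nat_induct) (auto intro: deg_lt_SucI simp: le_Suc_eq simp del: deg_lt.simps)

lemma deg_lt_const [simp]: "deg_lt p V (Suc k) (\<lambda>x. c)"
  by (simp add: fdiff_def)

text \<open>A difference of the composite in direction \<open>a\<close> is a difference of
  \<open>f\<close> in direction \<open>h a\<close>. Restriction to a subgroup, translation,
  projection and evaluation at a vertex of a cube are all instances.\<close>

lemma deg_lt_comp:
  assumes "deg_lt p W k f" "add_subgroup W" "c \<in> W" "\<And>x. x \<in> V \<Longrightarrow> h x \<in> W"
    and "\<And>x y. x \<in> V \<Longrightarrow> y \<in> V \<Longrightarrow> h (x + y) = h x + h y" "add_subgroup V"
  shows "deg_lt p V k (\<lambda>x. f (c + h x))"
  using assms(1)
proof (induction k arbitrary: f)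
  case 0
  then show ?case
    using assms by (auto intro: add_subgroup_add)
next
  case (Suc k)
  show ?case
    unfolding deg_lt.simps
  proof
    fix a assume a: "a \<in> V"
    have "deg_lt p V k (\<lambda>x. fdiff (h a) f (c + h x))"
      using Suc a assms by auto
    moreover have "int p dvd fdiff a (\<lambda>x. f (c + h x)) x - fdiff (h a) f (c + h x)"
      if "x \<in> V" for x
      using a that assms(5) by (simp add: fdiff_def add.assoc)
    ultimately show "deg_lt p V k (fdiff a (\<lambda>x. f (c + h x)))"
      by (rule deg_lt_congI[OF _ assms(6)])
  qed
qed

lemma deg_lt_shift:
  "deg_lt p V k f \<Longrightarrow> add_subgroup V \<Longrightarrow> y \<in> V \<Longrightarrow> deg_lt p V k (\<lambda>x. f (y + x))"
  using deg_lt_comp[of p V k f y V "\<lambda>x. x"] by simp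

lemma deg_lt_subset:
  "deg_lt p V k f \<Longrightarrow> add_subgroup V \<Longrightarrow> add_subgroup U \<Longrightarrow> U \<subseteq> V \<Longrightarrow> deg_lt p U k f"
  using deg_lt_comp[of p V k f 0 U "\<lambda>x. x"] by (auto simp: add_subgroup_zero)

lemma deg_lt_coset:
  "deg_lt p V k f \<Longrightarrow> add_subgroup V \<Longrightarrow> add_subgroup U \<Longrightarrow> U \<subseteq> V \<Longrightarrow> y \<in> V \<Longrightarrow>
    deg_lt p U k (\<lambda>x. f (y + x))"
  by (blast intro: deg_lt_subset deg_lt_shift)

lemma deg_lt_1_iff:
  assumes "add_subgroup V"
  shows "deg_lt p V (Suc 0) f \<longleftrightarrow> (\<forall>x\<in>V. int p dvd f x - f 0)"
proof
  assume *: "deg_lt p V (Suc 0) f"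
  show "\<forall>x\<in>V. int p dvd f x - f 0"
  proof
    fix x assume "x \<in> V"
    with * have "int p dvd fdiff x f 0"
      using add_subgroup_zero[OF assms] by auto
    then show "int p dvd f x - f 0"
      by (simp add: fdiff_def)
  qed
next
  assume "\<forall>x\<in>V. int p dvd f x - f 0"
  then show "deg_lt p V (Suc 0) f"
    using assms by (intro deg_lt_congI[OF deg_lt_const]) auto
qed

text \<open>By the product rule the difference of \<open>f * g\<close> is a sum of three products,
  each with a factor of smaller degree. Since the bounds are strict, \<open>k + l - 1\<close> is the
  usual sum of degrees.\<close>

lemma deg_lt_mult:
  assumes V: "add_subgroup V"
  shows "deg_lt p V k f \<Longrightarrow> deg_lt p V l g \<Longrightarrow> deg_lt p V (k + l - 1) (\<lambda>x. f x * g x)"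
proof (induction "k + l" arbitrary: k l f g)
  case 0
  then show ?case
    by simp
next
  case (Suc n)
  show ?case
  proof (cases "k = 0 \<or> l = 0")
    case True
    then have "deg_lt p V 0 (\<lambda>x. f x * g x)"
      using Suc.prems by auto
    then show ?thesis
      by (rule deg_lt_mono[OF V]) simp
  next
    case False
    then obtain k' l' where kl: "k = Suc k'" "l = Suc l'"
      by (meson not0_implies_Suc)
    have "deg_lt p V (k' + l') (fdiff a (\<lambda>x. f x * g x))" if a: "a \<in> V" for a
    proof -
      have fa: "deg_lt p V k' (fdiff a f)" and ga: "deg_lt p V l' (fdiff a g)"
        using Suc.prems a kl by auto
      have 1: "deg_lt p V (k' + l') (\<lambda>x. fdiff a f x * g x)"
        using Suc.hyps(1)[of k' l, OF _ fa Suc.prems(2)] Suc.hyps(2) kl by simp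
      have 2: "deg_lt p V (k' + l') (\<lambda>x. f x * fdiff a g x)"
        using Suc.hyps(1)[of k l', OF _ Suc.prems(1) ga] Suc.hyps(2) kl by simp
      have 3: "deg_lt p V (k' + l') (\<lambda>x. fdiff a f x * fdiff a g x)"
        using Suc.hyps(1)[of k' l, OF _ fa deg_lt_SucI[OF V ga, folded kl]] Suc.hyps(2) kl by simp
      have "fdiff a (\<lambda>x. f x * g x) =
          (\<lambda>x. fdiff a f x * g x + f x * fdiff a g x + fdiff a f x * fdiff a g x)"
        by (simp add: fdiff_def fun_eq_iff algebra_simps)
      then show ?thesis
        by (auto intro!: deg_lt_add 1 2 3)
    qed
    then show ?thesis
      by (simp add: kl)
  qed
qed

text \<open>A bound of Schwartz-Zippel type whose constant does not depend on \<open>p\<close>. A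
  difference can be nonzero at \<open>x\<close> only if \<open>f\<close> is nonzero at
  \<open>x\<close> or at \<open>x + a\<close>, so its support is at most twice as large. By
  induction all differences vanish, and a constant function with a zero vanishes.\<close>

lemma deg_lt_vanish:
  assumes V: "add_subgroup V" "finite V"
  shows "deg_lt p V (Suc d) f \<Longrightarrow> 2 ^ d * card {x \<in> V. \<not> int p dvd f x} < card V \<Longrightarrow>
    x \<in> V \<Longrightarrow> int p dvd f x"
proof (induction d arbitrary: f x)
  case 0
  then have "\<exists>y\<in>V. int p dvd f y"
    by (metis (mono_tags, lifting) Collect_cong less_irrefl mult.left_neutral power_0 Collect_mem_eq)
  then show ?case
    using 0 deg_lt_1_iff[OF V(1), of p f]
    by (metis dvd_diff_commute dvd_diff_left_iff dvd_diff_right_iff)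
next
  case (Suc d)
  define B where "B = {x \<in> V. \<not> int p dvd f x}"
  have "int p dvd fdiff a f y" if a: "a \<in> V" and y: "y \<in> V" for a y
  proof (rule Suc.IH)
    have "{x \<in> V. \<not> int p dvd fdiff a f x} \<subseteq> B \<union> (\<lambda>x. x - a) ` B"
    proof
      fix x assume x: "x \<in> {x \<in> V. \<not> int p dvd fdiff a f x}"
      then have "\<not> int p dvd f x \<or> \<not> int p dvd f (x + a)"
        by (auto simp: fdiff_def)
      then have "x \<in> B \<or> x + a \<in> B"
        using x add_subgroup_add[OF V(1) _ a] by (auto simp: B_def)
      moreover have "x = (x + a) - a"
        by simp
      ultimately show "x \<in> B \<union> (\<lambda>x. x - a) ` B"
        by blast
    qed
    then have "card {x \<in> V. \<not> int p dvd fdiff a f x} \<le> card (B \<union> (\<lambda>x. x - a) ` B)"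
      using V by (intro card_mono) (auto simp: B_def)
    also have "\<dots> \<le> card B + card ((\<lambda>x. x - a) ` B)"
      by (rule card_Un_le)
    also have "\<dots> \<le> 2 * card B"
      using card_image_le[of B "\<lambda>x. x - a"] V by (simp add: B_def)
    finally have "2 ^ d * card {x \<in> V. \<not> int p dvd fdiff a f x} \<le> 2 ^ Suc d * card B"
      using mult_le_mono2[of _ "2 * card B" "2 ^ d"] by (simp add: mult_ac)
    also have "\<dots> < card V"
      using Suc.prems(2) by (simp only: B_def)
    finally show "2 ^ d * card {x \<in> V. \<not> int p dvd fdiff a f x} < card V" .
  qed (use Suc.prems a y in auto)
  then have "deg_lt p V (Suc 0) f"
    using V by simp
  then have const: "int p dvd f y - f 0" if "y \<in> V" for y
    using deg_lt_1_iff[OF V(1)] that by auto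
  have "\<exists>y\<in>V. int p dvd f y"
  proof (rule ccontr)
    assume "\<not> (\<exists>y\<in>V. int p dvd f y)"
    then have "{x \<in> V. \<not> int p dvd f x} = V"
      by auto
    then show False
      using Suc.prems(2) by simp
  qed
  then obtain y where y: "y \<in> V" "int p dvd f y"
    by auto
  have "int p dvd (f x - f 0) - (f y - f 0) + f y"
    by (rule dvd_add[OF dvd_diff[OF const[OF Suc.prems(3)] const[OF y(1)]] y(2)])
  then show ?case
    by simp
qed

section \<open>Additive characters modulo \<open>p\<close>\<close>

definition chr :: "nat \<Rightarrow> int \<Rightarrow> complex" where
  "chr p k = cis (2 * pi * of_int k / of_nat p)"

lemma chr_0 [simp]: "chr p 0 = 1"
  by (simp add: chr_def)

lemma chr_add: "chr p (k + l) = chr p k * chr p l"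
  by (simp add: chr_def cis_mult add_divide_distrib distrib_left)

lemma cnj_chr: "cnj (chr p k) = chr p (- k)"
  by (simp add: chr_def cis_cnj)

lemma norm_chr [simp]: "cmod (chr p k) = 1"
  by (simp add: chr_def)

lemma chr_diff: "chr p (k - l) = chr p k * cnj (chr p l)"
  using chr_add[of p k "- l"] by (simp add: cnj_chr)

lemma chr_power: "chr p k ^ j = chr p (int j * k)"
  by (simp add: chr_def DeMoivre mult_ac)

lemma chr_eq_1_iff:
  assumes "p > 0"
  shows "chr p k = 1 \<longleftrightarrow> int p dvd k"
proof
  assume "int p dvd k"
  then obtain m where "k = int p * m"
    by auto
  then have "2 * pi * of_int k / of_nat p = 2 * pi * of_int m"
    using assms by simp
  then show "chr p k = 1"
    by (simp add: chr_def)
next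
  assume "chr p k = 1"
  then have "cos (2 * pi * of_int k / of_nat p) = 1"
    by (simp add: chr_def complex_eq_iff)
  then obtain n :: int where "2 * pi * of_int k / of_nat p = of_int n * 2 * pi"
    using cos_one_2pi_int by blast
  then have "(of_int k :: real) = of_int (n * int p)"
    using assms by (simp add: field_simps)
  then show "int p dvd k"
    by (simp only: of_int_eq_iff) simp
qed

lemma chr_cong: "p > 0 \<Longrightarrow> int p dvd k - l \<Longrightarrow> chr p k = chr p l"
  using chr_add[of p "k - l" l] by (simp add: chr_eq_1_iff)

lemma sum_chr_multiples:
  assumes "p > 0"
  shows "(\<Sum>j<p. chr p (int j * k)) = (if int p dvd k then of_nat p else 0)"
proof (cases "int p dvd k")
  case True
  then have "chr p (int j * k) = 1" for j
    using assms by (simp add: chr_eq_1_iff)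
  then show ?thesis
    using True by simp
next
  case False
  have "chr p k ^ p = 1"
    using assms by (simp add: chr_power chr_eq_1_iff)
  moreover have "chr p k \<noteq> 1"
    using False assms by (simp add: chr_eq_1_iff)
  ultimately have "(\<Sum>j<p. chr p k ^ j) = 0"
    by (simp add: sum_gp_strict)
  then show ?thesis
    using False by (simp add: chr_power)
qed

text \<open>If \<open>z \<noteq> 1\<close> is a \<open>p\<close>-th root of unity, then
  \<open>p = \<bar>\<Sum>j<p. 1 - z\<^sup>j\<bar> \<le> \<Sum>j<p. j * \<bar>1 - z\<bar>\<close>.\<close>
lemma chr_separated:
  assumes "p > 0" "\<not> int p dvd k - l"
  shows "2 / real p \<le> cmod (chr p k - chr p l)"
proof -
  define z where "z = chr p (k - l)"
  have dist: "cmod (1 - z ^ j) \<le> real j * cmod (1 - z)" for j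
  proof (induction j)
    case (Suc j)
    have "1 - z ^ Suc j = (1 - z) + z * (1 - z ^ j)"
      by (simp add: algebra_simps)
    also have "cmod \<dots> \<le> cmod (1 - z) + cmod (1 - z ^ j)"
      by (rule order_trans[OF norm_triangle_ineq]) (simp add: norm_mult z_def)
    finally show ?case
      using Suc by (simp add: algebra_simps)
  qed simp
  have "of_nat p = (\<Sum>j<p. 1 - z ^ j)"
    using sum_chr_multiples[OF assms(1), of "k - l"] assms(2)
    by (simp add: sum_subtractf z_def chr_power)
  then have "real p = cmod (\<Sum>j<p. 1 - z ^ j)"
    by (metis norm_of_nat)
  also have "\<dots> \<le> (\<Sum>j<p. real j * cmod (1 - z))"
    by (rule order_trans[OF norm_sum]) (intro sum_mono dist)
  also have "\<dots> = real (\<Sum>j<p. j) * cmod (1 - z)"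
    by (simp add: sum_distrib_right)
  also have "\<dots> \<le> (real p * real p / 2) * cmod (1 - z)"
  proof (intro mult_right_mono)
    have "2 * (\<Sum>j<p. j) \<le> p * p"
      by (induction p) (auto simp: algebra_simps)
    then show "real (\<Sum>j<p. j) \<le> real p * real p / 2"
      by (metis (no_types) le_divide_eq_numeral1(1) mult.commute of_nat_le_iff of_nat_mult of_nat_numeral)
  qed simp
  finally have "2 / real p \<le> cmod (1 - z)"
    using assms(1) by (simp add: field_simps)
  also have "1 - z = - cnj (chr p l) * (chr p k - chr p l)"
    using chr_diff[of p l l] by (simp add: z_def chr_diff algebra_simps)
  also have "cmod \<dots> = cmod (chr p k - chr p l)"
    by (simp only: norm_mult norm_minus_cancel complex_mod_cnj norm_chr mult_1)
  finally show ?thesis .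
qed

subsection \<open>Bias and differences\<close>

lemma cmod_chr_sum_le: "cmod (\<Sum>x\<in>V. chr p (f x)) \<le> card V"
  by (rule order_trans[OF norm_sum]) simp

text \<open>Weyl differencing: in the expanded square the pairs of points are written as
  \<open>x\<close> and \<open>x + a\<close>.\<close>

lemma bias_squared:
  assumes V: "add_subgroup V"
  shows "complex_of_real ((cmod (\<Sum>x\<in>V. chr p (f x)))\<^sup>2) =
    (\<Sum>a\<in>V. \<Sum>x\<in>V. chr p (fdiff a f x))"
proof -
  have "complex_of_real ((cmod (\<Sum>x\<in>V. chr p (f x)))\<^sup>2) =
      (\<Sum>x\<in>V. chr p (f x)) * cnj (\<Sum>x\<in>V. chr p (f x))"
    by (simp only: complex_norm_square)
  also have "\<dots> = (\<Sum>x\<in>V. \<Sum>y\<in>V. chr p (f y) * cnj (chr p (f x)))"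
    unfolding cnj_sum sum_product by (rule sum.swap)
  also have "\<dots> = (\<Sum>x\<in>V. \<Sum>a\<in>V. chr p (fdiff a f x))"
  proof (rule sum.cong[OF refl])
    fix x assume x: "x \<in> V"
    show "(\<Sum>y\<in>V. chr p (f y) * cnj (chr p (f x))) = (\<Sum>a\<in>V. chr p (fdiff a f x))"
      using sum_subgroup_shift[OF V x, of "\<lambda>y. chr p (f y) * cnj (chr p (f x))"]
      by (simp add: fdiff_def chr_diff add.commute)
  qed
  also have "\<dots> = (\<Sum>a\<in>V. \<Sum>x\<in>V. chr p (fdiff a f x))"
    by (rule sum.swap)
  finally show ?thesis .
qed

text \<open>By \<open>bias_squared\<close> the differences have average bias at least 1 / N^2.
  Directions outside \<open>A\<close> account for at most half of this, and each direction in
  \<open>A\<close> contributes at most the trivial bound.\<close>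

lemma many_biased_differences:
  fixes f :: "'a::ab_group_add \<Rightarrow> int" and p N :: nat
  assumes V: "add_subgroup V" "finite V"
    and bias: "card V \<le> real N * cmod (\<Sum>x\<in>V. chr p (f x))"
  defines "A \<equiv> {a \<in> V. card V \<le> real (2 * N\<^sup>2) * cmod (\<Sum>x\<in>V. chr p (fdiff a f x))}"
  shows "card V \<le> 2 * N\<^sup>2 * card A"
proof -
  define T where "T a = cmod (\<Sum>x\<in>V. chr p (fdiff a f x))" for a
  define v where "v = real (card V)"
  have v: "v > 0"
    using add_subgroup_card_pos[OF V] by (simp add: v_def)
  have A: "A \<subseteq> V"
    by (auto simp: A_def)
  have fin: "finite A" "finite (V - A)"
    using A V finite_subset by auto
  have "v\<^sup>2 \<le> (real N * cmod (\<Sum>x\<in>V. chr p (f x)))\<^sup>2"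
    using bias by (intro power_mono) (auto simp: v_def)
  also have "\<dots> = (real N)\<^sup>2 * cmod (complex_of_real ((cmod (\<Sum>x\<in>V. chr p (f x)))\<^sup>2))"
    unfolding norm_of_real by (simp add: power_mult_distrib)
  also have "\<dots> \<le> (real N)\<^sup>2 * (\<Sum>a\<in>V. T a)"
    unfolding bias_squared[OF V(1)] T_def by (intro mult_left_mono norm_sum) auto
  also have "(\<Sum>a\<in>V. T a) = (\<Sum>a\<in>A. T a) + (\<Sum>a\<in>V - A. T a)"
    using A V by (simp add: sum.subset_diff)
  finally have "2 * v\<^sup>2 \<le> 2 * (real N)\<^sup>2 * (\<Sum>a\<in>A. T a) + (\<Sum>a\<in>V - A. 2 * (real N)\<^sup>2 * T a)"
    unfolding sum_distrib_left[symmetric] by (simp add: algebra_simps)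
  also have "(\<Sum>a\<in>A. T a) \<le> (\<Sum>a\<in>A. v)"
    by (intro sum_mono) (simp add: T_def v_def cmod_chr_sum_le)
  also have "(\<Sum>a\<in>V - A. 2 * (real N)\<^sup>2 * T a) \<le> (\<Sum>a\<in>V - A. v)"
    by (intro sum_mono) (auto simp: A_def T_def v_def)
  also have "(\<Sum>a\<in>V - A. v) \<le> v * v"
    using card_mono[of V "V - A"] V v by (auto simp: v_def intro!: mult_right_mono)
  finally have "2 * v\<^sup>2 \<le> 2 * (real N)\<^sup>2 * (real (card A) * v) + v * v"
    by (simp add: mult_left_mono)
  then have "v * v \<le> (2 * (real N)\<^sup>2 * real (card A)) * v"
    by (simp add: power2_eq_square algebra_simps)
  then have "v \<le> 2 * (real N)\<^sup>2 * real (card A)"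
    using v by simp
  also have "\<dots> = real (2 * N\<^sup>2 * card A)"
    by simp
  finally show ?thesis
    unfolding v_def by (simp only: of_nat_le_iff)
qed

text \<open>A shift by \<open>b\<close> multiplies the character sum by the value of the character
  at the constant slope \<open>fdiff b g 0\<close>. As the sum is nonzero, this factor is 1.\<close>

lemma biased_affine_const:
  fixes g :: "'a::ab_group_add \<Rightarrow> int"
  assumes V: "add_subgroup V" "finite V" and "p > 0"
    and g: "deg_lt p V 2 g" and nz: "(\<Sum>x\<in>V. chr p (g x)) \<noteq> 0"
  shows "deg_lt p V 1 g"
proof -
  have "int p dvd fdiff b g y" if b: "b \<in> V" and y: "y \<in> V" for b y
  proof -
    have "deg_lt p V (Suc 0) (fdiff b g)"
      using g b by (simp add: numeral_2_eq_2)
    then have const: "int p dvd fdiff b g x - fdiff b g 0" if "x \<in> V" for x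
      using that deg_lt_1_iff[OF V(1)] by blast
    have "(\<Sum>x\<in>V. chr p (g x)) = (\<Sum>x\<in>V. chr p (g (x + b)))"
      using sum_subgroup_shift[OF V(1) b, of "\<lambda>x. chr p (g x)"] by simp
    also have "\<dots> = (\<Sum>x\<in>V. chr p (fdiff b g 0) * chr p (g x))"
    proof (intro sum.cong refl)
      fix x assume "x \<in> V"
      have "chr p (g (x + b)) = chr p (fdiff b g x) * chr p (g x)"
        by (simp add: fdiff_def flip: chr_add)
      also have "chr p (fdiff b g x) = chr p (fdiff b g 0)"
        using const[OF \<open>x \<in> V\<close>] \<open>p > 0\<close> by (rule chr_cong[rotated])
      finally show "chr p (g (x + b)) = chr p (fdiff b g 0) * chr p (g x)" .
    qed
    also have "\<dots> = chr p (fdiff b g 0) * (\<Sum>x\<in>V. chr p (g x))"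
      by (simp add: sum_distrib_left)
    finally have "chr p (fdiff b g 0) = 1"
      using nz by simp
    then have "int p dvd fdiff b g 0"
      using \<open>p > 0\<close> by (simp add: chr_eq_1_iff)
    from dvd_add[OF const[OF y] this] show ?thesis
      by simp
  qed
  then show ?thesis
    by simp
qed

text \<open>For quadratic \<open>g\<close> this is the radical of its polar form, and the index in
  \<open>V\<close> measures the rank of \<open>g\<close>.\<close>

definition kernel2 :: "nat \<Rightarrow> 'a::ab_group_add set \<Rightarrow> ('a \<Rightarrow> int) \<Rightarrow> 'a set" where
  "kernel2 p V g = {u \<in> V. deg_lt p V 1 (fdiff u g)}"

lemma kernel2_subset: "kernel2 p V g \<subseteq> V"
  by (auto simp: kernel2_def)

lemma add_subgroup_kernel2:
  assumes V: "add_subgroup V"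
  shows "add_subgroup (kernel2 p V g)"
  unfolding add_subgroup_def
proof (intro conjI ballI)
  show "0 \<in> kernel2 p V g"
    using V by (simp add: kernel2_def add_subgroup_zero fdiff_def)
  fix u w assume u: "u \<in> kernel2 p V g" and w: "w \<in> kernel2 p V g"
  have "deg_lt p V 1 (\<lambda>x. fdiff u g (- w + x) - fdiff w g (- w + x))"
    using u w V by (intro deg_lt_diff deg_lt_shift) (auto simp: kernel2_def add_subgroup_uminus)
  also have "(\<lambda>x. fdiff u g (- w + x) - fdiff w g (- w + x)) = fdiff (u - w) g"
    by (simp add: fdiff_def fun_eq_iff algebra_simps)
  finally show "u - w \<in> kernel2 p V g"
    using u w V by (simp add: kernel2_def add_subgroup_diff)
qed

text \<open>All differences of \<open>g\<close> are affine, so the character sum of a difference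
  vanishes unless the difference is constant. Only directions in the radical survive in
  \<open>bias_squared\<close>.\<close>

lemma quadratic_bias_squared:
  fixes g :: "'a::ab_group_add \<Rightarrow> int"
  assumes V: "add_subgroup V" "finite V" and "p > 0" and g: "deg_lt p V 3 g"
  shows "(cmod (\<Sum>x\<in>V. chr p (g x)))\<^sup>2 \<le> real (card (kernel2 p V g)) * card V"
proof -
  let ?K = "kernel2 p V g"
  have "(\<Sum>x\<in>V. chr p (fdiff a g x)) = 0" if "a \<in> V - ?K" for a
  proof (rule ccontr)
    assume "(\<Sum>x\<in>V. chr p (fdiff a g x)) \<noteq> 0"
    moreover have "deg_lt p V 2 (fdiff a g)"
      using g that by (simp add: numeral_3_eq_3 numeral_2_eq_2)
    ultimately have "deg_lt p V 1 (fdiff a g)"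
      using biased_affine_const[OF V \<open>p > 0\<close>] by blast
    then show False
      using that by (simp add: kernel2_def)
  qed
  then have "(\<Sum>a\<in>V. \<Sum>x\<in>V. chr p (fdiff a g x)) = (\<Sum>a\<in>?K. \<Sum>x\<in>V. chr p (fdiff a g x))"
    using V kernel2_subset[of p V g] by (intro sum.mono_neutral_right) auto
  then have "(cmod (\<Sum>x\<in>V. chr p (g x)))\<^sup>2 = cmod (\<Sum>a\<in>?K. \<Sum>x\<in>V. chr p (fdiff a g x))"
    using bias_squared[OF V(1), of p g] by (metis norm_of_real abs_of_nonneg zero_le_power2)
  also have "\<dots> \<le> (\<Sum>a\<in>?K. real (card V))"
    by (rule order_trans[OF norm_sum]) (intro sum_mono cmod_chr_sum_le)
  finally show ?thesis
    by simp
qed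

lemma quadratic_structure:
  fixes g :: "'a::ab_group_add \<Rightarrow> int"
  assumes V: "add_subgroup V" "finite V" and "p > 0" and g: "deg_lt p V 3 g"
    and bias: "card V \<le> real N * cmod (\<Sum>x\<in>V. chr p (g x))"
  shows "card V \<le> N\<^sup>2 * card (kernel2 p V g)"
proof -
  have v: "real (card V) > 0"
    using add_subgroup_card_pos[OF V] by simp
  have "(real (card V))\<^sup>2 \<le> (real N * cmod (\<Sum>x\<in>V. chr p (g x)))\<^sup>2"
    using bias by (intro power_mono) auto
  also have "\<dots> \<le> (real N)\<^sup>2 * (real (card (kernel2 p V g)) * card V)"
    unfolding power_mult_distrib by (intro mult_left_mono quadratic_bias_squared assms) auto
  finally have "real (card V) * card V \<le> ((real N)\<^sup>2 * real (card (kernel2 p V g))) * card V"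
    by (simp add: power2_eq_square mult_ac)
  then have "real (card V) \<le> (real N)\<^sup>2 * real (card (kernel2 p V g))"
    using v by simp
  also have "\<dots> = real (N\<^sup>2 * card (kernel2 p V g))"
    by simp
  finally show ?thesis
    by (simp only: of_nat_le_iff)
qed

subsection \<open>Subgroups from dense sets\<close>

primrec sumset_iter :: "'a::ab_group_add set \<Rightarrow> nat \<Rightarrow> 'a set" where
  "sumset_iter A 0 = {0}"
| "sumset_iter A (Suc m) = {x + a |x a. x \<in> sumset_iter A m \<and> a \<in> A}"

lemma sumset_iter_mono_Suc: "0 \<in> A \<Longrightarrow> sumset_iter A m \<subseteq> sumset_iter A (Suc m)"
  by (force intro: exI[of _ 0])

lemma sumset_iter_mono: "0 \<in> A \<Longrightarrow> m \<le> n \<Longrightarrow> sumset_iter A m \<subseteq> sumset_iter A n"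
  by (rule lift_Suc_mono_le[of "sumset_iter A"]) (auto intro: sumset_iter_mono_Suc[THEN subsetD] simp del: sumset_iter.simps)

lemma sumset_iter_subset:
  "add_subgroup V \<Longrightarrow> A \<subseteq> V \<Longrightarrow> sumset_iter A m \<subseteq> V"
  by (induction m) (auto simp: add_subgroup_zero intro!: add_subgroup_add)

lemma sumset_iter_add:
  "x \<in> sumset_iter A m \<Longrightarrow> y \<in> sumset_iter A n \<Longrightarrow> x + y \<in> sumset_iter A (m + n)"
proof (induction n arbitrary: y)
  case (Suc n)
  then obtain z a where "y = z + a" "z \<in> sumset_iter A n" "a \<in> A"
    by auto
  then show ?case
    using Suc by (auto simp flip: add.assoc)
qed simp

lemma sumset_iter_uminus:
  assumes "uminus ` A \<subseteq> A"
  shows "x \<in> sumset_iter A m \<Longrightarrow> - x \<in> sumset_iter A m"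
proof (induction m arbitrary: x)
  case (Suc m)
  then obtain z a where x: "x = z + a" "z \<in> sumset_iter A m" "a \<in> A"
    by auto
  have "- x = - z + - a"
    by (simp add: x)
  moreover have "- z \<in> sumset_iter A m" "- a \<in> A"
    using x Suc.IH assms by auto
  ultimately show ?case
    unfolding sumset_iter.simps by blast
qed simp

lemma sumset_iter_stable:
  assumes "sumset_iter A (Suc m) = sumset_iter A m" "m \<le> n"
  shows "sumset_iter A n = sumset_iter A m"
  using assms(2) by (induction n rule: dec_induct) (use assms(1) in auto)

text \<open>If the iterated sumsets do not become stationary, then every third step adds a disjoint
  translate of \<open>A\<close>.\<close>
lemma sumset_iter_subgroup:
  assumes V: "add_subgroup V" "finite V" and A: "A \<subseteq> V" "0 \<in> A" "uminus ` A \<subseteq> A"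
    and dense: "card V \<le> n * card A"
  shows "add_subgroup (sumset_iter A (3 * n))"
proof -
  let ?S = "sumset_iter A"
  have fin: "finite (?S m)" "finite A" for m
    using sumset_iter_subset[OF V(1) A(1)] A V by (meson finite_subset)+
  have A_pos: "card A > 0"
    using A fin card_gt_0_iff by blast
  have "\<exists>m\<le>3 * n. ?S (Suc m) = ?S m"
  proof (rule ccontr)
    assume "\<not> ?thesis"
    then have *: "?S (Suc m) \<noteq> ?S m" if "m \<le> 3 * n" for m
      using that by blast
    have "Suc j * card A \<le> card (?S (3 * j + 1))" if "j \<le> n" for j
      using that
    proof (induction j)
      case 0
      have "A \<subseteq> ?S 1"
        by (auto simp: One_nat_def)
      then show ?case
        using card_mono[OF fin(1)] by simp
    next
      case (Suc j)
      have "?S (3 * j + 2) \<subseteq> ?S (3 * j + 3)"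
        using A by (intro sumset_iter_mono) auto
      moreover have "?S (Suc (3 * j + 2)) \<noteq> ?S (3 * j + 2)"
        by (rule *) (use Suc.prems in simp)
      ultimately obtain x where x: "x \<in> ?S (3 * j + 3)" "x \<notin> ?S (3 * j + 2)"
        by (auto simp: numeral_3_eq_3 numeral_2_eq_2 simp del: sumset_iter.simps)
      \<comment> \<open>A common point would, by symmetry of \<open>A\<close>, bring
        \<open>x\<close> back into the sumset of order \<open>3 * j + 2\<close>.\<close>
      have disj: "(+) x ` A \<inter> ?S (3 * j + 1) = {}"
      proof (rule ccontr)
        assume "(+) x ` A \<inter> ?S (3 * j + 1) \<noteq> {}"
        then obtain a where a: "a \<in> A" "x + a \<in> ?S (3 * j + 1)"
          by auto
        then have "(x + a) + - a \<in> ?S (Suc (3 * j + 1))"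
          using A unfolding sumset_iter.simps by blast
        then show False
          using x by simp
      qed
      have "(+) x ` A \<subseteq> ?S (Suc (3 * j + 3))"
      proof
        fix y assume "y \<in> (+) x ` A"
        then obtain a where "a \<in> A" "y = x + a"
          by auto
        then show "y \<in> ?S (Suc (3 * j + 3))"
          using x(1) unfolding sumset_iter.simps(2) by blast
      qed
      moreover have "?S (3 * j + 1) \<subseteq> ?S (Suc (3 * j + 3))"
        using A by (intro sumset_iter_mono) auto
      ultimately have "card ((+) x ` A \<union> ?S (3 * j + 1)) \<le> card (?S (Suc (3 * j + 3)))"
        by (intro card_mono fin) auto
      also have "card ((+) x ` A \<union> ?S (3 * j + 1)) = card A + card (?S (3 * j + 1))"
        using disj fin by (subst card_Un_disjoint) (auto simp: card_image simp del: sumset_iter.simps)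
      finally show ?case
        using Suc by (simp add: algebra_simps del: sumset_iter.simps)
    qed
    from this[of n] have "Suc n * card A \<le> card (?S (3 * n + 1))"
      by simp
    also have "\<dots> \<le> card V"
      by (intro card_mono V sumset_iter_subset A)
    finally show False
      using dense A_pos by simp
  qed
  then obtain m where m: "m \<le> 3 * n" "?S (Suc m) = ?S m"
    by blast
  have stable: "?S (3 * n + 3 * n) = ?S (3 * n)"
    using sumset_iter_stable[OF m(2), of "3 * n + 3 * n"] sumset_iter_stable[OF m(2) m(1)] m(1)
    by (metis trans_le_add1)
  show ?thesis
    unfolding add_subgroup_def
  proof (intro conjI ballI)
    show "0 \<in> ?S (3 * n)"
      using sumset_iter_mono[OF A(2), of 0 "3 * n"] by auto
    fix x y assume "x \<in> ?S (3 * n)" "y \<in> ?S (3 * n)"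
    then have "x + - y \<in> ?S (3 * n + 3 * n)"
      by (intro sumset_iter_add sumset_iter_uminus A)
    then show "x - y \<in> ?S (3 * n)"
      using stable by simp
  qed
qed

text \<open>The subgroup is the stationary sumset. Since it contains \<open>A\<close>, it is as
  dense, and each of its elements is a sum of \<open>3 * n\<close> elements of \<open>A\<close>, so
  that the parameter \<open>r\<close> is paid \<open>3 * n\<close> times.\<close>

lemma subadditive_property_on_subgroup:
  fixes P :: "nat \<Rightarrow> 'a::ab_group_add \<Rightarrow> bool"
  assumes V: "add_subgroup V" "finite V" and A: "A \<subseteq> V" "0 \<in> A" "uminus ` A \<subseteq> A"
    and dense: "card V \<le> n * card A"
    and P: "P 0 0" "\<And>a. a \<in> A \<Longrightarrow> P r a"
    and P_add: "\<And>a b s t. a \<in> V \<Longrightarrow> b \<in> V \<Longrightarrow> P s a \<Longrightarrow> P t b \<Longrightarrow> P (s + t) (a + b)"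
  obtains W where "add_subgroup W" "W \<subseteq> V" "card V \<le> n * card W" "\<And>w. w \<in> W \<Longrightarrow> P (3 * n * r) w"
proof
  show "add_subgroup (sumset_iter A (3 * n))"
    by (rule sumset_iter_subgroup[OF V A dense])
  show "sumset_iter A (3 * n) \<subseteq> V"
    by (rule sumset_iter_subset[OF V(1) A(1)])
  have "n > 0"
    using dense add_subgroup_card_pos[OF V] by (cases n) auto
  have "A \<subseteq> sumset_iter A 1"
    by (auto simp: One_nat_def)
  also have "\<dots> \<subseteq> sumset_iter A (3 * n)"
    using A \<open>n > 0\<close> by (intro sumset_iter_mono) auto
  finally have "card A \<le> card (sumset_iter A (3 * n))"
    using sumset_iter_subset[OF V(1) A(1)] V by (meson card_mono finite_subset)
  then show "card V \<le> n * card (sumset_iter A (3 * n))"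
    using dense by (meson le_trans mult_le_mono2)
  have "P (m * r) w" if "w \<in> sumset_iter A m" for m w
    using that
  proof (induction m arbitrary: w)
    case (Suc m)
    then obtain x a where w: "w = x + a" "x \<in> sumset_iter A m" "a \<in> A"
      by auto
    then have "P (m * r + r) (x + a)"
      using Suc.IH P(2) A sumset_iter_subset[OF V(1) A(1), of m] by (intro P_add) auto
    then show ?case
      by (simp add: w add.commute)
  qed (use P in simp)
  then show "\<And>w. w \<in> sumset_iter A (3 * n) \<Longrightarrow> P (3 * n * r) w" .
qed

subsection \<open>Averaging over cosets\<close>

lemma exists_le_average:
  fixes f g :: "'a \<Rightarrow> real"
  assumes "finite V" "V \<noteq> {}" "sum f V \<le> sum g V"
  shows "\<exists>y\<in>V. f y \<le> g y"
proof (rule ccontr)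
  assume "\<not> ?thesis"
  then have "sum g V < sum f V"
    using assms by (intro sum_strict_mono) auto
  then show False
    using assms by simp
qed

lemma coset_large_sum:
  fixes \<phi> :: "'a::ab_group_add \<Rightarrow> complex"
  assumes V: "add_subgroup V" "finite V" and W: "W \<subseteq> V"
  shows "\<exists>y\<in>V. card W * cmod (\<Sum>x\<in>V. \<phi> x) \<le> card V * cmod (\<Sum>w\<in>W. \<phi> (y + w))"
proof (rule exists_le_average)
  have "(\<Sum>y\<in>V. card W * cmod (\<Sum>x\<in>V. \<phi> x)) = card V * cmod (of_nat (card W) * (\<Sum>x\<in>V. \<phi> x))"
    by (simp add: norm_mult)
  also have "\<dots> = card V * cmod (\<Sum>y\<in>V. \<Sum>w\<in>W. \<phi> (y + w))"
    by (simp only: sum_over_cosets[OF V(1) W])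
  also have "\<dots> \<le> card V * (\<Sum>y\<in>V. cmod (\<Sum>w\<in>W. \<phi> (y + w)))"
    by (intro mult_left_mono norm_sum) auto
  finally show "(\<Sum>y\<in>V. card W * cmod (\<Sum>x\<in>V. \<phi> x)) \<le> (\<Sum>y\<in>V. card V * cmod (\<Sum>w\<in>W. \<phi> (y + w)))"
    by (simp add: sum_distrib_left)
qed (use V in \<open>auto simp: add_subgroup_def\<close>)

lemma coset_few_bad:
  assumes V: "add_subgroup V" "finite V" and W: "W \<subseteq> V" and B: "B \<subseteq> V"
  shows "\<exists>y\<in>V. card V * card {w \<in> W. y + w \<in> B} \<le> card W * card B"
proof -
  have fin: "finite W"
    using V W finite_subset by auto
  define \<phi> :: "'a \<Rightarrow> real" where "\<phi> x = (if x \<in> B then 1 else 0)" for x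
  have \<phi>: "(\<Sum>w\<in>W. \<phi> (y + w)) = card {w \<in> W. y + w \<in> B}" for y
    using fin by (simp add: \<phi>_def sum.If_cases Int_def)
  have \<phi>V: "(\<Sum>x\<in>V. \<phi> x) = card B"
    using V B by (simp add: \<phi>_def sum.If_cases Int_absorb1)
  have "\<exists>y\<in>V. real (card V) * card {w \<in> W. y + w \<in> B} \<le> real (card W) * card B"
  proof (rule exists_le_average)
    have "(\<Sum>y\<in>V. real (card V) * card {w \<in> W. y + w \<in> B}) = card V * (\<Sum>y\<in>V. \<Sum>w\<in>W. \<phi> (y + w))"
      by (simp add: \<phi> sum_distrib_left)
    also have "\<dots> = card V * (card W * real (card B))"
      using sum_over_cosets[OF V(1) W, of \<phi>] by (simp add: \<phi>V)
    finally show "(\<Sum>y\<in>V. real (card V) * card {w \<in> W. y + w \<in> B}) \<le> (\<Sum>y\<in>V. real (card W) * card B)"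
      by simp
  qed (use V in \<open>auto simp: add_subgroup_def\<close>)
  then show ?thesis
    by (simp flip: of_nat_mult)
qed

subsection \<open>A biased function is determined by few of its differences\<close>

lemma cmod_add_squared: "(cmod (w + z))\<^sup>2 = (cmod w)\<^sup>2 + 2 * Re (cnj w * z) + (cmod z)\<^sup>2"
  unfolding cmod_power2 by (simp add: power2_eq_square algebra_simps)

text \<open>The variance of a unit vector is at most 1, and the mixed term averages out because
  \<open>m\<close> is the mean. So one more centred sample raises the second moment by at most 1 on
  average.\<close>

lemma sum_cmod_add_unit:
  fixes Z :: "'a \<Rightarrow> complex"
  assumes "finite V" "\<And>a. a \<in> V \<Longrightarrow> cmod (Z a) = 1" "(\<Sum>a\<in>V. Z a) = of_nat (card V) * m"
  shows "(\<Sum>a\<in>V. (cmod (s + (Z a - m)))\<^sup>2) \<le> card V * ((cmod s)\<^sup>2 + 1)"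
proof -
  define w where "w = s - m"
  have "(\<Sum>a\<in>V. (cmod (s + (Z a - m)))\<^sup>2) = (\<Sum>a\<in>V. (cmod (w + Z a))\<^sup>2)"
    by (simp add: w_def algebra_simps)
  also have "\<dots> = (\<Sum>a\<in>V. (cmod w)\<^sup>2 + 2 * Re (cnj w * Z a) + 1)"
    using assms(2) by (simp add: cmod_add_squared)
  also have "\<dots> = card V * (cmod w)\<^sup>2 + 2 * Re (cnj w * (\<Sum>a\<in>V. Z a)) + card V"
    by (simp add: sum.distrib sum_distrib_left)
  also have "Re (cnj w * (\<Sum>a\<in>V. Z a)) = card V * Re (cnj w * m)"
    by (simp add: assms(3) algebra_simps)
  also have "card V * (cmod w)\<^sup>2 + 2 * (card V * Re (cnj w * m)) + card V =
      card V * ((cmod (w + m))\<^sup>2 - (cmod m)\<^sup>2 + 1)"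
    by (simp add: cmod_add_squared algebra_simps)
  also have "\<dots> \<le> card V * ((cmod s)\<^sup>2 + 1)"
    by (intro mult_left_mono) (auto simp: w_def)
  finally show ?thesis .
qed

text \<open>The average of \<open>chr p (fdiff a f x)\<close> over \<open>a \<in> V\<close> is \<open>chr p (- f x)\<close> times a nonzero
  constant. So \<open>f x\<close> can be read off from a sample mean, if the sample \<open>a\<close> is good for \<open>x\<close>.
  The second moment method provides a sample which is good for most \<open>x\<close>.\<close>
lemma differences_determine:
  fixes f :: "'a::ab_group_add \<Rightarrow> int"
  assumes V: "add_subgroup V" "finite V" and "p > 0"
    and bias: "card V \<le> real N * cmod (\<Sum>x\<in>V. chr p (f x))"
  obtains a :: "nat \<Rightarrow> 'a" and B where "\<And>i. i < k \<Longrightarrow> a i \<in> V" "B \<subseteq> V"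
    "k * card B \<le> p\<^sup>2 * N\<^sup>2 * card V"
    "\<And>x y. x \<in> V - B \<Longrightarrow> y \<in> V - B \<Longrightarrow>
      (\<And>i. i < k \<Longrightarrow> int p dvd fdiff (a i) f x - fdiff (a i) f y) \<Longrightarrow> int p dvd f x - f y"
proof (cases "k = 0")
  \<comment> \<open>With an empty sample every point is declared exceptional.\<close>
  case True
  have "int p dvd f x - f y" if "x \<in> V - V" for x y
    using that by simp
  then show ?thesis
    using that[of "\<lambda>_. 0" V] True by auto
next
  case False
  define v where "v = card V"
  have v: "v > 0"
    using add_subgroup_card_pos[OF V] by (simp add: v_def)
  define \<mu> where "\<mu> = (\<Sum>x\<in>V. chr p (f x)) / of_nat v"
  define Z where "Z a x = chr p (fdiff a f x)" for a x
  define m where "m x = chr p (- f x) * \<mu>" for x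
  have sumZ: "(\<Sum>a\<in>V. Z a x) = of_nat (card V) * m x" if x: "x \<in> V" for x
  proof -
    have "(\<Sum>a\<in>V. Z a x) = (\<Sum>a\<in>V. chr p (- f x) * chr p (f (a + x)))"
      by (simp add: Z_def fdiff_def add.commute flip: chr_add)
    also have "\<dots> = chr p (- f x) * (\<Sum>a\<in>V. chr p (f a))"
      using sum_subgroup_shift[OF V(1) x, of "\<lambda>a. chr p (f a)"] by (simp flip: sum_distrib_left)
    finally show ?thesis
      using v by (simp add: m_def \<mu>_def v_def)
  qed
  \<comment> \<open>The random sample is derandomised one direction at a time: some choice of the
    next direction does not exceed the average of the second moment, summed over all
    \<open>x\<close>.\<close>
  have "\<exists>a. (\<forall>i<j. a i \<in> V) \<and> (\<Sum>x\<in>V. (cmod (\<Sum>i<j. Z (a i) x - m x))\<^sup>2) \<le> real j * v" for j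
  proof (induction j)
    case (Suc j)
    then obtain a where a: "\<forall>i<j. a i \<in> V"
      "(\<Sum>x\<in>V. (cmod (\<Sum>i<j. Z (a i) x - m x))\<^sup>2) \<le> real j * v"
      by auto
    define s where "s x = (\<Sum>i<j. Z (a i) x - m x)" for x
    have "(\<Sum>b\<in>V. \<Sum>x\<in>V. (cmod (s x + (Z b x - m x)))\<^sup>2) =
        (\<Sum>x\<in>V. \<Sum>b\<in>V. (cmod (s x + (Z b x - m x)))\<^sup>2)"
      by (rule sum.swap)
    also have "\<dots> \<le> (\<Sum>x\<in>V. v * ((cmod (s x))\<^sup>2 + 1))"
      unfolding v_def by (intro sum_mono sum_cmod_add_unit V sumZ) (auto simp: Z_def)
    also have "\<dots> = v * ((\<Sum>x\<in>V. (cmod (s x))\<^sup>2) + v)"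
      by (simp add: sum_distrib_left sum.distrib v_def distrib_left)
    also have "\<dots> \<le> v * (real j * v + v)"
      using a(2) by (intro mult_left_mono) (auto simp: s_def)
    also have "\<dots> = (\<Sum>b\<in>V. real (Suc j) * v)"
      by (simp add: v_def algebra_simps)
    finally have "\<exists>b\<in>V. (\<Sum>x\<in>V. (cmod (s x + (Z b x - m x)))\<^sup>2) \<le> real (Suc j) * v"
      using V by (intro exists_le_average) (auto simp: add_subgroup_def)
    then obtain b where b: "b \<in> V" "(\<Sum>x\<in>V. (cmod (s x + (Z b x - m x)))\<^sup>2) \<le> real (Suc j) * v"
      by auto
    have "(\<Sum>i<Suc j. Z ((a(j := b)) i) x - m x) = s x + (Z b x - m x)" for x
      by (simp add: s_def)
    then show ?case
      using a(1) b by (intro exI[of _ "a(j := b)"]) (auto simp: less_Suc_eq)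
  qed auto
  then obtain a where a: "\<And>i. i < k \<Longrightarrow> a i \<in> V"
    and mom: "(\<Sum>x\<in>V. (cmod (\<Sum>i<k. Z (a i) x - m x))\<^sup>2) \<le> real k * v"
    by blast
  define \<delta> where "\<delta> = cmod \<mu>"
  have vN: "real v \<le> real N * (\<delta> * v)"
    using bias v by (simp add: \<delta>_def \<mu>_def norm_divide v_def)
  then have N\<delta>: "1 \<le> real N * \<delta>"
    using v by (simp add: field_simps)
  then have \<delta>: "\<delta> > 0"
    by (metis \<delta>_def less_eq_real_def mult_zero_right norm_ge_zero not_one_le_zero)
  \<comment> \<open>Different values of \<open>f\<close> modulo \<open>p\<close> give values of
    \<open>m\<close> at distance at least \<open>\<delta>\<close> times 2 / p, so deviations below
    \<open>\<delta>\<close> / p on both sides cannot hide the difference. Chebyshev's inequality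
    then bounds \<open>B\<close>.\<close>
  define B where "B = {x \<in> V. \<delta> / p * k \<le> cmod (\<Sum>i<k. Z (a i) x - m x)}"
  have B: "B \<subseteq> V" "finite B"
    using V by (auto simp: B_def)
  have "card B * (\<delta> / p * k)\<^sup>2 = (\<Sum>x\<in>B. (\<delta> / p * k)\<^sup>2)"
    by simp
  also have "\<dots> \<le> (\<Sum>x\<in>B. (cmod (\<Sum>i<k. Z (a i) x - m x))\<^sup>2)"
    using \<delta> by (intro sum_mono power_mono) (auto simp: B_def)
  also have "\<dots> \<le> (\<Sum>x\<in>V. (cmod (\<Sum>i<k. Z (a i) x - m x))\<^sup>2)"
    using B V by (intro sum_mono2) auto
  also have "\<dots> \<le> real k * v"
    by (rule mom)
  finally have "(card B * \<delta>\<^sup>2 * k) * k \<le> (real p ^ 2 * v) * k"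
    using \<open>p > 0\<close> by (simp add: field_simps power2_eq_square)
  then have 1: "card B * \<delta>\<^sup>2 * k \<le> real p ^ 2 * v"
    using False by simp
  have "real (k * card B) * 1 \<le> real (k * card B) * (real N * \<delta>)\<^sup>2"
    using N\<delta> by (intro mult_left_mono one_le_power) auto
  also have "\<dots> = (real N)\<^sup>2 * (card B * \<delta>\<^sup>2 * k)"
    by (simp add: power_mult_distrib mult_ac)
  also have "\<dots> \<le> (real N)\<^sup>2 * (real p ^ 2 * v)"
    by (intro mult_left_mono 1) auto
  also have "\<dots> = real (p\<^sup>2 * N\<^sup>2 * card V)"
    by (simp add: v_def)
  finally have cardB: "k * card B \<le> p\<^sup>2 * N\<^sup>2 * card V"
    by (simp only: mult_1_right of_nat_le_iff)
  have "int p dvd f x - f y"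
    if x: "x \<in> V - B" and y: "y \<in> V - B"
      and eq: "\<And>i. i < k \<Longrightarrow> int p dvd fdiff (a i) f x - fdiff (a i) f y" for x y
  proof (rule ccontr)
    assume "\<not> int p dvd f x - f y"
    then have "\<not> int p dvd (- f x) - (- f y)"
      by (simp add: dvd_diff_commute)
    then have sep: "2 / p \<le> cmod (chr p (- f x) - chr p (- f y))"
      by (rule chr_separated[OF \<open>p > 0\<close>])
    have "Z (a i) x = Z (a i) y" if "i < k" for i
      unfolding Z_def using eq[OF that] by (rule chr_cong[OF \<open>p > 0\<close>])
    then have "(\<Sum>i<k. Z (a i) x - m x) - (\<Sum>i<k. Z (a i) y - m y) = of_nat k * (m y - m x)"
      by (simp add: sum_subtractf algebra_simps)
    then have "real k * cmod (m y - m x) =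
        cmod ((\<Sum>i<k. Z (a i) x - m x) - (\<Sum>i<k. Z (a i) y - m y))"
      by (simp add: norm_mult)
    also have "\<dots> \<le> cmod (\<Sum>i<k. Z (a i) x - m x) + cmod (\<Sum>i<k. Z (a i) y - m y)"
      by (rule norm_triangle_ineq4)
    also have "\<dots> < \<delta> / p * k + \<delta> / p * k"
      using x y by (intro add_strict_mono) (auto simp: B_def)
    also have "\<dots> = real k * (\<delta> * (2 / p))"
      by simp
    finally have "cmod (m y - m x) < \<delta> * (2 / p)"
      by (rule mult_left_less_imp_less) simp
    also have "m y - m x = (chr p (- f y) - chr p (- f x)) * \<mu>"
      by (simp add: m_def algebra_simps)
    finally have "\<delta> * cmod (chr p (- f y) - chr p (- f x)) < \<delta> * (2 / p)"
      by (simp only: norm_mult \<delta>_def mult.commute)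
    then have "cmod (chr p (- f y) - chr p (- f x)) < 2 / p"
      using \<delta> by (simp only: mult_less_cancel_left_pos)
    then show False
      using sep by (simp add: norm_minus_commute)
  qed
  then show ?thesis
    using that[of a B] a B(1) cardB by blast
qed

subsection \<open>Cubic functions\<close>

lemma fdiff_shift: "fdiff a (\<lambda>x. f (y + x)) = (\<lambda>x. fdiff a f (y + x))"
  by (simp add: fdiff_def add.assoc)

text \<open>The \<open>d\<close>-fold differences of \<open>h\<close> are constant on
  \<open>V\<close>, so those in directions from \<open>U\<close> vanish at every base point as soon
  as they vanish at one.\<close>

lemma deg_lt_all_cosets:
  assumes V: "add_subgroup V" and U: "add_subgroup U" "U \<subseteq> V" and y: "y0 \<in> V" "y \<in> V"
  shows "deg_lt p V (Suc d) h \<Longrightarrow> deg_lt p U d (\<lambda>x. h (y0 + x)) \<Longrightarrow> deg_lt p U d (\<lambda>x. h (y + x))"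
proof (induction d arbitrary: h)
  case 0
  then have "int p dvd h y0"
    using add_subgroup_zero[OF U(1)] by (auto dest: bspec[of _ _ 0])
  moreover have "int p dvd h x - h 0" if "x \<in> V" for x
    using 0(1) deg_lt_1_iff[OF V] that by blast
  ultimately have "int p dvd (h x - h 0) - (h y0 - h 0) + h y0" if "x \<in> V" for x
    by (meson dvd_add dvd_diff that y(1))
  then have "int p dvd h x" if "x \<in> V" for x
    using that by simp
  then show ?case
    using y U by (auto intro!: add_subgroup_add[OF V])
next
  case (Suc d)
  then show ?case
    using U by (auto simp: fdiff_shift simp del: deg_lt.simps(2) simp: deg_lt.simps(2)[of _ _ d] deg_lt.simps(2)[of _ _ "Suc d"])
qed

lemma cmod_sum_fdiff_uminus:
  assumes V: "add_subgroup V" and a: "a \<in> V"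
  shows "cmod (\<Sum>x\<in>V. chr p (fdiff (- a) f x)) = cmod (\<Sum>x\<in>V. chr p (fdiff a f x))"
proof -
  have "(\<Sum>x\<in>V. chr p (fdiff (- a) f x)) = (\<Sum>x\<in>V. chr p (fdiff (- a) f (x + a)))"
    by (rule sum_subgroup_shift[OF V a, symmetric])
  also have "\<dots> = cnj (\<Sum>x\<in>V. chr p (fdiff a f x))"
    by (simp add: fdiff_def cnj_chr)
  finally show ?thesis
    by (simp only: complex_mod_cnj)
qed

lemma coset_biased:
  fixes f :: "'a::ab_group_add \<Rightarrow> int"
  assumes V: "add_subgroup V" "finite V" and W: "W \<subseteq> V"
    and bias: "card V \<le> real N * cmod (\<Sum>x\<in>V. chr p (f x))"
  obtains y where "y \<in> V" "card W \<le> real N * cmod (\<Sum>w\<in>W. chr p (f (y + w)))"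
proof -
  obtain y where y: "y \<in> V"
    "card W * cmod (\<Sum>x\<in>V. chr p (f x)) \<le> card V * cmod (\<Sum>w\<in>W. chr p (f (y + w)))"
    using coset_large_sum[OF V W, of "\<lambda>x. chr p (f x)"] by auto
  have "real (card V) * card W \<le> (real N * cmod (\<Sum>x\<in>V. chr p (f x))) * card W"
    by (intro mult_right_mono bias) auto
  also have "\<dots> = real N * (card W * cmod (\<Sum>x\<in>V. chr p (f x)))"
    by simp
  also have "\<dots> \<le> real N * (card V * cmod (\<Sum>w\<in>W. chr p (f (y + w))))"
    by (intro mult_left_mono y) auto
  also have "\<dots> = real (card V) * (real N * cmod (\<Sum>w\<in>W. chr p (f (y + w))))"
    by simp
  finally have "card W \<le> real N * cmod (\<Sum>w\<in>W. chr p (f (y + w)))"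
    using add_subgroup_card_pos[OF V] by (simp only: mult_le_cancel_left_pos of_nat_0_less_iff)
  with y(1) show ?thesis
    by (rule that)
qed

lemma coset_density:
  assumes V: "add_subgroup V" "finite V" and W: "W \<subseteq> V" and B: "B \<subseteq> V" "c * card B \<le> card V"
  obtains y where "y \<in> V" "c * card {w \<in> W. y + w \<in> B} \<le> card W"
proof -
  obtain y where y: "y \<in> V" "card V * card {w \<in> W. y + w \<in> B} \<le> card W * card B"
    using coset_few_bad[OF V W B(1)] by auto
  have "card V * (c * card {w \<in> W. y + w \<in> B}) = c * (card V * card {w \<in> W. y + w \<in> B})"
    by simp
  also have "\<dots> \<le> c * (card W * card B)"
    by (intro mult_le_mono2 y)
  also have "\<dots> = card W * (c * card B)"
    by simp
  also have "\<dots> \<le> card W * card V"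
    by (intro mult_le_mono2 B)
  finally have "c * card {w \<in> W. y + w \<in> B} \<le> card W"
    using add_subgroup_card_pos[OF V] by (simp add: mult.commute)
  with y(1) show ?thesis
    by (rule that)
qed

lemma biased_differences_symmetric:
  fixes f :: "'a::ab_group_add \<Rightarrow> int" and p N :: nat
  assumes V: "add_subgroup V" and "N > 0"
  defines "A \<equiv> {a \<in> V. card V \<le> real (2 * N\<^sup>2) * cmod (\<Sum>x\<in>V. chr p (fdiff a f x))}"
  shows "A \<subseteq> V" "0 \<in> A" "uminus ` A \<subseteq> A"
proof -
  have "1 \<le> 2 * N\<^sup>2"
    using \<open>N > 0\<close> by (simp add: Suc_le_eq)
  then have "1 \<le> real (2 * N\<^sup>2)"
    by (metis of_nat_1 of_nat_le_iff)
  then have "real (card V) \<le> real (2 * N\<^sup>2) * real (card V)"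
    by (metis mult_right_mono mult_1 of_nat_0_le_iff)
  then show "0 \<in> A"
    using add_subgroup_zero[OF V] by (simp add: A_def fdiff_def)
  show "uminus ` A \<subseteq> A"
    using V by (auto simp: A_def cmod_sum_fdiff_uminus add_subgroup_uminus)
qed (auto simp: A_def)

text \<open>Turns a density 1 / n into an index \<open>p ^ n\<close>. This is far from sharp, but it
  keeps the number of dimensions polynomial.\<close>

lemma le_power_self: "2 \<le> (p::nat) \<Longrightarrow> n \<le> p ^ n"
  by (meson less_exp less_imp_le_nat order_trans power_mono zero_le)

lemma cubic_structure:
  fixes h :: "'a::ab_group_add \<Rightarrow> int"
  assumes V: "add_subgroup V" "finite V" and p: "2 \<le> p" "p \<le> N" and h: "deg_lt p V 4 h"
    and bias: "card V \<le> real N * cmod (\<Sum>x\<in>V. chr p (h x))"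
  obtains U where "index_le p (402 * N ^ 10) V U" "\<And>y. y \<in> V \<Longrightarrow> deg_lt p U 3 (\<lambda>x. h (y + x))"
proof -
  have "N > 0"
    using p by auto
  define A where "A = {a \<in> V. card V \<le> real (2 * N\<^sup>2) * cmod (\<Sum>x\<in>V. chr p (fdiff a h x))}"
  note A = biased_differences_symmetric[OF V(1) \<open>N > 0\<close>, where f = h and p = p, folded A_def]
  have dense: "card V \<le> 2 * N\<^sup>2 * card A"
    using many_biased_differences[OF V bias] by (simp add: A_def)
  \<comment> \<open>This is rank at most \<open>r\<close> for the difference in direction
    \<open>a\<close>. It is subadditive because the difference in direction \<open>a + b\<close> is
    a translate of the one in direction \<open>a\<close> plus the one in direction
    \<open>b\<close>.\<close>
  define P where "P r a \<longleftrightarrow> (\<exists>K. index_le p r V K \<and> (\<forall>u\<in>K. deg_lt p V 1 (fdiff u (fdiff a h))))" for r a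
  have P0: "P 0 0"
    using V by (auto simp: P_def fdiff_def intro!: exI[of _ V] index_le_refl)
  have PA: "P (4 * N ^ 4) a" if "a \<in> A" for a
  proof -
    have "deg_lt p V 3 (fdiff a h)"
      using h that A(1) by (auto simp: eval_nat_numeral)
    then have "card V \<le> (2 * N\<^sup>2)\<^sup>2 * card (kernel2 p V (fdiff a h))"
      using that p by (intro quadratic_structure[OF V]) (auto simp: A_def)
    also have "(2 * N\<^sup>2)\<^sup>2 = 4 * N ^ 4"
      by (simp add: power_mult_distrib flip: power_mult)
    also have "\<dots> * card (kernel2 p V (fdiff a h)) \<le> p ^ (4 * N ^ 4) * card (kernel2 p V (fdiff a h))"
      using le_power_self[OF p(1)] by (intro mult_le_mono1)
    finally have "index_le p (4 * N ^ 4) V (kernel2 p V (fdiff a h))"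
      using V by (simp add: index_le_def add_subgroup_kernel2 kernel2_subset)
    then show ?thesis
      unfolding P_def by (auto simp: kernel2_def)
  qed
  have P_add: "P (s + t) (a + b)" if "a \<in> V" "b \<in> V" and Pa: "P s a" and Pb: "P t b" for a b s t
  proof -
    obtain K L where K: "index_le p s V K" "\<forall>u\<in>K. deg_lt p V 1 (fdiff u (fdiff a h))"
      and L: "index_le p t V L" "\<forall>u\<in>L. deg_lt p V 1 (fdiff u (fdiff b h))"
      using Pa Pb by (auto simp: P_def)
    have "deg_lt p V 1 (fdiff u (fdiff (a + b) h))" if "u \<in> K \<inter> L" for u
    proof -
      have "fdiff u (fdiff (a + b) h) = (\<lambda>x. fdiff u (fdiff a h) (b + x) + fdiff u (fdiff b h) x)"
        by (simp add: fdiff_def fun_eq_iff add_ac)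
      then show ?thesis
        using K L that \<open>b \<in> V\<close> V by (auto intro!: deg_lt_add deg_lt_shift simp del: deg_lt.simps One_nat_def)
    qed
    then show ?thesis
      using index_le_Int[OF V K(1) L(1)] unfolding P_def by blast
  qed
  obtain W where W: "add_subgroup W" "W \<subseteq> V" "card V \<le> 2 * N\<^sup>2 * card W"
    and PW: "\<And>w. w \<in> W \<Longrightarrow> P (3 * (2 * N\<^sup>2) * (4 * N ^ 4)) w"
    using subadditive_property_on_subgroup[OF V A dense, of P, OF P0 PA P_add] by blast
  have "card V \<le> p ^ (2 * N\<^sup>2) * card W"
    using W(3) le_power_self[OF p(1), of "2 * N\<^sup>2"] by (meson le_trans mult_le_mono1)
  then have idxW: "index_le p (2 * N\<^sup>2) V W"
    using W by (simp add: index_le_def)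
  have finW: "finite W"
    using W V finite_subset by auto
  obtain y0 where y0: "y0 \<in> V" "card W \<le> real N * cmod (\<Sum>w\<in>W. chr p (h (y0 + w)))"
    using coset_biased[OF V W(2) bias] .
  define f where "f x = h (y0 + x)" for x
  \<comment> \<open>The factor 16 makes the exceptional set at most 1/16 of \<open>W\<close>, below
    the 1/8 allowed by \<open>deg_lt_vanish\<close> for a function of degree 3.\<close>
  define k where "k = 16 * p\<^sup>2 * N\<^sup>2"
  have "p > 0"
    using p by auto
  obtain a B where a: "\<And>i. i < k \<Longrightarrow> a i \<in> W" and B: "B \<subseteq> W" "k * card B \<le> p\<^sup>2 * N\<^sup>2 * card W"
    and det: "\<And>x y. x \<in> W - B \<Longrightarrow> y \<in> W - B \<Longrightarrow>
      (\<And>i. i < k \<Longrightarrow> int p dvd fdiff (a i) f x - fdiff (a i) f y) \<Longrightarrow> int p dvd f x - f y"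
    using differences_determine[OF W(1) finW \<open>p > 0\<close>, of N f k] y0(2) unfolding f_def by blast
  have "p\<^sup>2 * N\<^sup>2 * (16 * card B) \<le> p\<^sup>2 * N\<^sup>2 * card W"
    using B(2) by (simp add: k_def mult_ac)
  then have B16: "16 * card B \<le> card W"
    using \<open>p > 0\<close> \<open>N > 0\<close> by simp
  have "\<forall>i. \<exists>K. i < k \<longrightarrow> index_le p (24 * N ^ 6) V K \<and> (\<forall>u\<in>K. deg_lt p V 1 (fdiff u (fdiff (a i) h)))"
    using PW a by (simp add: P_def)
  then obtain K where K: "\<And>i. i < k \<Longrightarrow> index_le p (24 * N ^ 6) V (K i)"
    and Kdeg: "\<And>i u. i < k \<Longrightarrow> u \<in> K i \<Longrightarrow> deg_lt p V 1 (fdiff u (fdiff (a i) h))"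
    by metis
  define U1 where "U1 = W \<inter> (V \<inter> (\<Inter>i\<in>{..<k}. K i))"
  have U1: "index_le p (2 * N\<^sup>2 + card {..<k} * (24 * N ^ 6)) V U1"
    unfolding U1_def by (intro index_le_Int idxW V index_le_INT) (use K in auto)
  have fconst: "int p dvd fdiff u (fdiff (a i) f) x - fdiff u (fdiff (a i) f) 0"
    if "u \<in> U1" "i < k" "x \<in> V" for u i x
  proof -
    have "deg_lt p V 1 (\<lambda>x. fdiff u (fdiff (a i) h) (y0 + x))"
      using that Kdeg V y0 by (intro deg_lt_shift) (auto simp: U1_def)
    then have "deg_lt p V (Suc 0) (fdiff u (fdiff (a i) f))"
      by (simp only: f_def[abs_def] fdiff_shift One_nat_def)
    then show ?thesis
      using deg_lt_1_iff[OF V(1)] that by blast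
  qed
  \<comment> \<open>For \<open>u\<close> in \<open>U1\<close> the difference of
    \<open>fdiff (a i) f\<close> in direction \<open>u\<close> is constant on \<open>V\<close>, and
    this constant is additive in \<open>u\<close>. On its kernel \<open>U\<close> the sampled
    differences themselves become constant on cosets.\<close>
  define U where "U = {u \<in> U1. \<forall>i\<in>{..<k}. int p dvd fdiff u (fdiff (a i) f) 0}"
  have subU1: "add_subgroup U1" "U1 \<subseteq> V" "finite U1"
    using U1 V finite_subset by (auto simp: index_le_def)
  have U: "index_le p (card {..<k}) U1 U"
    unfolding U_def
  proof (rule index_le_kernel)
    fix i x y assume i: "i \<in> {..<k}" and xy: "x \<in> U1" "y \<in> U1"
    then have "x - y \<in> V"
      using subU1 by (auto intro: add_subgroup_diff[OF V(1)])
    then have "int p dvd - (fdiff y (fdiff (a i) f) (x - y) - fdiff y (fdiff (a i) f) 0)"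
      using fconst[OF xy(2), of i "x - y"] i by (simp only: dvd_minus_iff lessThan_iff)
    also have "- (fdiff y (fdiff (a i) f) (x - y) - fdiff y (fdiff (a i) f) 0) =
        fdiff (x - y) (fdiff (a i) f) 0 - (fdiff x (fdiff (a i) f) 0 - fdiff y (fdiff (a i) f) 0)"
      by (simp add: fdiff_def)
    finally show "int p dvd fdiff (x - y) (fdiff (a i) f) 0 -
        (fdiff x (fdiff (a i) f) 0 - fdiff y (fdiff (a i) f) 0)" .
  qed (use subU1 \<open>p > 0\<close> in auto)
  have subU: "add_subgroup U" "U \<subseteq> U1" "U \<subseteq> W" "U \<subseteq> V" "finite U"
    using U W subU1 finite_subset[of U U1] by (auto simp: index_le_def U1_def)
  obtain z where z: "z \<in> W" "16 * card {u \<in> U. z + u \<in> B} \<le> card U"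
    using coset_density[OF W(1) finW subU(3) B(1) B16] .
  have "card U > 0"
    by (rule add_subgroup_card_pos[OF subU(1,5)])
  have "\<exists>u0\<in>U. z + u0 \<notin> B"
  proof (rule ccontr)
    assume "\<not> ?thesis"
    then have "{u \<in> U. z + u \<in> B} = U"
      by auto
    then show False
      using z(2) \<open>card U > 0\<close> by simp
  qed
  then obtain u0 where u0: "u0 \<in> U" "z + u0 \<notin> B"
    by auto
  have good: "int p dvd f (z + u) - f (z + u0)" if u: "u \<in> U" "z + u \<notin> B" for u
  proof (rule det)
    show "z + u \<in> W - B" "z + u0 \<in> W - B"
      using u u0 z subU W by (auto intro: add_subgroup_add)
    fix i assume i: "i < k"
    have *: "int p dvd fdiff w (fdiff (a i) f) z" if w: "w \<in> U" for w
    proof -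
      have "int p dvd fdiff w (fdiff (a i) f) z - fdiff w (fdiff (a i) f) 0"
        using w i z subU W by (intro fconst) auto
      moreover have "int p dvd fdiff w (fdiff (a i) f) 0"
        using w i by (auto simp: U_def)
      ultimately show ?thesis
        by (metis dvd_add diff_add_cancel)
    qed
    have "fdiff (a i) f (z + u) - fdiff (a i) f (z + u0) =
        fdiff u (fdiff (a i) f) z - fdiff u0 (fdiff (a i) f) z"
      by (simp add: fdiff_def)
    then show "int p dvd fdiff (a i) f (z + u) - fdiff (a i) f (z + u0)"
      using *[OF u(1)] *[OF u0(1)] by simp
  qed
  have f4: "deg_lt p U 4 (\<lambda>u. f (z + u))"
  proof -
    have "y0 + z \<in> V"
      using y0 z W V by (auto intro: add_subgroup_add)
    then have "deg_lt p U 4 (\<lambda>u. h ((y0 + z) + u))"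
      by (rule deg_lt_coset[OF h V(1) subU(1,4)])
    then show ?thesis
      by (simp add: f_def add.assoc)
  qed
  have "int p dvd f (z + u) - f (z + u0)" if u: "u \<in> U" for u
  proof (rule deg_lt_vanish[where d = 3 and f = "\<lambda>u. f (z + u) - f (z + u0)", OF subU(1,5) _ _ u])
    show "deg_lt p U (Suc 3) (\<lambda>u. f (z + u) - f (z + u0))"
      using deg_lt_diff[OF f4, of "\<lambda>_. f (z + u0)"] deg_lt_const[of p U 3] by (simp only: numeral_eq_Suc) simp
    have "card {u \<in> U. \<not> int p dvd f (z + u) - f (z + u0)} \<le> card {u \<in> U. z + u \<in> B}"
      using good subU by (intro card_mono) auto
    then show "2 ^ 3 * card {u \<in> U. \<not> int p dvd f (z + u) - f (z + u0)} < card U"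
      using z(2) \<open>card U > 0\<close> by simp
  qed
  then have "deg_lt p U (Suc 0) (\<lambda>u. f (z + u))"
    by (intro deg_lt_congI[OF deg_lt_const subU(1)])
  then have "deg_lt p U 3 (\<lambda>u. f (z + u))"
    by (rule deg_lt_mono[OF subU(1)]) simp
  then have f3: "deg_lt p U 3 (\<lambda>u. h ((y0 + z) + u))"
    by (simp only: f_def add.assoc)
  have "deg_lt p U 3 (\<lambda>x. h (y + x))" if "y \<in> V" for y
    by (rule deg_lt_all_cosets[OF V(1) subU(1,4) _ that _ f3])
       (use h y0 z W V in \<open>auto intro: add_subgroup_add simp: eval_nat_numeral\<close>)
  moreover have "index_le p (402 * N ^ 10) V U"
  proof (rule index_le_mono[OF index_le_trans[OF U1 U]])
    have "p\<^sup>2 \<le> N\<^sup>2"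
      using p by (intro power_mono) auto
    then have "16 * (p\<^sup>2 * N\<^sup>2) \<le> 16 * (N\<^sup>2 * N\<^sup>2)"
      by (intro mult_le_mono) auto
    then have k: "k \<le> 16 * N ^ 4"
      by (simp add: k_def mult.assoc flip: power_add)
    have mono: "N ^ i \<le> N ^ 10" if "i \<le> 10" for i
      using that \<open>N > 0\<close> by (intro power_increasing) auto
    have "k * (24 * N ^ 6) \<le> (16 * N ^ 4) * (24 * N ^ 6)"
      by (intro mult_le_mono1 k)
    also have "\<dots> = 384 * N ^ 10"
      by (simp flip: power_add)
    \<comment> \<open>With \<open>k\<close> at most 16 N^4 the three summands are bounded by 2, 384
      and 16 times N^10, which gives 402.\<close>
    finally show "2 * N\<^sup>2 + card {..<k} * (24 * N ^ 6) + card {..<k} \<le> 402 * N ^ 10"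
      using k mono[of 2] mono[of 4] by simp
  qed (use p in auto)
  ultimately show ?thesis
    using that by blast
qed

subsection \<open>Quartic functions are determined by few quadratic functions\<close>

text \<open>The pattern of \<open>cubic_structure\<close>, except that the sampled differences
  become quadratic on cosets rather than constant. Biased differences have bias at least 1 / (2
  N^2), so \<open>2 * N\<^sup>2\<close> replaces \<open>N\<close> in the bound for cubic functions,
  and \<open>6 * N\<^sup>2\<close> is the length of the sumset. The factor 100 in \<open>k\<close>
  is chosen for the 31 vertices of a five-dimensional cube other than its base point.\<close>

lemma quartic_determined_by_quadratics:
  fixes h :: "'a::ab_group_add \<Rightarrow> int"
  assumes V: "add_subgroup V" "finite V" and p: "2 \<le> p" "p \<le> N" and h: "deg_lt p V 5 h"
    and bias: "card V \<le> real N * cmod (\<Sum>x\<in>V. chr p (h x))"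
  defines "k \<equiv> 100 * p\<^sup>2 * N\<^sup>2"
  obtains U z q B where "index_le p (2 * N\<^sup>2 + k * (6 * N\<^sup>2 * (402 * (2 * N\<^sup>2) ^ 10))) V U" "z \<in> V"
    "\<And>i. i < k \<Longrightarrow> deg_lt p U 3 (q i)" "B \<subseteq> U" "100 * card B \<le> card U"
    "\<And>x y. x \<in> U - B \<Longrightarrow> y \<in> U - B \<Longrightarrow>
      (\<And>i. i < k \<Longrightarrow> int p dvd q i x - q i y) \<Longrightarrow> int p dvd h (z + x) - h (z + y)"
proof -
  have "N > 0" "p > 0"
    using p by auto
  have "N \<le> 2 * N\<^sup>2"
    using \<open>N > 0\<close> by (simp add: power2_eq_square)
  then have pN: "p \<le> 2 * N\<^sup>2"
    using p by linarith
  define A where "A = {a \<in> V. card V \<le> real (2 * N\<^sup>2) * cmod (\<Sum>x\<in>V. chr p (fdiff a h x))}"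
  note A = biased_differences_symmetric[OF V(1) \<open>N > 0\<close>, where f = h and p = p, folded A_def]
  have dense: "card V \<le> 2 * N\<^sup>2 * card A"
    using many_biased_differences[OF V bias] by (simp add: A_def)
  define r where "r = 402 * (2 * N\<^sup>2) ^ 10"
  \<comment> \<open>A single \<open>K\<close> has to serve all cosets, because adding a direction
    \<open>b\<close> moves the base point from \<open>y\<close> to \<open>y + b\<close>.\<close>
  define P where "P r a \<longleftrightarrow> (\<exists>K. index_le p r V K \<and> (\<forall>y\<in>V. deg_lt p K 3 (\<lambda>x. fdiff a h (y + x))))" for r a
  have P0: "P 0 0"
    using V by (auto simp: P_def fdiff_def intro!: exI[of _ V] index_le_refl simp del: deg_lt.simps)
  have PA: "P r a" if "a \<in> A" for a
  proof -
    have a4: "deg_lt p V 4 (fdiff a h)"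
      using h that A(1) by (auto simp: eval_nat_numeral)
    have biasa: "card V \<le> real (2 * N\<^sup>2) * cmod (\<Sum>x\<in>V. chr p (fdiff a h x))"
      using that by (simp add: A_def)
    obtain K where "index_le p r V K" "\<And>y. y \<in> V \<Longrightarrow> deg_lt p K 3 (\<lambda>x. fdiff a h (y + x))"
      using cubic_structure[OF V p(1) pN a4 biasa] unfolding r_def by blast
    then show ?thesis
      unfolding P_def by blast
  qed
  have P_add: "P (s + t) (a + b)" if "a \<in> V" "b \<in> V" and Pa: "P s a" and Pb: "P t b" for a b s t
  proof -
    obtain K L where K: "index_le p s V K" "\<And>y. y \<in> V \<Longrightarrow> deg_lt p K 3 (\<lambda>x. fdiff a h (y + x))"
      and L: "index_le p t V L" "\<And>y. y \<in> V \<Longrightarrow> deg_lt p L 3 (\<lambda>x. fdiff b h (y + x))"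
      using Pa Pb by (auto simp: P_def)
    have sub: "add_subgroup K" "add_subgroup L"
      using K L by (auto intro: index_le_subgroup)
    have "deg_lt p (K \<inter> L) 3 (\<lambda>x. fdiff (a + b) h (y + x))" if y: "y \<in> V" for y
    proof -
      have "y + b \<in> V"
        using y \<open>b \<in> V\<close> V by (auto intro: add_subgroup_add)
      have "(\<lambda>x. fdiff (a + b) h (y + x)) = (\<lambda>x. fdiff a h ((y + b) + x) + fdiff b h (y + x))"
        by (simp add: fdiff_def fun_eq_iff add_ac)
      moreover have "deg_lt p (K \<inter> L) 3 (\<lambda>x. fdiff a h ((y + b) + x))"
        using K(2)[OF \<open>y + b \<in> V\<close>] sub(1) add_subgroup_Int[OF sub] by (rule deg_lt_subset) simp
      moreover have "deg_lt p (K \<inter> L) 3 (\<lambda>x. fdiff b h (y + x))"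
        using L(2)[OF y] sub(2) add_subgroup_Int[OF sub] by (rule deg_lt_subset) simp
      ultimately show ?thesis
        by (simp only: deg_lt_add)
    qed
    then show ?thesis
      using index_le_Int[OF V K(1) L(1)] unfolding P_def by blast
  qed
  obtain W where W: "add_subgroup W" "W \<subseteq> V" "card V \<le> 2 * N\<^sup>2 * card W"
    and PW: "\<And>w. w \<in> W \<Longrightarrow> P (3 * (2 * N\<^sup>2) * r) w"
    using subadditive_property_on_subgroup[OF V A dense, of P, OF P0 PA P_add] by blast
  have "card V \<le> p ^ (2 * N\<^sup>2) * card W"
    using W(3) le_power_self[OF p(1), of "2 * N\<^sup>2"] by (meson le_trans mult_le_mono1)
  then have idxW: "index_le p (2 * N\<^sup>2) V W"
    using W by (simp add: index_le_def)
  have finW: "finite W"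
    using W V finite_subset by auto
  obtain y0 where y0: "y0 \<in> V" "card W \<le> real N * cmod (\<Sum>w\<in>W. chr p (h (y0 + w)))"
    using coset_biased[OF V W(2) bias] .
  define f where "f x = h (y0 + x)" for x
  obtain a B where a: "\<And>i. i < k \<Longrightarrow> a i \<in> W" and B: "B \<subseteq> W" "k * card B \<le> p\<^sup>2 * N\<^sup>2 * card W"
    and det: "\<And>x y. x \<in> W - B \<Longrightarrow> y \<in> W - B \<Longrightarrow>
      (\<And>i. i < k \<Longrightarrow> int p dvd fdiff (a i) f x - fdiff (a i) f y) \<Longrightarrow> int p dvd f x - f y"
    using differences_determine[OF W(1) finW \<open>p > 0\<close>, of N f k] y0(2) unfolding f_def by blast
  have "p\<^sup>2 * N\<^sup>2 * (100 * card B) \<le> p\<^sup>2 * N\<^sup>2 * card W"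
    using B(2) by (simp add: k_def mult_ac)
  then have B100: "100 * card B \<le> card W"
    using \<open>p > 0\<close> \<open>N > 0\<close> by simp
  have "\<forall>i. \<exists>K. i < k \<longrightarrow> index_le p (6 * N\<^sup>2 * r) V K \<and> (\<forall>y\<in>V. deg_lt p K 3 (\<lambda>x. fdiff (a i) h (y + x)))"
    using PW a by (simp add: P_def)
  then obtain K where K: "\<And>i. i < k \<Longrightarrow> index_le p (6 * N\<^sup>2 * r) V (K i)"
    and Kdeg: "\<And>i y. i < k \<Longrightarrow> y \<in> V \<Longrightarrow> deg_lt p (K i) 3 (\<lambda>x. fdiff (a i) h (y + x))"
    by metis
  define U where "U = W \<inter> (V \<inter> (\<Inter>i\<in>{..<k}. K i))"
  have U: "index_le p (2 * N\<^sup>2 + card {..<k} * (6 * N\<^sup>2 * r)) V U"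
    unfolding U_def by (intro index_le_Int idxW V index_le_INT) (use K in auto)
  have subU: "add_subgroup U" "U \<subseteq> W"
    using U by (auto simp: index_le_def U_def)
  obtain z where z: "z \<in> W" "100 * card {u \<in> U. z + u \<in> B} \<le> card U"
    using coset_density[OF W(1) finW subU(2) B(1) B100] .
  have yz: "y0 + z \<in> V"
    using y0 z W V by (auto intro: add_subgroup_add)
  show ?thesis
  proof (rule that[of U "y0 + z" "\<lambda>i x. fdiff (a i) h ((y0 + z) + x)" "{u \<in> U. z + u \<in> B}"])
    show "index_le p (2 * N\<^sup>2 + k * (6 * N\<^sup>2 * (402 * (2 * N\<^sup>2) ^ 10))) V U"
      using U by (simp only: r_def card_lessThan)
    show "deg_lt p U 3 (\<lambda>x. fdiff (a i) h (y0 + z + x))" if "i < k" for i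
      by (rule deg_lt_subset[OF Kdeg[OF that yz] index_le_subgroup[OF K[OF that]] subU(1)])
         (use that in \<open>auto simp: U_def\<close>)
    fix x y
    assume x: "x \<in> U - {u \<in> U. z + u \<in> B}" and y: "y \<in> U - {u \<in> U. z + u \<in> B}"
      and eq: "\<And>i. i < k \<Longrightarrow> int p dvd fdiff (a i) h (y0 + z + x) - fdiff (a i) h (y0 + z + y)"
    have "int p dvd f (z + x) - f (z + y)"
    proof (rule det)
      show "z + x \<in> W - B" "z + y \<in> W - B"
        using x y subU z W by (auto intro: add_subgroup_add)
    qed (use eq in \<open>simp add: fdiff_def f_def add.assoc\<close>)
    then show "int p dvd h (y0 + z + x) - h (y0 + z + y)"
      by (simp add: f_def add.assoc)
  qed (use yz z in auto)
qed

text \<open>The usual condition that all nontrivial combinations of a family of quadratic functions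
  have rank at least \<open>s\<close>, expressed through the index of the radical.\<close>

definition regular :: "nat \<Rightarrow> nat \<Rightarrow> 'a::ab_group_add set \<Rightarrow> nat set \<Rightarrow> (nat \<Rightarrow> 'a \<Rightarrow> int) \<Rightarrow> bool" where
  "regular p s U J q \<longleftrightarrow> (\<forall>c. (\<exists>i\<in>J. \<not> int p dvd c i) \<longrightarrow>
    p ^ s * card (kernel2 p U (\<lambda>x. \<Sum>i\<in>J. c i * q i x)) \<le> card U)"

text \<open>A combination of small rank becomes constant on a large subgroup, so that one of the
  quadratic functions involved becomes superfluous.\<close>
lemma regularise:
  fixes f :: "'a::ab_group_add \<Rightarrow> int"
  assumes "finite I" "prime p"
    and "add_subgroup U" "finite U" "\<And>i. i \<in> I \<Longrightarrow> deg_lt p U 3 (q i)"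
    and "B \<subseteq> U" "c * card B \<le> card U"
    and "\<And>x y. x \<in> U - B \<Longrightarrow> y \<in> U - B \<Longrightarrow> (\<And>i. i \<in> I \<Longrightarrow> int p dvd q i x - q i y) \<Longrightarrow>
      int p dvd f x - f y"
  shows "\<exists>U' z J B'. index_le p (card I * Suc s) U U' \<and> z \<in> U \<and> J \<subseteq> I \<and>
    B' \<subseteq> U' \<and> c * card B' \<le> card U' \<and> regular p s U' J (\<lambda>i x. q i (z + x)) \<and>
    (\<forall>x\<in>U' - B'. \<forall>y\<in>U' - B'. (\<forall>i\<in>J. int p dvd q i (z + x) - q i (z + y)) \<longrightarrow>
      int p dvd f (z + x) - f (z + y))"
  using assms
proof (induction "card I" arbitrary: I U q B f rule: less_induct)
  case less
  note U = less.prems(3,4)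
  have p: "p > 1"
    using less.prems(2) by (rule prime_gt_1_nat)
  show ?case
  proof (cases "regular p s U I q")
    case True
    then show ?thesis
      using less.prems(3,6-8) p
      by (intro exI[of _ U] exI[of _ 0] exI[of _ I] exI[of _ B])
         (auto simp: add_subgroup_zero intro: index_le_mono[OF index_le_refl])
  next
    case False
    then obtain e i0 where i0: "i0 \<in> I" "\<not> int p dvd e i0"
      and small: "card U < p ^ s * card (kernel2 p U (\<lambda>x. \<Sum>i\<in>I. e i * q i x))"
      unfolding regular_def by (meson linorder_not_le)
    define g where "g x = (\<Sum>i\<in>I. e i * q i x)" for x
    define K where "K = kernel2 p U g"
    have K: "index_le p s U K"
      using small U by (auto simp: index_le_def K_def g_def[abs_def] add_subgroup_kernel2 kernel2_subset)
    have g_diff: "int p dvd fdiff u g x - fdiff u g 0" if "u \<in> K" "x \<in> U" for u x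
    proof -
      have "deg_lt p U (Suc 0) (fdiff u g)"
        using that by (simp add: K_def kernel2_def)
      then show ?thesis
        using deg_lt_1_iff[OF U(1)] that by blast
    qed
    have subK: "add_subgroup K" "K \<subseteq> U" "finite K"
      using K U finite_subset by (auto simp: index_le_def)
    \<comment> \<open>On \<open>K\<close> the differences of \<open>g\<close> are constant, and
      their value is additive in the direction. The one-element index set only fits this single
      condition into \<open>index_le_kernel\<close>; it costs one dimension, whence
      \<open>Suc s\<close>.\<close>
    define U1 where "U1 = {u \<in> K. \<forall>i\<in>{0::nat}. int p dvd fdiff u g 0}"
    have "index_le p (card {0::nat}) K U1"
      unfolding U1_def
    proof (rule index_le_kernel[where h = "\<lambda>i u. fdiff u g 0"])
      fix x y assume xy: "x \<in> K" "y \<in> K"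
      then have "x - y \<in> U"
        using subK by (auto intro: add_subgroup_diff[OF U(1)])
      then have "int p dvd - (fdiff y g (x - y) - fdiff y g 0)"
        using g_diff[OF xy(2), of "x - y"] by (simp only: dvd_minus_iff)
      also have "- (fdiff y g (x - y) - fdiff y g 0) = fdiff (x - y) g 0 - (fdiff x g 0 - fdiff y g 0)"
        by (simp add: fdiff_def)
      finally show "int p dvd fdiff (x - y) g 0 - (fdiff x g 0 - fdiff y g 0)" .
    qed (use subK p in auto)
    then have U1: "index_le p (Suc s) U U1"
      using index_le_trans[OF K, of 1 U1] by simp
    have subU1: "add_subgroup U1" "U1 \<subseteq> U" "finite U1"
      using U1 U finite_subset by (auto simp: index_le_def)
    obtain z where z: "z \<in> U" "c * card {u \<in> U1. z + u \<in> B} \<le> card U1"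
      using coset_density[OF U subU1(2) less.prems(6,7)] .
    define B1 where "B1 = {u \<in> U1. z + u \<in> B}"
    have g_const: "int p dvd g (z + x) - g z" if "x \<in> U1" for x
    proof -
      have "int p dvd (fdiff x g z - fdiff x g 0) + fdiff x g 0"
        using that z by (intro dvd_add g_diff) (auto simp: U1_def)
      then show ?thesis
        by (simp add: fdiff_def)
    qed
    have "\<exists>U' z' J B'. index_le p (card (I - {i0}) * Suc s) U1 U' \<and> z' \<in> U1 \<and> J \<subseteq> I - {i0} \<and>
      B' \<subseteq> U' \<and> c * card B' \<le> card U' \<and> regular p s U' J (\<lambda>i x. q i (z + (z' + x))) \<and>
      (\<forall>x\<in>U' - B'. \<forall>y\<in>U' - B'. (\<forall>i\<in>J. int p dvd q i (z + (z' + x)) - q i (z + (z' + y))) \<longrightarrow>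
        int p dvd f (z + (z' + x)) - f (z + (z' + y)))"
    proof (rule less.hyps[where q = "\<lambda>i x. q i (z + x)" and f = "\<lambda>x. f (z + x)" and B = B1])
      show "card (I - {i0}) < card I"
        using i0 less.prems(1) by (intro psubset_card_mono) auto
      show "deg_lt p U1 3 (\<lambda>x. q i (z + x))" if "i \<in> I - {i0}" for i
        using that subU1 z U by (intro deg_lt_coset[OF less.prems(5) U(1)]) auto
      fix x y
      assume x: "x \<in> U1 - B1" and y: "y \<in> U1 - B1"
        and eq: "\<And>i. i \<in> I - {i0} \<Longrightarrow> int p dvd q i (z + x) - q i (z + y)"
      have "int p dvd (g (z + x) - g z) - (g (z + y) - g z)"
        using x y by (intro dvd_diff g_const) auto
      also have "(g (z + x) - g z) - (g (z + y) - g z) = (\<Sum>i\<in>I. e i * (q i (z + x) - q i (z + y)))"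
        by (simp add: g_def sum_subtractf right_diff_distrib)
      also have "\<dots> = e i0 * (q i0 (z + x) - q i0 (z + y)) +
          (\<Sum>i\<in>I - {i0}. e i * (q i (z + x) - q i (z + y)))"
        using i0 less.prems(1) by (simp add: sum.remove)
      finally have sum: "int p dvd \<dots>" .
      have "int p dvd (\<Sum>i\<in>I - {i0}. e i * (q i (z + x) - q i (z + y)))"
        by (intro dvd_sum dvd_mult eq)
      \<comment> \<open>Constancy of \<open>g\<close> on \<open>z + U1\<close> and agreement of the
        other functions leave only the term of \<open>i0\<close>, whose coefficient is invertible
        modulo the prime \<open>p\<close>. So \<open>q i0\<close> is determined by the rest.\<close>
      with sum have "int p dvd e i0 * (q i0 (z + x) - q i0 (z + y))"
        by (simp only: dvd_add_left_iff)
      then have "int p dvd q i0 (z + x) - q i0 (z + y)"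
        using i0(2) less.prems(2) by (simp add: prime_dvd_mult_iff)
      with eq have "int p dvd q i (z + x) - q i (z + y)" if "i \<in> I" for i
        using that by (cases "i = i0") auto
      then show "int p dvd f (z + x) - f (z + y)"
        using x y z subU1 by (intro less.prems(8)) (auto simp: B1_def intro: add_subgroup_add[OF U(1)])
    qed (use less.prems(1,2) subU1 z in \<open>auto simp: B1_def\<close>)
    then obtain U' z' J B' where IH: "index_le p (card (I - {i0}) * Suc s) U1 U'" "z' \<in> U1"
      "J \<subseteq> I - {i0}" "B' \<subseteq> U'" "c * card B' \<le> card U'"
      "regular p s U' J (\<lambda>i x. q i (z + (z' + x)))"
      "\<forall>x\<in>U' - B'. \<forall>y\<in>U' - B'. (\<forall>i\<in>J. int p dvd q i (z + (z' + x)) - q i (z + (z' + y))) \<longrightarrow>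
        int p dvd f (z + (z' + x)) - f (z + (z' + y))"
      by blast
    have "Suc s + card (I - {i0}) * Suc s = card I * Suc s"
      using i0 less.prems(1) card_Suc_Diff1[of I i0] by (metis mult_Suc)
    then have "index_le p (card I * Suc s) U U'"
      using index_le_trans[OF U1 IH(1)] by simp
    moreover have "z + z' \<in> U"
      using z IH(2) subU1 by (auto intro: add_subgroup_add[OF U(1)])
    ultimately show ?thesis
      using IH(3-7) by (intro exI[of _ U'] exI[of _ "z + z'"] exI[of _ J] exI[of _ B'])
        (auto simp: add.assoc)
  qed
qed

subsection \<open>Equidistribution of regular families of quadratic functions\<close>

text \<open>The mixed second difference at the origin. For quadratic \<open>g\<close> it is the
  bilinear form attached to \<open>g\<close>, in a normalisation that works for
  \<open>p = 2\<close>.\<close>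

definition polar :: "('a::ab_group_add \<Rightarrow> int) \<Rightarrow> 'a \<Rightarrow> 'a \<Rightarrow> int" where
  "polar g a b = g (a + b) - g a - g b + g 0"

lemma polar_0 [simp]: "polar g 0 b = 0" "polar g a 0 = 0"
  by (simp_all add: polar_def)

lemma kernel2_iff:
  assumes "add_subgroup V"
  shows "u \<in> kernel2 p V g \<longleftrightarrow> u \<in> V \<and> (\<forall>b\<in>V. int p dvd polar g u b)"
proof -
  have "fdiff u g b - fdiff u g 0 = polar g u b" for b
    by (simp add: polar_def fdiff_def add.commute)
  then show ?thesis
    using deg_lt_1_iff[OF assms, of p "fdiff u g"] by (auto simp: kernel2_def simp del: deg_lt.simps)
qed

lemma fdiff_fdiff_polar:
  assumes "add_subgroup V" "deg_lt p V 3 g" "a \<in> V" "b \<in> V" "x \<in> V"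
  shows "int p dvd fdiff b g (x + a) - fdiff b g x - polar g a b"
proof -
  have "deg_lt p V (Suc 0) (fdiff a (fdiff b g))"
    using assms by (simp add: eval_nat_numeral)
  then have "int p dvd fdiff a (fdiff b g) x - fdiff a (fdiff b g) 0"
    using deg_lt_1_iff[OF assms(1)] assms(5) by blast
  moreover have "fdiff a (fdiff b g) x - fdiff a (fdiff b g) 0 =
      fdiff b g (x + a) - fdiff b g x - polar g a b"
    by (simp add: fdiff_def polar_def algebra_simps)
  ultimately show ?thesis
    by simp
qed

lemma polar_add_left:
  assumes "add_subgroup V" "deg_lt p V 3 g" "a \<in> V" "a' \<in> V" "b \<in> V"
  shows "int p dvd polar g (a + a') b - (polar g a b + polar g a' b)"
proof -
  have "int p dvd fdiff b g (a' + a) - fdiff b g a' - polar g a b"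
    by (rule fdiff_fdiff_polar[OF assms(1-3,5,4)])
  moreover have "fdiff b g (a' + a) - fdiff b g a' - polar g a b =
      polar g (a + a') b - (polar g a b + polar g a' b)"
    by (simp add: fdiff_def polar_def algebra_simps)
  ultimately show ?thesis
    by simp
qed

lemma polar_sum_left:
  assumes V: "add_subgroup V" and g: "deg_lt p V 3 g" and "finite S" "\<And>j. j \<in> S \<Longrightarrow> a j \<in> V" and b: "b \<in> V"
  shows "int p dvd polar g (\<Sum>j\<in>S. a j) b - (\<Sum>j\<in>S. polar g (a j) b)"
  using assms(3,4)
proof (induction S rule: finite_induct)
  case (insert k S)
  have "int p dvd polar g (a k + (\<Sum>j\<in>S. a j)) b - (polar g (a k) b + polar g (\<Sum>j\<in>S. a j) b)"
    using insert by (intro polar_add_left[OF V g _ _ b] add_subgroup_sum[OF V]) auto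
  moreover have "int p dvd polar g (\<Sum>j\<in>S. a j) b - (\<Sum>j\<in>S. polar g (a j) b)"
    using insert by simp
  ultimately have "int p dvd (polar g (a k + (\<Sum>j\<in>S. a j)) b - (polar g (a k) b + polar g (\<Sum>j\<in>S. a j) b))
      + (polar g (\<Sum>j\<in>S. a j) b - (\<Sum>j\<in>S. polar g (a j) b))"
    by (rule dvd_add)
  then show ?case
    using insert by (simp add: algebra_simps)
qed simp

text \<open>Adding a direction to a vertex changes \<open>g\<close> by its change at the base point
  plus the polar form with the earlier directions, which splits by additivity. Adding directions in
  increasing order counts each pair once.\<close>

lemma quadratic_cube:
  fixes a :: "nat \<Rightarrow> 'a::ab_group_add"
  assumes V: "add_subgroup V" and g: "deg_lt p V 3 g" and x: "x \<in> V"
    and "finite S" "\<And>j. j \<in> S \<Longrightarrow> a j \<in> V"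
  shows "int p dvd g (x + (\<Sum>j\<in>S. a j)) -
    (g x + (\<Sum>j\<in>S. g (x + a j) - g x) + (\<Sum>l\<in>S. \<Sum>j\<in>{j \<in> S. j < l}. polar g (a j) (a l)))"
  using assms(4,5)
proof (induction S rule: finite_linorder_max_induct)
  case (insert k S)
  let ?w = "\<Sum>j\<in>S. a j"
  let ?T = "\<Sum>l\<in>S. \<Sum>j\<in>{j \<in> S. j < l}. polar g (a j) (a l)"
  have k: "k \<notin> S"
    using insert by auto
  have w: "?w \<in> V"
    using insert by (intro add_subgroup_sum[OF V]) auto
  have "{j \<in> insert k S. j < l} = {j \<in> S. j < l}" if "l \<in> S" for l
    using insert that by auto
  moreover have "{j \<in> insert k S. j < k} = S"
    using insert by auto
  ultimately have pairs: "(\<Sum>l\<in>insert k S. \<Sum>j\<in>{j \<in> insert k S. j < l}. polar g (a j) (a l)) =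
      (\<Sum>j\<in>S. polar g (a j) (a k)) + ?T"
    using insert k by simp
  have 1: "int p dvd fdiff (a k) g (x + ?w) - fdiff (a k) g x - polar g ?w (a k)"
    using insert by (intro fdiff_fdiff_polar[OF V g w _ x]) auto
  have 2: "int p dvd polar g ?w (a k) - (\<Sum>j\<in>S. polar g (a j) (a k))"
    using insert by (intro polar_sum_left[OF V g]) auto
  have 3: "int p dvd g (x + ?w) - (g x + (\<Sum>j\<in>S. g (x + a j) - g x) + ?T)"
    using insert by auto
  have "int p dvd (fdiff (a k) g (x + ?w) - fdiff (a k) g x - polar g ?w (a k)) +
      (polar g ?w (a k) - (\<Sum>j\<in>S. polar g (a j) (a k))) +
      (g (x + ?w) - (g x + (\<Sum>j\<in>S. g (x + a j) - g x) + ?T))"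
    using 1 2 3 by (intro dvd_add)
  also have "\<dots> = g (x + (\<Sum>j\<in>insert k S. a j)) - (g x + (\<Sum>j\<in>insert k S. g (x + a j) - g x) +
      ((\<Sum>j\<in>S. polar g (a j) (a k)) + ?T))"
    using insert k by (simp add: fdiff_def algebra_simps)
  finally show ?case
    by (simp only: pairs)
qed simp

lemma sum_Pow_insert:
  fixes F :: "'a set \<Rightarrow> 'b::comm_monoid_add"
  assumes "finite S" "k \<notin> S"
  shows "(\<Sum>R\<in>Pow (insert k S). F R) = (\<Sum>R\<in>Pow S. F R) + (\<Sum>R\<in>Pow S. F (insert k R))"
proof -
  have "inj_on (insert k) (Pow S)"
    using assms by (auto simp: inj_on_def)
  moreover have "Pow S \<inter> insert k ` Pow S = {}"
    using assms by auto
  ultimately show ?thesis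
    using assms by (simp add: Pow_insert sum.union_disjoint sum.reindex)
qed

text \<open>Up to sign the alternating sum is an iterated difference, one for each direction in
  \<open>S\<close>.\<close>

lemma cube_sum_vanishes:
  fixes a :: "nat \<Rightarrow> 'a::ab_group_add"
  assumes V: "add_subgroup V" and "finite S" "\<And>j. j \<in> S \<Longrightarrow> a j \<in> V" "x \<in> V"
    and "deg_lt p V (card S) f"
  shows "int p dvd (\<Sum>R\<in>Pow S. (- 1) ^ card R * f (x + (\<Sum>j\<in>R. a j)))"
  using assms(2-5)
proof (induction S arbitrary: f rule: finite_induct)
  case (insert k S)
  have fin: "finite R" "k \<notin> R" if "R \<in> Pow S" for R
    using that insert finite_subset by auto
  have "int p dvd - (\<Sum>R\<in>Pow S. (- 1) ^ card R * fdiff (a k) f (x + (\<Sum>j\<in>R. a j)))"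
    using insert by (simp only: dvd_minus_iff) (intro insert.IH; simp)
  also have "- (\<Sum>R\<in>Pow S. (- 1) ^ card R * fdiff (a k) f (x + (\<Sum>j\<in>R. a j))) =
      (\<Sum>R\<in>Pow S. (- 1) ^ card R * f (x + (\<Sum>j\<in>R. a j))) +
      (\<Sum>R\<in>Pow S. - ((- 1) ^ card R * f (x + (\<Sum>j\<in>R. a j) + a k)))"
    by (simp add: fdiff_def sum_subtractf sum_negf right_diff_distrib)
  also have "(\<Sum>R\<in>Pow S. - ((- 1) ^ card R * f (x + (\<Sum>j\<in>R. a j) + a k))) =
      (\<Sum>R\<in>Pow S. (- 1) ^ card (insert k R) * f (x + (\<Sum>j\<in>insert k R. a j)))"
    using fin by (intro sum.cong refl) (simp add: add_ac)
  finally show ?case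
    using insert by (simp add: sum_Pow_insert)
qed simp

lemma chr_sum: "chr p (\<Sum>j\<in>J. f j) = (\<Prod>j\<in>J. chr p (f j))"
  by (induction J rule: infinite_finite_induct) (simp_all add: chr_add)

text \<open>Fourier inversion on the residues of the values: the zero frequency contributes
  \<open>card T\<close>, and each of the fewer than \<open>p ^ card J\<close> others at most
  \<open>card T\<close> / (4 p^(card J)), so a quarter is lost in total. The exponent of
  \<open>p\<close> in the square of this saving is \<open>2 * card J\<close>, and the additional 4
  covers the factor 4, since \<open>p\<^sup>2\<close> is at least 4.\<close>

lemma equidistributed_of_small_sums:
  fixes \<psi> :: "'j \<Rightarrow> 't \<Rightarrow> int"
  assumes "prime p" "finite T" "finite J" and s: "2 * card J + 4 \<le> s"
    and small: "\<And>c. \<exists>j\<in>J. \<not> int p dvd c j \<Longrightarrow>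
      real p ^ s * (cmod (\<Sum>a\<in>T. chr p (\<Sum>j\<in>J. c j * \<psi> j a)))\<^sup>2 \<le> (real (card T))\<^sup>2"
  shows "3 * card T \<le> 4 * (p ^ card J * card {a \<in> T. \<forall>j\<in>J. int p dvd \<psi> j a - \<tau> j})"
proof -
  have p: "p \<ge> 2" "p > 0"
    using assms(1) prime_ge_2_nat prime_gt_0_nat by auto
  let ?N = "{a \<in> T. \<forall>j\<in>J. int p dvd \<psi> j a - \<tau> j}"
  let ?C = "PiE J (\<lambda>_. {..<p})"
  define S where "S c = (\<Sum>a\<in>T. chr p (\<Sum>j\<in>J. int (c j) * (\<psi> j a - \<tau> j)))" for c
  define c0 where "c0 = (\<lambda>j\<in>J. 0::nat)"
  have c0: "c0 \<in> ?C"
    using p by (auto simp: c0_def)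
  have finC: "finite ?C"
    using assms by (intro finite_PiE) auto
  have cardC: "card ?C = p ^ card J"
    using assms by (simp add: card_PiE)
  have S0: "S c0 = of_nat (card T)"
    by (simp add: S_def c0_def cong: sum.cong)
  have "(\<Sum>c\<in>?C. S c) = (\<Sum>a\<in>T. \<Sum>c\<in>?C. \<Prod>j\<in>J. chr p (int (c j) * (\<psi> j a - \<tau> j)))"
    unfolding S_def by (subst sum.swap) (simp add: chr_sum)
  also have "\<dots> = (\<Sum>a\<in>T. \<Prod>j\<in>J. \<Sum>k<p. chr p (int k * (\<psi> j a - \<tau> j)))"
    using assms by (subst prod_sum_PiE) auto
  also have "\<dots> = (\<Sum>a\<in>T. if a \<in> ?N then of_nat (p ^ card J) else 0)"
  proof (rule sum.cong[OF refl])
    fix a assume a: "a \<in> T"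
    show "(\<Prod>j\<in>J. \<Sum>k<p. chr p (int k * (\<psi> j a - \<tau> j))) = (if a \<in> ?N then of_nat (p ^ card J) else 0)"
    proof (cases "a \<in> ?N")
      case True
      then show ?thesis
        using p by (simp add: sum_chr_multiples)
    next
      case False
      then have "\<exists>j\<in>J. (\<Sum>k<p. chr p (int k * (\<psi> j a - \<tau> j))) = 0"
        using a p by (auto simp: sum_chr_multiples)
      then have "(\<Prod>j\<in>J. \<Sum>k<p. chr p (int k * (\<psi> j a - \<tau> j))) = 0"
        using assms by (intro prod_zero)
      then show ?thesis
        using False by (simp only: if_False)
    qed
  qed
  also have "\<dots> = (\<Sum>a\<in>{a \<in> T. a \<in> ?N}. of_nat (p ^ card J))"
    using assms(2) by (simp only: sum.inter_filter)
  also have "\<dots> = of_nat (p ^ card J * card ?N)"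
    by simp
  finally have total: "(\<Sum>c\<in>?C. S c) = of_nat (p ^ card J * card ?N)" .
  have bound: "cmod (S c) \<le> card T / (4 * real p ^ card J)" if c: "c \<in> ?C - {c0}" for c
  proof -
    have "\<exists>j\<in>J. c j \<noteq> 0"
    proof (rule ccontr)
      assume "\<not> ?thesis"
      then have "c = c0"
        using c by (auto simp: c0_def PiE_def extensional_def fun_eq_iff)
      then show False
        using c by simp
    qed
    then have nz: "\<exists>j\<in>J. \<not> int p dvd int (c j)"
      using c by (fastforce dest: PiE_mem dvd_imp_le)
    have "S c = chr p (- (\<Sum>j\<in>J. int (c j) * \<tau> j)) * (\<Sum>a\<in>T. chr p (\<Sum>j\<in>J. int (c j) * \<psi> j a))"
      by (simp add: S_def sum_distrib_left sum_subtractf algebra_simps flip: chr_add)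
    then have "cmod (S c) = cmod (\<Sum>a\<in>T. chr p (\<Sum>j\<in>J. int (c j) * \<psi> j a))"
      by (simp add: norm_mult)
    then have 1: "real p ^ s * (cmod (S c))\<^sup>2 \<le> (real (card T))\<^sup>2"
      using small[OF nz] by simp
    have "(4::real) \<le> real p ^ 2"
      using power_mono[of 2 "real p" 2] p by simp
    then have "(4 * real p ^ card J)\<^sup>2 \<le> (real p ^ 2 * real p ^ card J)\<^sup>2"
      using p by (intro power_mono mult_right_mono) auto
    also have "\<dots> = real p ^ (2 * card J + 4)"
      by (simp add: power_mult_distrib power_add mult.commute flip: power_mult)
    also have "\<dots> \<le> real p ^ s"
      using s p by (intro power_increasing) auto
    finally have "(4 * real p ^ card J)\<^sup>2 * (cmod (S c))\<^sup>2 \<le> real p ^ s * (cmod (S c))\<^sup>2"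
      by (rule mult_right_mono) simp
    also note 1
    finally have "(4 * real p ^ card J * cmod (S c))\<^sup>2 \<le> (real (card T))\<^sup>2"
      by (simp only: power_mult_distrib)
    then have "4 * real p ^ card J * cmod (S c) \<le> real (card T)"
      by (rule power2_le_imp_le) simp
    then show ?thesis
      using p by (simp add: field_simps)
  qed
  have "(\<Sum>c\<in>?C. S c) = S c0 + (\<Sum>c\<in>?C - {c0}. S c)"
    using c0 finC by (simp add: sum.remove)
  then have "of_nat (card T) = complex_of_real (real (p ^ card J * card ?N)) - (\<Sum>c\<in>?C - {c0}. S c)"
    unfolding total S0 by (simp add: algebra_simps)
  then have "real (card T) = cmod (complex_of_real (real (p ^ card J * card ?N)) - (\<Sum>c\<in>?C - {c0}. S c))"
    by (metis norm_of_nat)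
  also have "\<dots> \<le> real (p ^ card J * card ?N) + cmod (\<Sum>c\<in>?C - {c0}. S c)"
    by (rule order_trans[OF norm_triangle_ineq4]) (simp only: norm_of_real abs_of_nat)
  also have "cmod (\<Sum>c\<in>?C - {c0}. S c) \<le> (\<Sum>c\<in>?C - {c0}. card T / (4 * real p ^ card J))"
    by (rule order_trans[OF norm_sum]) (intro sum_mono bound)
  also have "\<dots> \<le> (\<Sum>c\<in>?C. card T / (4 * real p ^ card J))"
    using finC by (intro sum_mono2) auto
  also have "\<dots> = card T / 4"
    using p by (simp add: cardC)
  finally have "real (3 * card T) \<le> real (4 * (p ^ card J * card ?N))"
    by (simp add: mult_ac)
  then show ?thesis
    by (simp only: of_nat_le_iff)
qed

text \<open>The five directions of a cube. The value 0 elsewhere makes these functions a finite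
  subgroup, so that the bounds for quadratic functions apply to functions of a cube.\<close>

definition tuples :: "'a::ab_group_add set \<Rightarrow> (nat \<Rightarrow> 'a) set" where
  "tuples U = {a. \<forall>j. (j \<in> {..<5} \<longrightarrow> a j \<in> U) \<and> (j \<notin> {..<5} \<longrightarrow> a j = 0)}"

definition axis_vec :: "nat \<Rightarrow> 'a::ab_group_add \<Rightarrow> nat \<Rightarrow> 'a" where
  "axis_vec j t = (\<lambda>i. if i = j then t else 0)"

lemma tuples_mem: "add_subgroup U \<Longrightarrow> a \<in> tuples U \<Longrightarrow> a j \<in> U"
  by (cases "j < 5") (auto simp: tuples_def add_subgroup_zero)

lemma add_subgroup_tuples: "add_subgroup U \<Longrightarrow> add_subgroup (tuples U)"
  by (auto simp: add_subgroup_def tuples_def)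

lemma finite_tuples: "finite U \<Longrightarrow> finite (tuples U)"
  unfolding tuples_def by (rule finite_set_of_finite_funs) auto

lemma axis_vec_in_tuples: "add_subgroup U \<Longrightarrow> t \<in> U \<Longrightarrow> j < 5 \<Longrightarrow> axis_vec j t \<in> tuples U"
  by (auto simp: tuples_def axis_vec_def add_subgroup_zero)

lemma add_subgroup_axis: "add_subgroup U \<Longrightarrow> add_subgroup (axis_vec j ` U)"
proof -
  assume U: "add_subgroup U"
  have "axis_vec j t - axis_vec j t' = axis_vec j (t - t')" for t t' :: 'a
    by (simp add: axis_vec_def fun_eq_iff)
  moreover have "0 = axis_vec j (0::'a)"
    by (simp add: axis_vec_def fun_eq_iff)
  ultimately show ?thesis
    using U unfolding add_subgroup_def by (auto intro: imageI)
qed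

lemma inj_axis_vec: "inj_on (axis_vec j) U"
  by (auto simp: inj_on_def axis_vec_def fun_eq_iff split: if_splits)

text \<open>The coordinates which, together with \<open>q i x\<close>, determine \<open>q i\<close> at the vertices of the cube
  with base point \<open>x\<close> and directions \<open>a\<close>.\<close>
definition cube_coord ::
    "(nat \<Rightarrow> 'a::ab_group_add \<Rightarrow> int) \<Rightarrow> 'a \<Rightarrow> nat \<times> nat \<times> nat \<Rightarrow> (nat \<Rightarrow> 'a) \<Rightarrow> int" where
  "cube_coord q x = (\<lambda>(i, l, j) a. if j = l then q i (x + a l) else polar (q i) (a j) (a l))"

text \<open>Diagonal entries stand for the neighbours of the base point, the others for unordered
  pairs of directions. These are 5 + 10 = 15 coordinates per function, and
  \<open>30 * card I + 4\<close> is what \<open>equidistributed_of_small_sums\<close> asks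
  for.\<close>

definition cube_index :: "nat set \<Rightarrow> (nat \<times> nat \<times> nat) set" where
  "cube_index I = I \<times> (SIGMA l:{..<5}. {..l})"

lemma finite_cube_index: "finite I \<Longrightarrow> finite (cube_index I)"
  by (simp add: cube_index_def)

lemma card_cube_index: "finite I \<Longrightarrow> card (cube_index I) = 15 * card I"
  by (simp add: cube_index_def card_cartesian_product eval_nat_numeral lessThan_Suc)

lemma deg_lt_cube_coord:
  assumes U: "add_subgroup U" and q: "\<And>i. i \<in> I \<Longrightarrow> deg_lt p U 3 (q i)" and x: "x \<in> U"
    and J: "w \<in> cube_index I"
  shows "deg_lt p (tuples U) 3 (cube_coord q x w)"
proof -
  obtain i l j where w: "w = (i, l, j)" and i: "i \<in> I"
    using J by (auto simp: cube_index_def)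
  note comp = deg_lt_comp[OF q[OF i] U _ _ _ add_subgroup_tuples[OF U]]
  have 0: "0 \<in> U"
    using U by (rule add_subgroup_zero)
  have 1: "deg_lt p (tuples U) 3 (\<lambda>a. q i (y + a l))" if "y \<in> U" for y l
    using that U by (intro comp) (auto simp: tuples_mem)
  have 2: "deg_lt p (tuples U) 3 (\<lambda>a. q i (0 + (a j + a l)))"
    using 0 U by (intro comp) (auto simp: tuples_mem add_ac intro: add_subgroup_add)
  have 3: "deg_lt p (tuples U) 3 (\<lambda>a. q i 0)"
    by (simp only: numeral_3_eq_3 deg_lt_const)
  show ?thesis
  proof (cases "j = l")
    case True
    then show ?thesis
      using 1[OF x] by (simp add: w cube_coord_def)
  next
    case False
    have "deg_lt p (tuples U) 3 (\<lambda>a. q i (0 + (a j + a l)) - q i (0 + a j) - q i (0 + a l) + q i 0)"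
      by (intro deg_lt_add deg_lt_diff 1 2 3 0)
    then show ?thesis
      using False by (simp add: w cube_coord_def polar_def)
  qed
qed

text \<open>Testing with directions on the axes \<open>j\<close> and \<open>l\<close> isolates the
  coordinate indexed by exactly this pair. The condition \<open>j \<le> l\<close> prevents a match
  with the pair in the opposite order.\<close>

lemma polar_cube_coord:
  assumes U: "add_subgroup U" and q: "deg_lt p U 3 (q i)" and x: "x \<in> U" and t: "t \<in> U" "t' \<in> U"
    and jl: "j \<le> l" "j' \<le> l'"
  shows "int p dvd polar (cube_coord q x (i, l', j')) (axis_vec j t) (axis_vec l t') -
    (if l' = l \<and> j' = j then polar (q i) t t' else 0)"
proof (cases "j' = l'")
  case True
  show ?thesis
  proof (cases "j = l \<and> l' = l")
    case True': True
    have "int p dvd fdiff t' (q i) (x + t) - fdiff t' (q i) x - polar (q i) t t'"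
      by (rule fdiff_fdiff_polar[OF U q t x])
    moreover have "polar (cube_coord q x (i, l', j')) (axis_vec j t) (axis_vec l t') =
        fdiff t' (q i) (x + t) - fdiff t' (q i) x"
      using True True' by (simp add: polar_def cube_coord_def axis_vec_def fdiff_def add.assoc)
    ultimately show ?thesis
      using True True' by simp
  next
    case False
    then show ?thesis
      using True jl by (auto simp: polar_def cube_coord_def axis_vec_def)
  qed
next
  case False
  then show ?thesis
    using jl unfolding polar_def[of "cube_coord q x (i, l', j')"]
    by (auto simp: cube_coord_def axis_vec_def)
qed

lemma polar_lincomb: "polar (\<lambda>x. \<Sum>w\<in>J. c w * g w x) a b = (\<Sum>w\<in>J. c w * polar (g w) a b)"
  by (simp add: polar_def sum.distrib sum_subtractf algebra_simps)

text \<open>Let a combination of coordinates have a nonzero coefficient at a pair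
  \<open>(l, j)\<close>. On the axis \<open>j\<close> its radical lies in the radical of the
  combination of the \<open>q i\<close> with the coefficients at this pair, which is small by
  regularity. By \<open>card_subgroup_Int\<close> the radical in the space of all cubes is small as
  well, and so is the character sum.\<close>

lemma cube_equidistributed:
  assumes p: "prime p" and U: "add_subgroup U" "finite U" and I: "finite I"
    and q: "\<And>i. i \<in> I \<Longrightarrow> deg_lt p U 3 (q i)" and reg: "regular p s U I q"
    and s: "30 * card I + 4 \<le> s" and x: "x \<in> U"
  shows "3 * card (tuples U) \<le> 4 * (p ^ (15 * card I) *
    card {a \<in> tuples U. \<forall>w\<in>cube_index I. int p dvd cube_coord q x w a - \<tau> w})"
proof -
  let ?T = "tuples U" and ?J = "cube_index I"
  have T: "add_subgroup ?T" "finite ?T"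
    using U by (simp_all add: add_subgroup_tuples finite_tuples)
  have p0: "p > 0"
    using p by (rule prime_gt_0_nat)
  have "3 * card ?T \<le> 4 * (p ^ card ?J * card {a \<in> ?T. \<forall>w\<in>?J. int p dvd cube_coord q x w a - \<tau> w})"
  proof (rule equidistributed_of_small_sums[OF p T(2) finite_cube_index[OF I]])
    show "2 * card ?J + 4 \<le> s"
      using s I by (simp add: card_cube_index)
    fix c assume "\<exists>w\<in>?J. \<not> int p dvd c w"
    then obtain i0 l j where c: "\<not> int p dvd c (i0, l, j)" and w: "(i0, l, j) \<in> ?J"
      by auto
    then have i0: "i0 \<in> I" and jl: "j \<le> l" "l < 5" "j < 5"
      by (auto simp: cube_index_def)
    define \<Theta> where "\<Theta> a = (\<Sum>w\<in>?J. c w * cube_coord q x w a)" for a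
    define K where "K = kernel2 p ?T \<Theta>"
    define L where "L = kernel2 p U (\<lambda>y. \<Sum>i\<in>I. c (i, l, j) * q i y)"
    have \<Theta>3: "deg_lt p ?T 3 \<Theta>"
      unfolding \<Theta>_def by (intro deg_lt_sum deg_lt_cmult deg_lt_cube_coord[OF U(1) q x])
    have "t \<in> L" if t: "t \<in> U" and sK: "axis_vec j t \<in> K" for t
    proof -
      have "int p dvd polar (\<lambda>y. \<Sum>i\<in>I. c (i, l, j) * q i y) t t'" if t': "t' \<in> U" for t'
      proof -
        have "int p dvd polar \<Theta> (axis_vec j t) (axis_vec l t')"
          using sK axis_vec_in_tuples[OF U(1) t' jl(2)] kernel2_iff[OF T(1)] by (auto simp: K_def)
        then have 1: "int p dvd (\<Sum>w\<in>?J. c w * polar (cube_coord q x w) (axis_vec j t) (axis_vec l t'))"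
          by (simp add: \<Theta>_def[abs_def] polar_lincomb)
        have 2: "int p dvd (\<Sum>w\<in>?J. c w * (polar (cube_coord q x w) (axis_vec j t) (axis_vec l t') -
            (if snd w = (l, j) then polar (q (fst w)) t t' else 0)))"
        proof (intro dvd_sum dvd_mult)
          fix w assume "w \<in> ?J"
          then obtain i l' j' where w: "w = (i, l', j')" "i \<in> I" "j' \<le> l'"
            by (auto simp: cube_index_def)
          show "int p dvd polar (cube_coord q x w) (axis_vec j t) (axis_vec l t') -
              (if snd w = (l, j) then polar (q (fst w)) t t' else 0)"
            using polar_cube_coord[of U p q i, OF U(1) q[OF w(2)] x t t' jl(1) w(3)]
            by (simp only: w fst_conv snd_conv prod.inject)
        qed
        have "int p dvd (\<Sum>w\<in>?J. c w * (if snd w = (l, j) then polar (q (fst w)) t t' else 0))"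
          using dvd_diff[OF 1 2] by (simp add: right_diff_distrib sum_subtractf)
        also have "(\<Sum>w\<in>?J. c w * (if snd w = (l, j) then polar (q (fst w)) t t' else 0)) =
            (\<Sum>w\<in>(\<lambda>i. (i, l, j)) ` I. c w * polar (q (fst w)) t t')"
          using I w by (intro sum.mono_neutral_cong_right finite_cube_index)
            (auto simp: cube_index_def)
        also have "\<dots> = (\<Sum>i\<in>I. c (i, l, j) * polar (q i) t t')"
          by (subst sum.reindex) (auto simp: inj_on_def)
        finally show ?thesis
          by (simp only: polar_lincomb)
      qed
      then show ?thesis
        using t by (simp add: L_def kernel2_iff[OF U(1)])
    qed
    then have "K \<inter> axis_vec j ` U \<subseteq> axis_vec j ` L"
      by auto
    moreover have "finite L"
      using U kernel2_subset finite_subset unfolding L_def by metis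
    ultimately have KL: "card (K \<inter> axis_vec j ` U) \<le> card L"
      by (meson card_image_le card_mono finite_imageI le_trans)
    have "card K * card (axis_vec j ` U) \<le> card ?T * card (K \<inter> axis_vec j ` U)"
      using U jl unfolding K_def
      by (intro card_subgroup_Int T add_subgroup_kernel2 kernel2_subset add_subgroup_axis)
         (auto intro: axis_vec_in_tuples)
    also have "\<dots> \<le> card ?T * card L"
      by (intro mult_le_mono2 KL)
    finally have "p ^ s * card K * card U \<le> card ?T * (p ^ s * card L)"
      by (simp add: card_image[OF inj_axis_vec] mult_ac)
    also have "p ^ s * card L \<le> card U"
      using reg[unfolded regular_def, rule_format, of "\<lambda>i. c (i, l, j)"] c i0 by (auto simp: L_def)
    finally have "p ^ s * card K \<le> card ?T"
      using add_subgroup_card_pos[OF U] by simp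
    then have "real (p ^ s * card K) \<le> real (card ?T)"
      by (simp only: of_nat_le_iff)
    then have 3: "real p ^ s * card K \<le> card ?T"
      by simp
    have "real p ^ s * (cmod (\<Sum>a\<in>?T. chr p (\<Theta> a)))\<^sup>2 \<le> real p ^ s * (card K * card ?T)"
      using quadratic_bias_squared[OF T p0 \<Theta>3] by (intro mult_left_mono) (auto simp: K_def)
    also have "\<dots> = (real p ^ s * card K) * card ?T"
      by simp
    also have "\<dots> \<le> real (card ?T) * card ?T"
      by (intro mult_right_mono 3) auto
    finally show "real p ^ s * (cmod (\<Sum>a\<in>?T. chr p (\<Sum>w\<in>?J. c w * cube_coord q x w a)))\<^sup>2 \<le> (real (card ?T))\<^sup>2"
      by (simp add: \<Theta>_def power2_eq_square)
  qed
  then show ?thesis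
    using I by (simp only: card_cube_index)
qed

text \<open>With the other directions fixed, the vertex moves injectively with \<open>a j\<close>,
  so at most \<open>card B\<close> choices of \<open>a j\<close> are bad.\<close>

lemma card_bad_vertex:
  assumes U: "add_subgroup U" "finite U" and B: "B \<subseteq> U" "c * card B \<le> card U"
    and S: "S \<subseteq> {..<5}" "j \<in> S"
  shows "c * card {a \<in> tuples U. x + (\<Sum>i\<in>S. a i) \<in> B} \<le> card (tuples U)"
proof -
  let ?T = "tuples U"
  have T: "add_subgroup ?T" "finite ?T"
    using U by (simp_all add: add_subgroup_tuples finite_tuples)
  have finS: "finite S"
    using S finite_subset by blast
  define \<phi> :: "(nat \<Rightarrow> 'a) \<Rightarrow> nat" where "\<phi> a = (if x + (\<Sum>i\<in>S. a i) \<in> B then 1 else 0)" for a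
  have j: "j < 5"
    using S by auto
  have "card U * card {a \<in> ?T. x + (\<Sum>i\<in>S. a i) \<in> B} = card (axis_vec j ` U) * (\<Sum>a\<in>?T. \<phi> a)"
    using T by (simp add: \<phi>_def sum.If_cases Int_def card_image[OF inj_axis_vec])
  also have "\<dots> = (\<Sum>a\<in>?T. \<Sum>w\<in>axis_vec j ` U. \<phi> (a + w))"
    using sum_over_cosets[OF T(1), of "axis_vec j ` U" \<phi>] axis_vec_in_tuples[OF U(1) _ j]
    by (simp add: image_subset_iff)
  also have "\<dots> \<le> (\<Sum>a\<in>?T. card B)"
  proof (rule sum_mono)
    fix a
    have "(\<Sum>w\<in>axis_vec j ` U. \<phi> (a + w)) = (\<Sum>t\<in>U. \<phi> (a + axis_vec j t))"
      by (subst sum.reindex[OF inj_axis_vec]) simp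
    also have "\<dots> = card {t \<in> U. (x + (\<Sum>i\<in>S. a i)) + t \<in> B}"
      using U S finS
      by (simp add: \<phi>_def sum.If_cases Int_def sum.distrib axis_vec_def add.assoc)
    also have "\<dots> \<le> card B"
      using finite_subset[OF B(1) U(2)]
      by (intro card_inj_on_le[where f = "\<lambda>t. (x + (\<Sum>i\<in>S. a i)) + t"]) (auto simp: inj_on_def)
    finally show "(\<Sum>w\<in>axis_vec j ` U. \<phi> (a + w)) \<le> card B" .
  qed
  also have "\<dots> = card ?T * card B"
    by simp
  finally have "card U * card {a \<in> ?T. x + (\<Sum>i\<in>S. a i) \<in> B} \<le> card ?T * card B" .
  then have "c * (card U * card {a \<in> ?T. x + (\<Sum>i\<in>S. a i) \<in> B}) \<le> c * (card ?T * card B)"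
    by (rule mult_le_mono2)
  also have "\<dots> \<le> card ?T * card U"
    using mult_le_mono2[OF B(2), of "card ?T"] by (simp add: mult_ac)
  finally show ?thesis
    using add_subgroup_card_pos[OF U] by (simp add: mult_ac)
qed

text \<open>The base point may be exceptional: its value is to be recovered from the other 31
  vertices.\<close>

definition bad_cubes :: "'a::ab_group_add set \<Rightarrow> 'a set \<Rightarrow> 'a \<Rightarrow> (nat \<Rightarrow> 'a) set" where
  "bad_cubes U B x = {a \<in> tuples U. \<exists>S\<in>Pow {..<5} - {{}}. x + (\<Sum>i\<in>S. a i) \<in> B}"

lemma card_bad_cubes:
  assumes U: "add_subgroup U" "finite U" and B: "B \<subseteq> U" "c * card B \<le> card U"
  shows "c * card (bad_cubes U B x) \<le> 31 * card (tuples U)"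
proof -
  let ?P = "Pow {..<5::nat} - {{}}"
  have "bad_cubes U B x = (\<Union>S\<in>?P. {a \<in> tuples U. x + (\<Sum>i\<in>S. a i) \<in> B})"
    by (auto simp: bad_cubes_def)
  then have "c * card (bad_cubes U B x) \<le> c * (\<Sum>S\<in>?P. card {a \<in> tuples U. x + (\<Sum>i\<in>S. a i) \<in> B})"
    by (simp only:) (intro mult_le_mono2 card_UN_le; simp)
  also have "\<dots> = (\<Sum>S\<in>?P. c * card {a \<in> tuples U. x + (\<Sum>i\<in>S. a i) \<in> B})"
    by (rule sum_distrib_left)
  also have "\<dots> \<le> (\<Sum>S\<in>?P. card (tuples U))"
  proof (rule sum_mono)
    fix S assume "S \<in> ?P"
    then obtain j where "j \<in> S" "S \<subseteq> {..<5}"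
      by auto
    then show "c * card {a \<in> tuples U. x + (\<Sum>i\<in>S. a i) \<in> B} \<le> card (tuples U)"
      by (intro card_bad_vertex[OF U B])
  qed
  also have "\<dots> = 31 * card (tuples U)"
    by (simp add: card_Pow)
  finally show ?thesis .
qed

text \<open>For each base point, more than half of the values of the coordinate vector are attained at
  good cubes.\<close>
lemma common_good_cube:
  assumes p: "prime p" and U: "add_subgroup U" "finite U" and I: "finite I"
    and q: "\<And>i. i \<in> I \<Longrightarrow> deg_lt p U 3 (q i)" and reg: "regular p s U I q"
    and s: "30 * card I + 4 \<le> s" and x: "x \<in> U" "y \<in> U"
    and B: "B \<subseteq> U" "100 * card B \<le> card U"
  shows "\<exists>a\<in>tuples U - bad_cubes U B x. \<exists>a'\<in>tuples U - bad_cubes U B y.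
    \<forall>w\<in>cube_index I. int p dvd cube_coord q x w a - cube_coord q y w a'"
proof -
  let ?T = "tuples U" and ?J = "cube_index I"
  have T: "add_subgroup ?T" "finite ?T"
    using U by (simp_all add: add_subgroup_tuples finite_tuples)
  have p0: "p > 0"
    using p by (rule prime_gt_0_nat)
  define \<Omega> where "\<Omega> = PiE ?J (\<lambda>_. {0..<int p})"
  have \<Omega>: "finite \<Omega>" "card \<Omega> = p ^ (15 * card I)"
    using I unfolding \<Omega>_def
    by (auto simp: card_PiE finite_cube_index card_cube_index intro!: finite_PiE)
  define N where "N x \<tau> = {a \<in> ?T. \<forall>w\<in>?J. int p dvd cube_coord q x w a - \<tau> w}" for x \<tau>
  define M where "M x = {\<tau> \<in> \<Omega>. N x \<tau> \<subseteq> bad_cubes U B x}" for x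
  \<comment> \<open>Each coordinate vector is attained by at least 3/4 of its expected number of
    cubes, while at most 31/100 of all cubes are bad. So at most 124/300 of the vectors, less than
    half, are attained only by bad cubes, and the vectors lost for \<open>x\<close> and for
    \<open>y\<close> together do not exhaust \<open>\<Omega>\<close>.\<close>
  have M: "2 * card (M x) < card \<Omega>" if x: "x \<in> U" for x
  proof -
    have disj: "N x \<tau> \<inter> N x \<tau>' = {}" if "\<tau> \<in> \<Omega>" "\<tau>' \<in> \<Omega>" "\<tau> \<noteq> \<tau>'" for \<tau> \<tau>'
    proof (rule ccontr)
      assume "N x \<tau> \<inter> N x \<tau>' \<noteq> {}"
      then obtain a where a: "a \<in> N x \<tau>" "a \<in> N x \<tau>'"
        by auto
      have "\<tau> w = \<tau>' w" if w: "w \<in> ?J" for w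
      proof -
        have "int p dvd (cube_coord q x w a - \<tau> w) - (cube_coord q x w a - \<tau>' w)"
          by (rule dvd_diff) (use a w in \<open>auto simp: N_def\<close>)
        then have "int p dvd \<tau>' w - \<tau> w"
          by simp
        then have "\<tau>' w mod int p = \<tau> w mod int p"
          by (simp add: mod_eq_dvd_iff)
        moreover have "\<tau> w \<in> {0..<int p}" "\<tau>' w \<in> {0..<int p}"
          using \<open>\<tau> \<in> \<Omega>\<close> \<open>\<tau>' \<in> \<Omega>\<close> w by (auto simp: \<Omega>_def dest: PiE_mem)
        ultimately show ?thesis
          by simp
      qed
      then have "\<tau> = \<tau>'"
        using \<open>\<tau> \<in> \<Omega>\<close> \<open>\<tau>' \<in> \<Omega>\<close> unfolding \<Omega>_def by (intro PiE_ext)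
      then show False
        using \<open>\<tau> \<noteq> \<tau>'\<close> by simp
    qed
    have finN: "finite (N x \<tau>)" for \<tau>
      using T by (simp add: N_def)
    have "card (M x) * (3 * card ?T) = (\<Sum>\<tau>\<in>M x. 3 * card ?T)"
      by simp
    also have "\<dots> \<le> (\<Sum>\<tau>\<in>M x. 4 * (card \<Omega> * card (N x \<tau>)))"
      unfolding N_def \<Omega>(2) by (intro sum_mono cube_equidistributed[OF p U I q reg s x])
    also have "\<dots> = 4 * card \<Omega> * (\<Sum>\<tau>\<in>M x. card (N x \<tau>))"
      by (simp add: sum_distrib_left mult_ac)
    also have "(\<Sum>\<tau>\<in>M x. card (N x \<tau>)) = card (\<Union>\<tau>\<in>M x. N x \<tau>)"
      using disj finN \<Omega> by (subst card_UN_disjoint) (auto simp: M_def)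
    also have "\<dots> \<le> card (bad_cubes U B x)"
      using T by (intro card_mono) (auto simp: M_def bad_cubes_def)
    finally have "100 * (card (M x) * (3 * card ?T)) \<le> 4 * card \<Omega> * (100 * card (bad_cubes U B x))"
      by (simp add: mult_ac)
    also have "\<dots> \<le> 4 * card \<Omega> * (31 * card ?T)"
      by (intro mult_le_mono2 card_bad_cubes U B)
    finally have "(300 * card (M x)) * card ?T \<le> (124 * card \<Omega>) * card ?T"
      by (simp add: mult_ac)
    then have "300 * card (M x) \<le> 124 * card \<Omega>"
      using add_subgroup_card_pos[OF T] by (simp only: mult_le_cancel2)
    moreover have "card \<Omega> > 0"
      using p0 by (simp add: \<Omega>)
    ultimately show ?thesis
      by linarith
  qed
  have "M x \<union> M y \<noteq> \<Omega>"
    using M[OF x(1)] M[OF x(2)] card_Un_le[of "M x" "M y"] by auto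
  then obtain \<tau> where \<tau>: "\<tau> \<in> \<Omega>" "\<tau> \<notin> M x" "\<tau> \<notin> M y"
    by (auto simp: M_def)
  then obtain a a' where a: "a \<in> N x \<tau>" "a \<notin> bad_cubes U B x" "a' \<in> N y \<tau>" "a' \<notin> bad_cubes U B y"
    unfolding M_def by blast
  have "int p dvd cube_coord q x w a - cube_coord q y w a'" if w: "w \<in> ?J" for w
  proof -
    have "int p dvd (cube_coord q x w a - \<tau> w) - (cube_coord q y w a' - \<tau> w)"
      by (rule dvd_diff) (use a w in \<open>auto simp: N_def\<close>)
    then show ?thesis
      by simp
  qed
  then show ?thesis
    using a unfolding N_def by blast
qed

text \<open>Two cubes with the same coordinates and the same values of \<open>q\<close> at the base
  carry the same values of \<open>q\<close> at all corresponding vertices. Hence \<open>f\<close>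
  agrees at the 31 pairs of nonexceptional vertices, and the vanishing fifth differences transfer
  this to the base points.\<close>

lemma determined_exactly:
  fixes f :: "'a::ab_group_add \<Rightarrow> int"
  assumes p: "prime p" and U: "add_subgroup U" "finite U" and I: "finite I"
    and q: "\<And>i. i \<in> I \<Longrightarrow> deg_lt p U 3 (q i)" and reg: "regular p s U I q"
    and s: "30 * card I + 4 \<le> s" and B: "B \<subseteq> U" "100 * card B \<le> card U"
    and f: "deg_lt p U 5 f"
    and det: "\<And>x y. x \<in> U - B \<Longrightarrow> y \<in> U - B \<Longrightarrow> (\<And>i. i \<in> I \<Longrightarrow> int p dvd q i x - q i y) \<Longrightarrow>
      int p dvd f x - f y"
    and x: "x \<in> U" "y \<in> U" and eq: "\<And>i. i \<in> I \<Longrightarrow> int p dvd q i x - q i y"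
  shows "int p dvd f x - f y"
proof -
  obtain a a' where a: "a \<in> tuples U" "a \<notin> bad_cubes U B x" "a' \<in> tuples U" "a' \<notin> bad_cubes U B y"
    and coord: "\<And>w. w \<in> cube_index I \<Longrightarrow> int p dvd cube_coord q x w a - cube_coord q y w a'"
    using common_good_cube[OF p U I q reg s x B] by blast
  have aU: "a j \<in> U" "a' j \<in> U" for j
    using a U by (auto simp: tuples_mem)
  have vertex: "x + (\<Sum>j\<in>S. a j) \<in> U" "y + (\<Sum>j\<in>S. a' j) \<in> U" for S
    using x aU by (auto intro!: add_subgroup_add[OF U(1)] add_subgroup_sum[OF U(1)])
  have qS: "int p dvd q i (x + (\<Sum>j\<in>S. a j)) - q i (y + (\<Sum>j\<in>S. a' j))"
    if i: "i \<in> I" and S: "S \<in> Pow {..<5}" for i S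
  proof -
    have finS: "finite S"
      using S finite_subset by auto
    let ?R = "\<lambda>x a. q i x + (\<Sum>j\<in>S. q i (x + a j) - q i x) +
      (\<Sum>l\<in>S. \<Sum>j\<in>{j \<in> S. j < l}. polar (q i) (a j) (a l))"
    have 1: "int p dvd q i (x + (\<Sum>j\<in>S. a j)) - ?R x a"
      by (rule quadratic_cube[OF U(1) q[OF i] x(1) finS aU(1)])
    have 2: "int p dvd q i (y + (\<Sum>j\<in>S. a' j)) - ?R y a'"
      by (rule quadratic_cube[OF U(1) q[OF i] x(2) finS aU(2)])
    have lin: "int p dvd q i (x + a j) - q i (y + a' j)" if "j \<in> S" for j
      using coord[of "(i, j, j)"] i S that by (auto simp: cube_index_def cube_coord_def)
    have pol: "int p dvd polar (q i) (a j) (a l) - polar (q i) (a' j) (a' l)" if "l \<in> S" "j < l" for j l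
      using coord[of "(i, l, j)"] i S that by (auto simp: cube_index_def cube_coord_def)
    have "?R x a - ?R y a' = (q i x - q i y) +
        (\<Sum>j\<in>S. (q i (x + a j) - q i (y + a' j)) - (q i x - q i y)) +
        (\<Sum>l\<in>S. \<Sum>j\<in>{j \<in> S. j < l}. polar (q i) (a j) (a l) - polar (q i) (a' j) (a' l))"
      by (simp add: sum_subtractf right_diff_distrib)
    also have "int p dvd \<dots>"
      by (intro dvd_add dvd_sum eq i dvd_diff[OF lin eq]) (auto intro: pol)
    finally have "int p dvd ?R x a - ?R y a'" .
    from dvd_add[OF dvd_diff[OF 1 2] this] show ?thesis
      by (simp add: algebra_simps)
  qed
  have fS: "int p dvd f (x + (\<Sum>j\<in>S. a j)) - f (y + (\<Sum>j\<in>S. a' j))" if S: "S \<in> Pow {..<5} - {{}}" for S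
  proof (rule det)
    show "x + (\<Sum>j\<in>S. a j) \<in> U - B" "y + (\<Sum>j\<in>S. a' j) \<in> U - B"
      using S a vertex by (auto simp: bad_cubes_def)
  qed (use qS S in auto)
  have card5: "card {..<5::nat} = 5"
    by simp
  have cube: "int p dvd (\<Sum>S\<in>Pow {..<5}. (- 1) ^ card S * f (x + (\<Sum>j\<in>S. a j)))"
    "int p dvd (\<Sum>S\<in>Pow {..<5}. (- 1) ^ card S * f (y + (\<Sum>j\<in>S. a' j)))"
    using f by (auto intro!: cube_sum_vanishes[OF U(1)] aU x simp only: card5)
  have "int p dvd (\<Sum>S\<in>Pow {..<5}. (- 1) ^ card S * f (x + (\<Sum>j\<in>S. a j))) -
      (\<Sum>S\<in>Pow {..<5}. (- 1) ^ card S * f (y + (\<Sum>j\<in>S. a' j)))"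
    by (rule dvd_diff[OF cube])
  also have "\<dots> = (\<Sum>S\<in>Pow {..<5}. (- 1) ^ card S * (f (x + (\<Sum>j\<in>S. a j)) - f (y + (\<Sum>j\<in>S. a' j))))"
    by (simp add: sum_subtractf right_diff_distrib)
  also have "\<dots> = (f x - f y) + (\<Sum>S\<in>Pow {..<5} - {{}}. (- 1) ^ card S * (f (x + (\<Sum>j\<in>S. a j)) - f (y + (\<Sum>j\<in>S. a' j))))"
    by (subst sum.remove[of _ "{}"]) auto
  finally have "int p dvd \<dots>" .
  moreover have "int p dvd (\<Sum>S\<in>Pow {..<5} - {{}}. (- 1) ^ card S * (f (x + (\<Sum>j\<in>S. a j)) - f (y + (\<Sum>j\<in>S. a' j))))"
    by (intro dvd_sum dvd_mult fS)
  ultimately show ?thesis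
    by (simp only: dvd_add_left_iff)
qed

subsection \<open>Division by a linear function\<close>

primrec nat_mul :: "nat \<Rightarrow> 'a::ab_group_add \<Rightarrow> 'a" where
  "nat_mul 0 v = 0"
| "nat_mul (Suc t) v = nat_mul t v + v"

lemma nat_mul_add: "nat_mul (s + t) v = nat_mul s v + nat_mul t v"
  by (induction t) (simp_all add: add_ac)

lemma nat_mul_mult: "nat_mul (s * t) v = nat_mul s (nat_mul t v)"
  by (induction s) (simp_all add: nat_mul_add add.commute)

lemma nat_mul_zero [simp]: "nat_mul s 0 = 0"
  by (induction s) simp_all

lemma nat_mul_mem: "add_subgroup V \<Longrightarrow> v \<in> V \<Longrightarrow> nat_mul t v \<in> V"
  by (induction t) (auto intro: add_subgroup_zero add_subgroup_add)

lemma nat_mul_mod: "nat_mul p v = 0 \<Longrightarrow> nat_mul (t mod p) v = nat_mul t v"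
  using nat_mul_add[of "t div p * p" "t mod p" v] by (simp add: nat_mul_mult)

text \<open>The binomial coefficients vanish beyond \<open>t\<close>, so the range of summation can
  be made independent of \<open>t\<close>; below it is \<open>p - 1\<close> for all points.\<close>

lemma newton_expansion:
  "t \<le> m \<Longrightarrow> f (y + nat_mul t v) = (\<Sum>j\<le>m. int (t choose j) * (fdiff v ^^ j) f y)"
proof (induction t arbitrary: f)
  case 0
  have "(\<Sum>j\<le>m. int (0 choose j) * (fdiff v ^^ j) f y) = (\<Sum>j\<in>{0}. int (0 choose j) * (fdiff v ^^ j) f y)"
    by (intro sum.mono_neutral_right) (auto simp: binomial_eq_0)
  then show ?case
    by simp
next
  case (Suc t)
  then obtain m' where m: "m = Suc m'" "t \<le> m'"
    by (cases m) auto
  have "f (y + nat_mul (Suc t) v) = fdiff v f (y + nat_mul t v) + f (y + nat_mul t v)"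
    by (simp add: fdiff_def add.assoc)
  also have "\<dots> = (\<Sum>j\<le>m. int (t choose j) * (fdiff v ^^ Suc j) f y) +
      (\<Sum>j\<le>m. int (t choose j) * (fdiff v ^^ j) f y)"
    using Suc.IH[of "fdiff v f"] Suc.IH[of f] Suc.prems by (simp add: funpow_Suc_right del: funpow.simps)
  also have "(\<Sum>j\<le>m. int (t choose j) * (fdiff v ^^ Suc j) f y) =
      (\<Sum>j\<le>m'. int (t choose j) * (fdiff v ^^ Suc j) f y)"
    using m by (simp add: binomial_eq_0)
  also have "(\<Sum>j\<le>m. int (t choose j) * (fdiff v ^^ j) f y) =
      f y + (\<Sum>j\<le>m'. int (t choose Suc j) * (fdiff v ^^ Suc j) f y)"
    unfolding m sum.atMost_Suc_shift by simp
  also have "(\<Sum>j\<le>m'. int (t choose j) * (fdiff v ^^ Suc j) f y) +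
      (f y + (\<Sum>j\<le>m'. int (t choose Suc j) * (fdiff v ^^ Suc j) f y)) =
      f y + (\<Sum>j\<le>m'. int (Suc t choose Suc j) * (fdiff v ^^ Suc j) f y)"
    by (simp add: sum.distrib algebra_simps del: funpow.simps)
  also have "\<dots> = (\<Sum>j\<le>m. int (Suc t choose j) * (fdiff v ^^ j) f y)"
    unfolding m sum.atMost_Suc_shift by (simp del: binomial_Suc_Suc)
  finally show ?case .
qed

lemma fact_mult_choose: "fact j * int (t choose j) = (\<Prod>i<j. int t - int i)"
proof (induction j)
  case (Suc j)
  have "int (Suc j) * int (t choose Suc j) = (int t - int j) * int (t choose j)"
  proof (cases "j \<le> t")
    case True
    have "(t choose Suc j) * Suc j = (t - j) * (t choose j)"
      using binomial_absorb_comp[of t j] Suc_times_binomial_eq[of "t - 1" j] by (cases t) auto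
    then show ?thesis
      using True by (metis mult.commute of_nat_diff of_nat_mult)
  qed (simp add: binomial_eq_0)
  then have "fact (Suc j) * int (t choose Suc j) = (int t - int j) * (fact j * int (t choose j))"
    by (simp add: mult_ac)
  then show ?case
    using Suc by (simp add: mult.commute)
qed simp

lemma deg_lt_prod_linear:
  assumes V: "add_subgroup V" and "finite J" "\<And>i. i \<in> J \<Longrightarrow> deg_lt p V 2 (h i)"
  shows "deg_lt p V (Suc (card J)) (\<lambda>x. \<Prod>i\<in>J. h i x)"
  using assms(2,3)
proof (induction J rule: finite_induct)
  case (insert i J)
  then have "deg_lt p V (2 + Suc (card J) - 1) (\<lambda>x. h i x * (\<Prod>i\<in>J. h i x))"
    by (intro deg_lt_mult[OF V]) auto
  then show ?case
    using insert by (simp del: deg_lt.simps)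
qed (simp only: prod.empty deg_lt_const)

lemma deg_lt_funpow_fdiff:
  "deg_lt p V (j + k) f \<Longrightarrow> v \<in> V \<Longrightarrow> deg_lt p V k ((fdiff v ^^ j) f)"
  by (induction j arbitrary: f) (auto simp: funpow_Suc_right simp del: funpow.simps)

text \<open>Newton's formula in direction \<open>v\<close>, starting at \<open>\<pi> x\<close> with
  \<open>\<tau> x\<close> steps. For \<open>1 \<le> j < p\<close> the binomial coefficient is
  \<open>\<tau> x\<close> times a polynomial of degree \<open>j - 1\<close> in
  \<open>\<tau> x\<close>, because \<open>fact j\<close> is invertible modulo \<open>p\<close>. It
  multiplies a \<open>j\<close>-fold difference of \<open>f\<close>, so the cofactor of
  \<open>\<tau>\<close> has one degree less than \<open>f\<close>.\<close>

lemma division_by_linear: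
  assumes "prime p" and V: "add_subgroup V" "v \<in> V"
    and \<pi>: "\<And>x. x \<in> V \<Longrightarrow> \<pi> x \<in> V" "\<And>x y. x \<in> V \<Longrightarrow> y \<in> V \<Longrightarrow> \<pi> (x + y) = \<pi> x + \<pi> y"
    and \<tau>: "deg_lt p V 2 \<tau>"
    and dec: "\<And>x. x \<in> V \<Longrightarrow> x = \<pi> x + nat_mul (nat (\<tau> x mod int p)) v"
    and f: "deg_lt p V (Suc k) f"
  obtains g where "deg_lt p V k g" "\<And>x. x \<in> V \<Longrightarrow> int p dvd f x - (f (\<pi> x) + \<tau> x * g x)"
proof -
  have p: "p > 1"
    using assms(1) by (rule prime_gt_1_nat)
  have "\<exists>r. int p dvd r * fact j - 1" if "j < p" for j
  proof -
    have "\<not> p dvd fact j"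
      using that assms(1) by (simp add: prime_dvd_fact_iff)
    then have "coprime (fact j :: nat) p"
      using assms(1) by (simp add: prime_imp_coprime coprime_commute)
    then have "coprime (int (fact j)) (int p)"
      by (simp only: coprime_int_iff)
    then obtain r where "[int (fact j) * r = 1] (mod int p)"
      using cong_solve_coprime_int by blast
    then show ?thesis
      by (auto simp: cong_iff_dvd_diff mult.commute)
  qed
  then obtain r where r: "\<And>j. j < p \<Longrightarrow> int p dvd r j * fact j - 1"
    by metis
  \<comment> \<open>The falling factorial without its factor for \<open>i = 0\<close>, which is
    \<open>\<tau> x\<close> itself.\<close>
  define c where "c j x = (\<Prod>i\<in>{1..<j}. \<tau> x - int i)" for j x
  define g where "g x = (\<Sum>j\<in>{1..<p}. r j * (c j x * (fdiff v ^^ j) f (\<pi> x)))" for x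
  have "deg_lt p V k (\<lambda>x. c j x * (fdiff v ^^ j) f (\<pi> x))" if j: "j \<ge> 1" for j
  proof (cases "j \<le> k")
    case True
    have "deg_lt p V (Suc (card {1..<j})) (c j)"
      unfolding c_def using deg_lt_const[of p V 1]
      by (intro deg_lt_prod_linear V deg_lt_diff[OF \<tau>]) (simp_all only: numeral_2_eq_2 One_nat_def finite_atLeastLessThan)
    then have "deg_lt p V j (c j)"
      using j by simp
    moreover have "deg_lt p V (Suc k - j) (\<lambda>x. (fdiff v ^^ j) f (0 + \<pi> x))"
      using True f by (intro deg_lt_comp[OF deg_lt_funpow_fdiff V(1) add_subgroup_zero[OF V(1)] \<pi>] V) auto
    ultimately have "deg_lt p V (j + (Suc k - j) - 1) (\<lambda>x. c j x * (fdiff v ^^ j) f (0 + \<pi> x))"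
      by (rule deg_lt_mult[OF V(1)])
    then show ?thesis
      using True by simp
  next
    case False
    have "deg_lt p V (j + 0) f"
      using False by (intro deg_lt_mono[OF V(1) f]) auto
    then have "deg_lt p V 0 ((fdiff v ^^ j) f)"
      by (rule deg_lt_funpow_fdiff[OF _ V(2)])
    then have "deg_lt p V 0 (\<lambda>x. c j x * (fdiff v ^^ j) f (\<pi> x))"
      using \<pi> by simp
    then show ?thesis
      by (rule deg_lt_mono[OF V(1)]) simp
  qed
  then have "deg_lt p V k g"
    unfolding g_def by (intro deg_lt_sum deg_lt_cmult) auto
  moreover have "int p dvd f x - (f (\<pi> x) + \<tau> x * g x)" if x: "x \<in> V" for x
  proof -
    define t where "t = nat (\<tau> x mod int p)"
    have t: "t \<le> p - 1" "int p dvd int t - \<tau> x"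
      using p by (auto simp: t_def nat_le_iff mod_eq_dvd_iff[symmetric])
    define D where "D j = (fdiff v ^^ j) f (\<pi> x)" for j
    have cC: "int p dvd int (t choose j) - \<tau> x * (r j * c j x)" if j: "j \<in> {1..<p}" for j
    proof -
      have "{..<j} = insert 0 {1..<j}"
        using j by auto
      then have "fact j * int (t choose j) = int t * (\<Prod>i\<in>{1..<j}. int t - int i)"
        by (simp add: fact_mult_choose)
      moreover have "[int t = \<tau> x] (mod int p)"
        using t by (simp add: cong_iff_dvd_diff)
      then have "[int t * (\<Prod>i\<in>{1..<j}. int t - int i) = \<tau> x * c j x] (mod int p)"
        unfolding c_def by (intro cong_mult cong_prod cong_diff cong_refl)
      ultimately have "[fact j * int (t choose j) = \<tau> x * c j x] (mod int p)"
        by simp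
      then have "[r j * (fact j * int (t choose j)) = r j * (\<tau> x * c j x)] (mod int p)"
        by (rule cong_mult[OF cong_refl])
      moreover have "[(r j * fact j) * int (t choose j) = 1 * int (t choose j)] (mod int p)"
        using r[of j] j by (intro cong_mult[OF _ cong_refl]) (simp add: cong_iff_dvd_diff)
      ultimately have "[int (t choose j) = r j * (\<tau> x * c j x)] (mod int p)"
        by (metis cong_sym cong_trans mult.assoc mult_1)
      then show ?thesis
        by (simp add: cong_iff_dvd_diff mult_ac)
    qed
    have "f x = f (\<pi> x + nat_mul t v)"
      using dec[OF x] by (simp add: t_def)
    also have "\<dots> = (\<Sum>j\<le>p - 1. int (t choose j) * D j)"
      unfolding D_def by (rule newton_expansion[OF t(1)])
    also have "{..p - 1} = insert 0 {1..<p}"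
      using p by auto
    finally have "f x - (f (\<pi> x) + \<tau> x * g x) =
        (\<Sum>j\<in>{1..<p}. (int (t choose j) - \<tau> x * (r j * c j x)) * D j)"
      by (simp add: g_def D_def sum_distrib_left sum_subtractf algebra_simps)
    also have "int p dvd \<dots>"
      by (intro dvd_sum dvd_mult2 cC)
    finally show ?thesis .
  qed
  ultimately show ?thesis
    by (rule that)
qed

subsection \<open>Lifting decompositions from subgroups\<close>

text \<open>The degree bounds are strict, so 2, 4 and 3 mean linear, cubic and quadratic. Both sums
  have the same length; the shorter one is padded with zeros.\<close>

definition decomposes :: "nat \<Rightarrow> 'a::ab_group_add set \<Rightarrow> nat \<Rightarrow> ('a \<Rightarrow> int) \<Rightarrow> bool" where
  "decomposes p V c f \<longleftrightarrow> (\<exists>l g q q'.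
    (\<forall>j<c. deg_lt p V 2 (l j) \<and> deg_lt p V 4 (g j) \<and> deg_lt p V 3 (q j) \<and> deg_lt p V 3 (q' j)) \<and>
    (\<forall>x\<in>V. int p dvd f x - ((\<Sum>j<c. l j x * g j x) + (\<Sum>j<c. q j x * q' j x))))"

lemma decomposesI:
  assumes "\<And>j. j < c \<Longrightarrow> deg_lt p V 2 (l j)" "\<And>j. j < c \<Longrightarrow> deg_lt p V 4 (g j)"
    "\<And>j. j < c \<Longrightarrow> deg_lt p V 3 (q j)" "\<And>j. j < c \<Longrightarrow> deg_lt p V 3 (q' j)"
    "\<And>x. x \<in> V \<Longrightarrow> int p dvd f x - ((\<Sum>j<c. l j x * g j x) + (\<Sum>j<c. q j x * q' j x))"
  shows "decomposes p V c f"
  using assms unfolding decomposes_def by blast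

lemma decomposes_shift:
  assumes V: "add_subgroup V" and z: "z \<in> V" and dec: "decomposes p V c (\<lambda>x. f (z + x))"
  shows "decomposes p V c f"
proof -
  obtain l g q q' where *: "\<forall>j<c. deg_lt p V 2 (l j) \<and> deg_lt p V 4 (g j) \<and> deg_lt p V 3 (q j) \<and> deg_lt p V 3 (q' j)"
    "\<forall>x\<in>V. int p dvd f (z + x) - ((\<Sum>j<c. l j x * g j x) + (\<Sum>j<c. q j x * q' j x))"
    using dec unfolding decomposes_def by blast
  have z': "- z \<in> V"
    using V z by (rule add_subgroup_uminus)
  have "int p dvd f x - ((\<Sum>j<c. l j (- z + x) * g j (- z + x)) + (\<Sum>j<c. q j (- z + x) * q' j (- z + x)))"
    if "x \<in> V" for x
    using *(2)[rule_format, OF add_subgroup_add[OF V z' that]] by simp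
  then show ?thesis
    using *(1)
    by (intro decomposesI[of c p V "\<lambda>j x. l j (- z + x)" "\<lambda>j x. g j (- z + x)"
        "\<lambda>j x. q j (- z + x)" "\<lambda>j x. q' j (- z + x)"] deg_lt_shift V z') blast+
qed

lemma nat_mul_mem_subgroup:
  assumes "prime p" and U: "add_subgroup U" and v: "v \<notin> U" "nat_mul p v = 0"
    and t: "nat_mul t v \<in> U"
  shows "p dvd t"
proof (rule ccontr)
  assume "\<not> p dvd t"
  then have "coprime t p"
    using assms(1) by (simp add: prime_imp_coprime coprime_commute)
  then obtain s where "[t * s = Suc 0] (mod p)"
    using cong_solve_coprime_nat by blast
  then have s: "(s * t) mod p = 1"
    using prime_gt_1_nat[OF assms(1)] by (simp add: cong_def mult.commute)
  have "nat_mul (s * t) v \<in> U"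
    using nat_mul_mem[OF U t] by (simp add: nat_mul_mult)
  then show False
    using nat_mul_mod[OF v(2), of "s * t"] s v(1) by simp
qed

lemma decomposes_extend:
  assumes "prime p" and U: "add_subgroup U" and v: "v \<notin> U" "nat_mul p v = 0"
    and dec: "decomposes p U c f" and "U1 = {u + nat_mul t v |u t. u \<in> U \<and> t < p}"
    and U1: "add_subgroup U1" and f: "deg_lt p U1 5 f"
  shows "decomposes p U1 (Suc c) f"
proof -
  have p: "p > 1"
    using assms(1) by (rule prime_gt_1_nat)
  have unique: "s mod p = t mod p" if "x - nat_mul s v \<in> U" "x - nat_mul t v \<in> U" for x s t
    using that
  proof (induction s t rule: linorder_wlog)
    case (le s t)
    have "(x - nat_mul s v) - (x - nat_mul t v) = nat_mul (t - s) v"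
      using nat_mul_add[of s "t - s" v] le(1) by (simp add: algebra_simps)
    then have "p dvd t - s"
      using nat_mul_mem_subgroup[OF assms(1) U v] add_subgroup_diff[OF U le(2,3)] by simp
    then show ?case
      using le(1) mod_eq_dvd_iff_nat by metis
  qed metis
  \<comment> \<open>The coordinate of \<open>x\<close> along \<open>v\<close>. By
    \<open>unique\<close> it is additive modulo \<open>p\<close>, so that it is linear and
    subtracting the part along \<open>v\<close> is an additive projection onto
    \<open>U\<close>.\<close>
  define d where "d x = (SOME t. t < p \<and> x - nat_mul t v \<in> U)" for x
  have d: "d x < p" "x - nat_mul (d x) v \<in> U" if "x \<in> U1" for x
  proof -
    have "\<exists>t. t < p \<and> x - nat_mul t v \<in> U"
      using that assms(6) by auto
    then show "d x < p" "x - nat_mul (d x) v \<in> U"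
      unfolding d_def by (metis (mono_tags, lifting) someI_ex)+
  qed
  have d_add: "d (x + y) = (d x + d y) mod p" if xy: "x \<in> U1" "y \<in> U1" for x y
  proof -
    have "(x - nat_mul (d x) v) + (y - nat_mul (d y) v) \<in> U"
      using d xy by (intro add_subgroup_add[OF U]) auto
    then have "(x + y) - nat_mul (d x + d y) v \<in> U"
      by (simp add: nat_mul_add algebra_simps)
    moreover have "x + y \<in> U1"
      using xy by (rule add_subgroup_add[OF U1])
    ultimately have "d (x + y) mod p = (d x + d y) mod p"
      using d by (intro unique[of "x + y"]) auto
    then show ?thesis
      using d[OF \<open>x + y \<in> U1\<close>] by simp
  qed
  define \<pi> where "\<pi> x = x - nat_mul (d x) v" for x
  have \<pi>U: "\<pi> x \<in> U" if "x \<in> U1" for x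
    using d that by (simp add: \<pi>_def)
  have \<pi>_add: "\<pi> (x + y) = \<pi> x + \<pi> y" if "x \<in> U1" "y \<in> U1" for x y
    using that by (simp add: \<pi>_def d_add nat_mul_mod[OF v(2)] nat_mul_add)
  have UU1: "U \<subseteq> U1"
  proof
    fix x assume "x \<in> U"
    moreover have "x = x + nat_mul 0 v"
      by simp
    ultimately show "x \<in> U1"
      unfolding assms(6) using p by fastforce
  qed
  have "v \<in> U1"
  proof -
    have "v = 0 + nat_mul 1 v"
      by simp
    then show ?thesis
      unfolding assms(6) using p add_subgroup_zero[OF U] by blast
  qed
  define \<tau> where "\<tau> x = int (d x)" for x
  have \<tau>: "deg_lt p U1 2 \<tau>"
  proof -
    have "int p dvd fdiff a \<tau> x - \<tau> a" if "a \<in> U1" "x \<in> U1" for a x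
    proof -
      have "int p dvd int ((d x + d a) mod p) - int (d x + d a)"
        by (simp add: mod_eq_dvd_iff[symmetric] zmod_int)
      then show ?thesis
        using d_add[OF that(2,1)] by (simp add: \<tau>_def fdiff_def algebra_simps)
    qed
    then have "deg_lt p U1 (Suc 0) (fdiff a \<tau>)" if "a \<in> U1" for a
      using that by (intro deg_lt_congI[OF deg_lt_const U1])
    then show ?thesis
      unfolding numeral_2_eq_2 deg_lt.simps(2)[of p U1 "Suc 0"] by blast
  qed
  have split: "x = \<pi> x + nat_mul (nat (\<tau> x mod int p)) v" if "x \<in> U1" for x
    using d[OF that] by (simp add: \<pi>_def \<tau>_def)
  have \<pi>U1: "\<pi> x \<in> U1" if "x \<in> U1" for x
    using \<pi>U[OF that] UU1 by blast
  have f5: "deg_lt p U1 (Suc 4) f"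
    using f by (simp add: eval_nat_numeral)
  obtain h where h: "deg_lt p U1 4 h" "\<And>x. x \<in> U1 \<Longrightarrow> int p dvd f x - (f (\<pi> x) + \<tau> x * h x)"
    using division_by_linear[OF assms(1) U1 \<open>v \<in> U1\<close> \<pi>U1 \<pi>_add \<tau> split f5] by metis
  obtain l g q q' where *: "\<forall>j<c. deg_lt p U 2 (l j) \<and> deg_lt p U 4 (g j) \<and> deg_lt p U 3 (q j) \<and> deg_lt p U 3 (q' j)"
    "\<forall>x\<in>U. int p dvd f x - ((\<Sum>j<c. l j x * g j x) + (\<Sum>j<c. q j x * q' j x))"
    using dec unfolding decomposes_def by blast
  have comp: "deg_lt p U1 k (\<lambda>x. e (\<pi> x))" if "deg_lt p U k e" for k e
    using deg_lt_comp[OF that U add_subgroup_zero[OF U] \<pi>U \<pi>_add U1] by simp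
  \<comment> \<open>The new product \<open>\<tau> * h\<close> takes the slot \<open>c\<close>; the
    matching quadratic slot is filled with zeros.\<close>
  let ?l = "\<lambda>j x. if j < c then l j (\<pi> x) else \<tau> x" and ?g = "\<lambda>j x. if j < c then g j (\<pi> x) else h x"
  let ?q = "\<lambda>j x. if j < c then q j (\<pi> x) else 0" and ?q' = "\<lambda>j x. if j < c then q' j (\<pi> x) else 0"
  show ?thesis
  proof (rule decomposesI[of "Suc c" p U1 ?l ?g ?q ?q'])
    fix j
    show "deg_lt p U1 2 (?l j)" "deg_lt p U1 4 (?g j)" "deg_lt p U1 3 (?q j)" "deg_lt p U1 3 (?q' j)"
      using *(1) \<tau> h(1) by (cases "j < c"; simp only: if_True if_False comp deg_lt_zero)+
  next
    fix x assume x: "x \<in> U1"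
    have "int p dvd (f x - (f (\<pi> x) + \<tau> x * h x)) +
        (f (\<pi> x) - ((\<Sum>j<c. l j (\<pi> x) * g j (\<pi> x)) + (\<Sum>j<c. q j (\<pi> x) * q' j (\<pi> x))))"
      using h(2)[OF x] *(2) \<pi>U[OF x] by (intro dvd_add) auto
    then show "int p dvd f x - ((\<Sum>j<Suc c. ?l j x * ?g j x) + (\<Sum>j<Suc c. ?q j x * ?q' j x))"
      by (simp add: algebra_simps)
  qed
qed

lemma add_subgroup_extend:
  assumes "p > 0" and U: "add_subgroup U" and v: "nat_mul p v = 0"
  shows "add_subgroup {u + nat_mul t v |u t. u \<in> U \<and> t < p}" (is "add_subgroup ?W")
  unfolding add_subgroup_def
proof (intro conjI ballI)
  show "0 \<in> ?W"
    using assms add_subgroup_zero by (auto intro!: exI[of _ 0])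
  fix x y assume "x \<in> ?W" "y \<in> ?W"
  then obtain u t u' t' where x: "x = u + nat_mul t v" "u \<in> U" "t < p"
    and y: "y = u' + nat_mul t' v" "u' \<in> U" "t' < p"
    by auto
  have "nat_mul t' v + nat_mul (p - t') v = 0"
    using y(3) v nat_mul_add[of t' "p - t'" v] by simp
  then have "- nat_mul t' v = nat_mul (p - t') v"
    by (rule minus_unique)
  then have "x - y = (u - u') + (nat_mul t v + nat_mul (p - t') v)"
    using x y by (simp flip: \<open>- nat_mul t' v = nat_mul (p - t') v\<close>)
  then have "x - y = (u - u') + nat_mul ((t + (p - t')) mod p) v"
    by (simp only: nat_mul_mod[OF v] nat_mul_add)
  moreover have "u - u' \<in> U"
    using x y U by (auto intro: add_subgroup_diff)
  moreover have "(t + (p - t')) mod p < p"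
    using assms by simp
  ultimately show "x - y \<in> ?W"
    by blast
qed

text \<open>Each vector outside \<open>U\<close> multiplies the cardinality by \<open>p\<close> and
  costs one product. Since \<open>V\<close> may be exhausted early, only an upper bound for the
  number of products is claimed.\<close>

lemma decomposes_lift:
  assumes "prime p" and V: "add_subgroup V" "finite V" "\<And>v. v \<in> V \<Longrightarrow> nat_mul p v = 0"
    and f: "deg_lt p V 5 f"
  shows "index_le p r V U \<Longrightarrow> decomposes p U c f \<Longrightarrow> \<exists>c'\<le>c + r. decomposes p V c' f"
proof (induction r arbitrary: U c)
  case 0
  then have "U \<subseteq> V" "card V \<le> card U"
    by (auto simp: index_le_def)
  then have "U = V"
    using V card_seteq by blast
  then show ?case
    using 0 by auto
next
  case (Suc r)
  have p: "p > 1"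
    using assms(1) by (rule prime_gt_1_nat)
  note U = index_le_subgroup[OF Suc.prems(1)] index_le_subset[OF Suc.prems(1)]
  show ?case
  proof (cases "U = V")
    case True
    then show ?thesis
      using Suc.prems by (intro exI[of _ c]) simp
  next
    case False
    then obtain v where v: "v \<in> V" "v \<notin> U"
      using U by auto
    define U1 where "U1 = {u + nat_mul t v |u t. u \<in> U \<and> t < p}"
    have subU1: "add_subgroup U1" "U1 \<subseteq> V"
      unfolding U1_def using p U v V
      by (auto intro!: add_subgroup_extend add_subgroup_add nat_mul_mem)
    have "inj_on (\<lambda>(u, t). u + nat_mul t v) (U \<times> {..<p})"
    proof -
      have "t = t'" if "u + nat_mul t v = u' + nat_mul t' v" "u \<in> U" "u' \<in> U" "t < p" "t' < p" for u u' t t'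
        using that
      proof (induction t t' arbitrary: u u' rule: linorder_wlog)
        case (le t t')
        have "u - u' = nat_mul (t' - t) v"
          using nat_mul_add[of t "t' - t" v] le(1,2) by (simp add: algebra_simps)
        then have "p dvd t' - t"
          using nat_mul_mem_subgroup[OF assms(1) U(1) v(2) V(3)[OF v(1)]] add_subgroup_diff[OF U(1) le(3,4)] by simp
        then show ?case
          using le by (metis dvd_imp_le diff_is_0_eq dual_order.antisym less_imp_diff_less not_less zero_less_diff)
      qed metis
      then show ?thesis
        by (auto simp: inj_on_def) (metis add_right_cancel)
    qed
    moreover have "U1 = (\<lambda>(u, t). u + nat_mul t v) ` (U \<times> {..<p})"
      by (auto simp: U1_def)
    ultimately have "card U1 = card U * p"
      by (simp add: card_image card_cartesian_product)
    then have "index_le p r V U1"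
      using Suc.prems(1) subU1 by (simp add: index_le_def mult_ac)
    moreover have "decomposes p U1 (Suc c) f"
      by (rule decomposes_extend[OF assms(1) U(1) v(2) V(3)[OF v(1)] Suc.prems(2) U1_def subU1(1)])
         (rule deg_lt_subset[OF f V(1) subU1])
    ultimately show ?thesis
      using Suc.IH by fastforce
  qed
qed

subsection \<open>The spaces of points as subgroups of a fixed group\<close>

text \<open>The additive circle group contains every prime field as a subgroup, so that all spaces
  of points are finite subgroups of the same type.\<close>
typedef circle = "{z :: complex. cmod z = 1}"
  by (rule exI[of _ 1]) simp

setup_lifting type_definition_circle

instantiation circle :: ab_group_add
begin

lift_definition zero_circle :: circle is 1 by simp
lift_definition plus_circle :: "circle \<Rightarrow> circle \<Rightarrow> circle" is "(*)" by (simp add: norm_mult)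
lift_definition uminus_circle :: "circle \<Rightarrow> circle" is inverse by (simp add: norm_inverse)
lift_definition minus_circle :: "circle \<Rightarrow> circle \<Rightarrow> circle" is "(/)" by (simp add: norm_divide)

instance
proof
  fix a b c :: circle
  show "a + b + c = a + (b + c)"
    by transfer (simp add: mult.assoc)
  show "a + b = b + a"
    by transfer (simp add: mult.commute)
  show "0 + a = a"
    by transfer simp
  show "- a + a = 0"
    by transfer (metis left_inverse norm_zero zero_neq_one)
  show "a - b = a + - b"
    by transfer (simp add: divide_inverse)
qed

end

lift_definition unit_root :: "nat \<Rightarrow> int \<Rightarrow> circle" is chr
  by simp

lemma unit_root_add: "unit_root p (k + l) = unit_root p k + unit_root p l"
  by transfer (rule chr_add)

lemma unit_root_0 [simp]: "unit_root p 0 = 0"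
  by transfer simp

lemma unit_root_diff: "unit_root p (k - l) = unit_root p k - unit_root p l"
  using unit_root_add[of p "k - l" l] by simp

lemma unit_root_eq_0_iff: "p > 0 \<Longrightarrow> unit_root p k = 0 \<longleftrightarrow> int p dvd k"
  by transfer (rule chr_eq_1_iff)

lemma unit_root_eq_iff: "p > 0 \<Longrightarrow> unit_root p k = unit_root p l \<longleftrightarrow> int p dvd k - l"
  using unit_root_eq_0_iff[of p "k - l"] by (simp add: unit_root_diff)

lemma nat_mul_unit_root: "nat_mul t (unit_root p 1) = unit_root p (int t)"
  by (induction t) (simp_all add: add.commute flip: unit_root_add)

definition dlog :: "nat \<Rightarrow> circle \<Rightarrow> int" where
  "dlog p z = (SOME k. k \<in> {0..<int p} \<and> unit_root p k = z)"

lemma dlog: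
  assumes "p > 0" "z \<in> unit_root p ` {0..<int p}"
  shows "dlog p z \<in> {0..<int p}" "unit_root p (dlog p z) = z"
proof -
  have "\<exists>k. k \<in> {0..<int p} \<and> unit_root p k = z"
    using assms by auto
  then show "dlog p z \<in> {0..<int p}" "unit_root p (dlog p z) = z"
    unfolding dlog_def by (metis (mono_tags, lifting) someI_ex)+
qed

lemma unit_root_mem: "p > 0 \<Longrightarrow> unit_root p k \<in> unit_root p ` {0..<int p}"
  by (rule image_eqI[of _ _ "k mod int p"]) (auto simp: unit_root_eq_iff mod_eq_dvd_iff[symmetric])

lemma dlog_unit_root: "p > 0 \<Longrightarrow> int p dvd dlog p (unit_root p k) - k"
  using dlog(2)[OF _ unit_root_mem, of p k] by (simp add: unit_root_eq_iff)

text \<open>A copy of the vector space over the prime field with coordinates in \<open>I\<close>.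
  Outside \<open>I\<close> the value is the group zero, as a subgroup requires. It serves both as
  the domain, with \<open>I = {..<n}\<close>, and as the space of values of a family of quadratic
  functions.\<close>

definition fpspace :: "nat \<Rightarrow> nat set \<Rightarrow> (nat \<Rightarrow> circle) set" where
  "fpspace p I = {z. \<forall>i. (i \<in> I \<longrightarrow> z i \<in> unit_root p ` {0..<int p}) \<and> (i \<notin> I \<longrightarrow> z i = 0)}"

lemma finite_fpspace: "finite I \<Longrightarrow> finite (fpspace p I)"
  unfolding fpspace_def by (rule finite_set_of_finite_funs) auto

lemma fpspace_mem: "p > 0 \<Longrightarrow> z \<in> fpspace p I \<Longrightarrow> z i \<in> unit_root p ` {0..<int p}"
  by (cases "i \<in> I") (auto simp: fpspace_def intro!: image_eqI[of _ _ 0])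

lemma unit_root_dlog: "p > 0 \<Longrightarrow> z \<in> fpspace p I \<Longrightarrow> unit_root p (dlog p (z i)) = z i"
  by (rule dlog(2)[OF _ fpspace_mem])

lemma fpspaceI:
  "p > 0 \<Longrightarrow> (\<And>i. i \<in> I \<Longrightarrow> z i = unit_root p (k i)) \<Longrightarrow> (\<And>i. i \<notin> I \<Longrightarrow> z i = 0) \<Longrightarrow> z \<in> fpspace p I"
  using unit_root_mem by (auto simp: fpspace_def)

lemma fpspaceE:
  assumes "z \<in> fpspace p I"
  obtains k where "\<And>i. i \<in> I \<Longrightarrow> z i = unit_root p (k i)" "\<And>i. i \<notin> I \<Longrightarrow> z i = 0"
proof -
  have "\<forall>i\<in>I. \<exists>k. z i = unit_root p k"
    using assms by (auto simp: fpspace_def)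
  then show ?thesis
    using that assms by (auto simp: fpspace_def dest!: bchoice)
qed

lemma add_subgroup_fpspace:
  assumes "p > 0"
  shows "add_subgroup (fpspace p I)"
  unfolding add_subgroup_def
proof (intro conjI ballI)
  show "0 \<in> fpspace p I"
    by (rule fpspaceI[OF assms, where k = "\<lambda>_. 0"]) auto
  fix x y assume "x \<in> fpspace p I" "y \<in> fpspace p I"
  then obtain k l where "\<And>i. i \<in> I \<Longrightarrow> x i = unit_root p (k i)" "\<And>i. i \<notin> I \<Longrightarrow> x i = 0"
    "\<And>i. i \<in> I \<Longrightarrow> y i = unit_root p (l i)" "\<And>i. i \<notin> I \<Longrightarrow> y i = 0"
    by (elim fpspaceE) blast
  then show "x - y \<in> fpspace p I"
    by (intro fpspaceI[OF assms, where k = "\<lambda>i. k i - l i"]) (auto simp: unit_root_diff)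
qed

lemma nat_mul_fun: "nat_mul t z i = nat_mul t (z i)" for z :: "nat \<Rightarrow> 'a::ab_group_add"
  by (induction t) simp_all

lemma fpspace_torsion:
  assumes "p > 0" "z \<in> fpspace p I"
  shows "nat_mul p z = 0"
proof
  fix i
  obtain k where k: "z i = unit_root p k"
    using unit_root_dlog[OF assms] by metis
  have "nat_mul t (unit_root p k) = unit_root p (int t * k)" for t
    by (induction t) (simp_all add: algebra_simps unit_root_add)
  then show "nat_mul p z i = 0 i"
    using assms by (simp add: nat_mul_fun k unit_root_eq_0_iff)
qed

lemma deg_lt_dlog:
  assumes "p > 0"
  shows "deg_lt p (fpspace p I) 2 (\<lambda>z. dlog p (z i))"
proof -
  let ?V = "fpspace p I" and ?\<tau> = "\<lambda>z. dlog p (z i)"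
  note V = add_subgroup_fpspace[OF assms, of I]
  have "int p dvd fdiff a ?\<tau> x - ?\<tau> a" if "a \<in> ?V" "x \<in> ?V" for a x
  proof -
    have "x + a \<in> ?V"
      using V that by (auto intro: add_subgroup_add)
    then have "unit_root p (dlog p ((x + a) i) - dlog p (x i) - dlog p (a i)) = 0"
      using that assms by (simp add: unit_root_diff unit_root_dlog unit_root_dlog[of p "x + a" I i, simplified])
    then show ?thesis
      using assms by (simp add: unit_root_eq_0_iff fdiff_def)
  qed
  then have "deg_lt p ?V (Suc 0) (fdiff a ?\<tau>)" if "a \<in> ?V" for a
    using that by (intro deg_lt_congI[OF deg_lt_const V])
  then show ?thesis
    unfolding numeral_2_eq_2 deg_lt.simps(2)[of p ?V "Suc 0"] by blast
qed

subsection \<open>Polynomial representation\<close>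

text \<open>Polynomial functions of degree at most \<open>d\<close> with integer coefficients, in
  the nested form that repeated division by the coordinates produces.\<close>

primrec is_poly :: "nat set \<Rightarrow> nat \<Rightarrow> ((nat \<Rightarrow> int) \<Rightarrow> int) \<Rightarrow> bool" where
  "is_poly I 0 f \<longleftrightarrow> (\<exists>c. f = (\<lambda>x. c))"
| "is_poly I (Suc d) f \<longleftrightarrow> (\<exists>c g. (\<forall>i\<in>I. is_poly I d (g i)) \<and> f = (\<lambda>x. c + (\<Sum>i\<in>I. x i * g i x)))"

lemma is_poly_cong:
  "is_poly I d f \<Longrightarrow> (\<And>i. i \<in> I \<Longrightarrow> [x i = y i] (mod m)) \<Longrightarrow> [f x = f y] (mod m)"
  by (induction d arbitrary: f) (auto intro!: cong_add cong_sum cong_mult)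

lemma linear_form_deg:
  assumes "is_poly I 1 f" "\<And>i. i \<in> I \<Longrightarrow> deg_lt p V (Suc k) (q i)"
  shows "deg_lt p V (Suc k) (\<lambda>x. f (\<lambda>i. q i x))"
proof -
  obtain c g where g: "\<forall>i\<in>I. \<exists>b. g i = (\<lambda>x. b)" "f = (\<lambda>x. c + (\<Sum>i\<in>I. x i * g i x))"
    using assms(1) by auto
  then obtain b where b: "\<And>i. i \<in> I \<Longrightarrow> g i = (\<lambda>x. b i)"
    by metis
  have "deg_lt p V (Suc k) (\<lambda>x. c + (\<Sum>i\<in>I. b i * q i x))"
    by (intro deg_lt_add deg_lt_const deg_lt_sum deg_lt_cmult assms)
  moreover have "(\<lambda>x. f (\<lambda>i. q i x)) = (\<lambda>x. c + (\<Sum>i\<in>I. b i * q i x))"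
    by (simp add: g(2) b mult.commute cong: sum.cong)
  ultimately show ?thesis
    by simp
qed

definition drop_coords :: "nat set \<Rightarrow> (nat \<Rightarrow> circle) \<Rightarrow> nat \<Rightarrow> circle" where
  "drop_coords J z = (\<lambda>i. if i \<in> J then 0 else z i)"

lemma drop_coords_mem: "p > 0 \<Longrightarrow> z \<in> fpspace p I \<Longrightarrow> drop_coords J z \<in> fpspace p I"
  by (auto simp: drop_coords_def fpspace_def intro!: image_eqI[of _ _ 0])

lemma drop_coords_add: "drop_coords J (x + y) = drop_coords J x + drop_coords J y"
  by (simp add: drop_coords_def fun_eq_iff)

text \<open>Coordinates are set to 0 one after the other; each time
  \<open>division_by_linear\<close> splits off a multiple of the coordinate, evaluated where the
  earlier coordinates are already 0.\<close>

lemma coordinate_expansion: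
  assumes "prime p" "finite J" "J \<subseteq> I" and f: "deg_lt p (fpspace p I) (Suc d) f"
  shows "\<exists>g. (\<forall>i\<in>J. deg_lt p (fpspace p I) d (g i)) \<and> (\<forall>z\<in>fpspace p I.
    int p dvd f z - (f (drop_coords J z) + (\<Sum>i\<in>J. dlog p (z i) * g i z)))"
  using assms(2,3)
proof (induction J rule: finite_induct)
  case empty
  then show ?case
    by (simp add: drop_coords_def)
next
  case (insert j J)
  let ?V = "fpspace p I"
  have p: "p > 0"
    using assms(1) by (rule prime_gt_0_nat)
  note V = add_subgroup_fpspace[OF p, of I]
  obtain g where g: "\<forall>i\<in>J. deg_lt p ?V d (g i)"
    "\<forall>z\<in>?V. int p dvd f z - (f (drop_coords J z) + (\<Sum>i\<in>J. dlog p (z i) * g i z))"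
    using insert by auto
  define v where "v = (\<lambda>i. if i = j then unit_root p 1 else 0)"
  have v: "v \<in> ?V"
    using insert by (intro fpspaceI[OF p, where k = "\<lambda>i. if i = j then 1 else 0"]) (auto simp: v_def)
  have split: "z = drop_coords {j} z + nat_mul (nat (dlog p (z j) mod int p)) v" if z: "z \<in> ?V" for z
  proof
    fix i
    have "dlog p (z j) \<in> {0..<int p}"
      by (rule dlog(1)[OF p fpspace_mem[OF p z]])
    then have "nat_mul (nat (dlog p (z j) mod int p)) (unit_root p 1) = unit_root p (dlog p (z j))"
      by (simp add: nat_mul_unit_root)
    then show "z i = (drop_coords {j} z + nat_mul (nat (dlog p (z j) mod int p)) v) i"
      using unit_root_dlog[OF p z, of j] by (simp add: nat_mul_fun v_def drop_coords_def)
  qed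
  obtain h where h: "deg_lt p ?V d h"
    "\<And>z. z \<in> ?V \<Longrightarrow> int p dvd f z - (f (drop_coords {j} z) + dlog p (z j) * h z)"
    using division_by_linear[OF assms(1) V v drop_coords_mem[OF p] drop_coords_add deg_lt_dlog[OF p] split f]
    by blast
  define g' where "g' i = (if i = j then (\<lambda>z. h (0 + drop_coords J z)) else g i)" for i
  have "deg_lt p ?V d (\<lambda>z. h (0 + drop_coords J z))"
    using drop_coords_mem[OF p] drop_coords_add
    by (intro deg_lt_comp[OF h(1) V add_subgroup_zero[OF V] _ _ V])
  then have "\<forall>i\<in>insert j J. deg_lt p ?V d (g' i)"
    using g(1) by (auto simp: g'_def)
  moreover have "int p dvd f z - (f (drop_coords (insert j J) z) + (\<Sum>i\<in>insert j J. dlog p (z i) * g' i z))"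
    if z: "z \<in> ?V" for z
  proof -
    have "drop_coords {j} (drop_coords J z) = drop_coords (insert j J) z" "drop_coords J z j = z j"
      using insert by (auto simp: drop_coords_def fun_eq_iff)
    then have 1: "int p dvd f (drop_coords J z) -
        (f (drop_coords (insert j J) z) + dlog p (z j) * h (drop_coords J z))"
      using h(2)[OF drop_coords_mem[OF p z, of J]] by simp
    have "(\<Sum>i\<in>J. dlog p (z i) * g' i z) = (\<Sum>i\<in>J. dlog p (z i) * g i z)"
      using insert by (intro sum.cong) (auto simp: g'_def)
    then have sum: "(\<Sum>i\<in>insert j J. dlog p (z i) * g' i z) =
        dlog p (z j) * h (drop_coords J z) + (\<Sum>i\<in>J. dlog p (z i) * g i z)"
      using insert(1,2) by (simp add: g'_def)
    from dvd_add[OF g(2)[rule_format, OF z] 1] show ?thesis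
      unfolding sum by (simp add: algebra_simps)
  qed
  ultimately show ?case
    by blast
qed

text \<open>Once all coordinates are dropped only the constant \<open>f 0\<close> remains, and the
  cofactors have smaller degree. The argument is valid for every prime, also when
  \<open>p \<le> d\<close>.\<close>

lemma polynomial_representation:
  assumes "prime p" "finite I"
  shows "deg_lt p (fpspace p I) (Suc d) f \<Longrightarrow>
    \<exists>g. is_poly I d g \<and> (\<forall>z\<in>fpspace p I. [f z = g (\<lambda>i. dlog p (z i))] (mod int p))"
proof (induction d arbitrary: f)
  case 0
  have "p > 0"
    using assms(1) by (rule prime_gt_0_nat)
  then have "\<forall>z\<in>fpspace p I. int p dvd f z - f 0"
    using 0 deg_lt_1_iff[OF add_subgroup_fpspace] by blast
  then show ?case
    by (intro exI[of _ "\<lambda>x. f 0"] conjI) (auto simp: cong_iff_dvd_diff)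
next
  case (Suc d)
  let ?V = "fpspace p I"
  obtain g where g: "\<forall>i\<in>I. deg_lt p ?V (Suc d) (g i)"
    "\<forall>z\<in>?V. int p dvd f z - (f (drop_coords I z) + (\<Sum>i\<in>I. dlog p (z i) * g i z))"
    using coordinate_expansion[OF assms subset_refl Suc.prems] by blast
  have "\<forall>i\<in>I. \<exists>h. is_poly I d h \<and> (\<forall>z\<in>?V. [g i z = h (\<lambda>i. dlog p (z i))] (mod int p))"
    using g(1) Suc.IH by blast
  then obtain h where h: "\<And>i. i \<in> I \<Longrightarrow> is_poly I d (h i)"
    "\<And>i z. i \<in> I \<Longrightarrow> z \<in> ?V \<Longrightarrow> [g i z = h i (\<lambda>i. dlog p (z i))] (mod int p)"
    by metis
  have "[f z = f 0 + (\<Sum>i\<in>I. dlog p (z i) * h i (\<lambda>i. dlog p (z i)))] (mod int p)" if z: "z \<in> ?V" for z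
  proof -
    have "drop_coords I z = 0"
      using z by (auto simp: drop_coords_def fpspace_def fun_eq_iff)
    then have "[f z = f 0 + (\<Sum>i\<in>I. dlog p (z i) * g i z)] (mod int p)"
      using g(2) z by (auto simp: cong_iff_dvd_diff)
    also have "[f 0 + (\<Sum>i\<in>I. dlog p (z i) * g i z) =
        f 0 + (\<Sum>i\<in>I. dlog p (z i) * h i (\<lambda>i. dlog p (z i)))] (mod int p)"
      using z by (intro cong_add cong_sum cong_mult cong_refl h)
    finally show ?thesis .
  qed
  then show ?case
    using h(1) by (intro exI[of _ "\<lambda>x. f 0 + (\<Sum>i\<in>I. x i * h i x)"]) auto
qed

subsection \<open>Quartic functions of regular quadratic functions\<close>

lemma prescribed_cube:
  assumes p: "prime p" and U: "add_subgroup U" "finite U" and I: "finite I"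
    and q: "\<And>i. i \<in> I \<Longrightarrow> deg_lt p U 3 (q i)" and reg: "regular p s U I q"
    and s: "30 * card I + 4 \<le> s" and x: "x \<in> U"
  shows "\<exists>a\<in>tuples U. \<forall>i\<in>I. \<forall>l<5. \<forall>j\<le>l. int p dvd cube_coord q x (i, l, j) a - \<tau> i l j"
proof -
  have T: "card (tuples U) > 0"
    using U by (intro add_subgroup_card_pos add_subgroup_tuples finite_tuples)
  have "3 * card (tuples U) \<le> 4 * (p ^ (15 * card I) * card {a \<in> tuples U. \<forall>w\<in>cube_index I.
      int p dvd cube_coord q x w a - (case w of (i, l, j) \<Rightarrow> \<tau> i l j)})"
    by (rule cube_equidistributed[OF p U I q reg s x])
  then have "card {a \<in> tuples U. \<forall>w\<in>cube_index I.
      int p dvd cube_coord q x w a - (case w of (i, l, j) \<Rightarrow> \<tau> i l j)} \<noteq> 0"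
    using T by (metis (no_types, lifting) le_zero_eq mult_0_right mult_eq_0_iff not_gr0 zero_neq_numeral)
  then obtain a where a: "a \<in> tuples U"
    "\<forall>w\<in>cube_index I. int p dvd cube_coord q x w a - (case w of (i, l, j) \<Rightarrow> \<tau> i l j)"
    by (metis (mono_tags, lifting) card.empty empty_Collect_eq)
  have "int p dvd cube_coord q x (i, l, j) a - \<tau> i l j" if "i \<in> I" "j \<le> l" "l < 5" for i l j
    using a(2)[rule_format, of "(i, l, j)"] that by (simp add: cube_index_def)
  then show ?thesis
    using a(1) by blast
qed

text \<open>On a suitable cube with directions \<open>0, \<dots>, 4\<close>, the value of the vector \<open>q\<close> at a vertex is \<open>z\<close>
  plus \<open>u\<close>, \<open>v\<close>, \<open>w\<close> if the vertex involves both \<open>0\<close> and \<open>1\<close>, both \<open>2\<close> and \<open>3\<close>, or \<open>4\<close>. The alternating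
  sum of \<open>F\<close> over the cube is then a third difference of \<open>F\<close>.\<close>
lemma third_difference_on_cube:
  fixes F :: "'a::ab_group_add \<Rightarrow> int"
  shows "(\<Sum>S\<in>Pow {..<5::nat}. (- 1) ^ card S * F (z + (if 0 \<in> S \<and> 1 \<in> S then u else 0) +
      (if 2 \<in> S \<and> 3 \<in> S then v else 0) + (if 4 \<in> S then w else 0))) =
    - fdiff w (fdiff v (fdiff u F)) z"
proof -
  have "{..<5::nat} = {0, 1, 2, 3, 4}"
    by auto
  then show ?thesis
    by (simp only:) (simp add: sum_Pow_insert; simp add: fdiff_def add_ac)
qed

text \<open>The map \<open>Q\<close> is onto, so \<open>f\<close> induces a function
  \<open>F\<close> on the space of values. Every third difference of \<open>F\<close> is realised by
  a cube in \<open>U\<close>, where the fifth difference of \<open>f\<close> vanishes. So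
  \<open>F\<close> is a quadratic polynomial, and writing it as a constant plus coordinates times
  affine forms gives the products.\<close>

lemma function_of_quadratics:
  fixes f :: "'a::ab_group_add \<Rightarrow> int"
  assumes p: "prime p" and U: "add_subgroup U" "finite U" and I: "finite I"
    and q: "\<And>i. i \<in> I \<Longrightarrow> deg_lt p U 3 (q i)" and reg: "regular p s U I q"
    and s: "30 * card I + 4 \<le> s" and f: "deg_lt p U 5 f"
    and det: "\<And>x y. x \<in> U \<Longrightarrow> y \<in> U \<Longrightarrow> (\<And>i. i \<in> I \<Longrightarrow> int p dvd q i x - q i y) \<Longrightarrow>
      int p dvd f x - f y"
  shows "\<exists>c q'. (\<forall>i\<in>I. deg_lt p U 3 (q' i)) \<and> (\<forall>x\<in>U. [f x = c + (\<Sum>i\<in>I. q i x * q' i x)] (mod int p))"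
proof -
  have p0: "p > 0"
    using p by (rule prime_gt_0_nat)
  let ?V = "fpspace p I"
  note V = add_subgroup_fpspace[OF p0, of I]
  define Q where "Q x = (\<lambda>i. if i \<in> I then unit_root p (q i x) else 0)" for x
  have QV: "Q x \<in> ?V" for x
    by (rule fpspaceI[OF p0]) (auto simp: Q_def)
  have Q_eqI: "Q x = z" if "z \<in> ?V" "\<And>i. i \<in> I \<Longrightarrow> int p dvd q i x - dlog p (z i)" for x z
  proof
    fix i
    show "Q x i = z i"
    proof (cases "i \<in> I")
      case True
      then have "unit_root p (q i x) = unit_root p (dlog p (z i))"
        using that(2) p0 by (simp add: unit_root_eq_iff)
      then show ?thesis
        using True unit_root_dlog[OF p0 that(1)] by (simp add: Q_def)
    next
      case False
      then show ?thesis
        using that(1) by (auto simp: Q_def fpspace_def)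
    qed
  qed
  have Q_det: "int p dvd f x - f y" if "x \<in> U" "y \<in> U" "Q x = Q y" for x y
  proof (rule det[OF that(1,2)])
    fix i assume "i \<in> I"
    then show "int p dvd q i x - q i y"
      using fun_cong[OF that(3), of i] p0 by (simp add: Q_def unit_root_eq_iff)
  qed
  \<comment> \<open>The choice of a preimage is harmless: by \<open>Q_det\<close> it affects the
    value only by a multiple of \<open>p\<close>.\<close>
  define F where "F z = f (SOME x. x \<in> U \<and> Q x = z)" for z
  have F: "[F (Q x) = f x] (mod int p)" if x: "x \<in> U" for x
  proof -
    define y where "y = (SOME y. y \<in> U \<and> Q y = Q x)"
    have "\<exists>y. y \<in> U \<and> Q y = Q x"
      using x by blast
    then have y: "y \<in> U \<and> Q y = Q x"
      unfolding y_def by (rule someI_ex)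
    have "int p dvd f y - f x"
      by (rule Q_det[OF conjunct1[OF y] x conjunct2[OF y]])
    then show ?thesis
      unfolding F_def y_def cong_iff_dvd_diff .
  qed
  \<comment> \<open>The diagonal coordinate of direction 0 at base point 0 is the value of
    \<open>q i\<close> at \<open>a 0\<close>, which can be prescribed.\<close>
  have surj: "\<exists>x\<in>U. Q x = z" if z: "z \<in> ?V" for z
  proof -
    have "\<exists>a\<in>tuples U. \<forall>i\<in>I. \<forall>l<5. \<forall>j\<le>l. int p dvd cube_coord q 0 (i, l, j) a - dlog p (z i)"
      by (rule prescribed_cube[OF p U I q reg s add_subgroup_zero[OF U(1)]])
    then obtain a where a: "a \<in> tuples U"
      "\<forall>i\<in>I. \<forall>l<5. \<forall>j\<le>l. int p dvd cube_coord q 0 (i, l, j) a - dlog p (z i)"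
      by (elim bexE)
    have "Q (a 0) = z"
      using a(2)[rule_format, of _ 0 0] by (intro Q_eqI z) (simp add: cube_coord_def)
    then show ?thesis
      using tuples_mem[OF U(1) a(1)] by blast
  qed
  have "int p dvd fdiff w (fdiff v (fdiff u F)) z"
    if u: "u \<in> ?V" and v: "v \<in> ?V" and w: "w \<in> ?V" and z: "z \<in> ?V" for u v w z
  proof -
    obtain x where x: "x \<in> U" "Q x = z"
      using surj[OF z] by blast
    have qx: "int p dvd q i x - dlog p (z i)" if "i \<in> I" for i
      using fun_cong[OF x(2), of i] unit_root_dlog[OF p0 z, of i] that p0
      by (simp add: Q_def flip: unit_root_eq_iff)
    \<comment> \<open>Single steps do not change \<open>q\<close>, except that direction 4 adds
      \<open>w\<close>; the pairs (0, 1) and (2, 3) have polar values \<open>u\<close> and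
      \<open>v\<close>, and all other pairs 0. This is the configuration of
      \<open>third_difference_on_cube\<close>.\<close>
    define \<tau> where "\<tau> i l j = (if l = j then q i x + (if l = 4 then dlog p (w i) else 0)
      else if (l, j) = (1, 0) then dlog p (u i) else if (l, j) = (3, 2) then dlog p (v i) else 0)"
      for i l j :: nat
    have "\<exists>a\<in>tuples U. \<forall>i\<in>I. \<forall>l<5. \<forall>j\<le>l. int p dvd cube_coord q x (i, l, j) a - \<tau> i l j"
      by (rule prescribed_cube[OF p U I q reg s x(1)])
    then obtain a where a: "a \<in> tuples U"
      "\<forall>i\<in>I. \<forall>l<5. \<forall>j\<le>l. int p dvd cube_coord q x (i, l, j) a - \<tau> i l j"
      by (elim bexE)
    have aU: "a j \<in> U" for j
      using tuples_mem[OF U(1) a(1)] .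
    define Z where "Z S = z + (if 0 \<in> S \<and> 1 \<in> S then u else 0) + (if 2 \<in> S \<and> 3 \<in> S then v else 0) +
      (if 4 \<in> S then w else 0)" for S :: "nat set"
    have ZV: "Z S \<in> ?V" for S
      unfolding Z_def using u v w z V
      by (intro add_subgroup_add[OF V]) (auto simp: add_subgroup_zero)
    have QS: "Q (x + (\<Sum>j\<in>S. a j)) = Z S" if S: "S \<in> Pow {..<5}" for S
    proof (rule Q_eqI[OF ZV])
      fix i assume i: "i \<in> I"
      have finS: "finite S"
        using S finite_subset by auto
      have "[q i (x + (\<Sum>j\<in>S. a j)) = q i x + (\<Sum>j\<in>S. q i (x + a j) - q i x) +
          (\<Sum>l\<in>S. \<Sum>j\<in>{j \<in> S. j < l}. polar (q i) (a j) (a l))] (mod int p)"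
        using quadratic_cube[OF U(1) q[OF i] x(1) finS aU] by (simp add: cong_iff_dvd_diff)
      also have "[q i x + (\<Sum>j\<in>S. q i (x + a j) - q i x) +
          (\<Sum>l\<in>S. \<Sum>j\<in>{j \<in> S. j < l}. polar (q i) (a j) (a l)) =
          dlog p (z i) + (\<Sum>j\<in>S. if j = 4 then dlog p (w i) else 0) +
          (\<Sum>l\<in>S. \<Sum>j\<in>{j \<in> S. j < l}. \<tau> i l j)] (mod int p)"
      proof (intro cong_add cong_sum)
        show "[q i x = dlog p (z i)] (mod int p)"
          using qx[OF i] by (simp add: cong_iff_dvd_diff)
      next
        fix j assume "j \<in> S"
        then have "int p dvd q i (x + a j) - (q i x + (if j = 4 then dlog p (w i) else 0))"
          using a(2)[rule_format, of i j j] i S by (auto simp: cube_coord_def \<tau>_def)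
        then show "[q i (x + a j) - q i x = (if j = 4 then dlog p (w i) else 0)] (mod int p)"
          by (simp add: cong_iff_dvd_diff algebra_simps)
      next
        fix l j assume "l \<in> S" "j \<in> {j \<in> S. j < l}"
        then show "[polar (q i) (a j) (a l) = \<tau> i l j] (mod int p)"
          using a(2)[rule_format, of i l j] i S by (auto simp: cube_coord_def cong_iff_dvd_diff)
      qed
      also have "(\<Sum>l\<in>S. \<Sum>j\<in>{j \<in> S. j < l}. \<tau> i l j) =
          (\<Sum>l\<in>S. (if l = 1 then if 0 \<in> S then dlog p (u i) else 0 else 0) +
            (if l = 3 then if 2 \<in> S then dlog p (v i) else 0 else 0))"
      proof (rule sum.cong[OF refl])
        fix l assume "l \<in> S"
        have "(\<Sum>j\<in>{j \<in> S. j < l}. \<tau> i l j) = (\<Sum>j\<in>{j \<in> S. j < l}.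
            (if j = 0 then if l = 1 then dlog p (u i) else 0 else 0) +
            (if j = 2 then if l = 3 then dlog p (v i) else 0 else 0))"
          by (rule sum.cong) (auto simp: \<tau>_def)
        then show "(\<Sum>j\<in>{j \<in> S. j < l}. \<tau> i l j) =
            (if l = 1 then if 0 \<in> S then dlog p (u i) else 0 else 0) +
            (if l = 3 then if 2 \<in> S then dlog p (v i) else 0 else 0)"
          using finS by (simp add: sum.distrib)
      qed
      also have "(\<Sum>l\<in>S. (if l = 1 then if 0 \<in> S then dlog p (u i) else 0 else 0) +
            (if l = 3 then if 2 \<in> S then dlog p (v i) else 0 else 0)) =
          (if 0 \<in> S \<and> 1 \<in> S then dlog p (u i) else 0) +
          (if 2 \<in> S \<and> 3 \<in> S then dlog p (v i) else 0)"
        using finS by (simp add: sum.distrib)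
      also have "(\<Sum>j\<in>S. if j = 4 then dlog p (w i) else 0) = (if 4 \<in> S then dlog p (w i) else 0)"
        using finS by simp
      finally have "[q i (x + (\<Sum>j\<in>S. a j)) = dlog p (z i) + (if 4 \<in> S then dlog p (w i) else 0) +
          ((if 0 \<in> S \<and> 1 \<in> S then dlog p (u i) else 0) + (if 2 \<in> S \<and> 3 \<in> S then dlog p (v i) else 0))] (mod int p)" .
      moreover have "[dlog p (Z S i) = dlog p (z i) + (if 4 \<in> S then dlog p (w i) else 0) +
          ((if 0 \<in> S \<and> 1 \<in> S then dlog p (u i) else 0) + (if 2 \<in> S \<and> 3 \<in> S then dlog p (v i) else 0))] (mod int p)"
      proof -
        have "unit_root p (dlog p (Z S i)) = unit_root p (dlog p (z i) + (if 4 \<in> S then dlog p (w i) else 0) +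
          ((if 0 \<in> S \<and> 1 \<in> S then dlog p (u i) else 0) + (if 2 \<in> S \<and> 3 \<in> S then dlog p (v i) else 0)))"
          unfolding unit_root_dlog[OF p0 ZV]
          using unit_root_dlog[OF p0 u, of i] unit_root_dlog[OF p0 v, of i] unit_root_dlog[OF p0 w, of i] unit_root_dlog[OF p0 z, of i]
          by (simp add: Z_def unit_root_add add_ac)
        then show ?thesis
          using p0 by (simp add: unit_root_eq_iff cong_iff_dvd_diff)
      qed
      ultimately show "int p dvd q i (x + (\<Sum>j\<in>S. a j)) - dlog p (Z S i)"
        by (metis cong_iff_dvd_diff cong_sym cong_trans)
    qed
    have vertex: "x + (\<Sum>j\<in>S. a j) \<in> U" for S
      using x aU by (auto intro!: add_subgroup_add[OF U(1)] add_subgroup_sum[OF U(1)])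
    have "[\<Sum>S\<in>Pow {..<5}. (- 1) ^ card S * f (x + (\<Sum>j\<in>S. a j)) = 0] (mod int p)"
    proof -
      have "int p dvd (\<Sum>S\<in>Pow {..<5}. (- 1) ^ card S * f (x + (\<Sum>j\<in>S. a j)))"
        by (rule cube_sum_vanishes[OF U(1)]) (use f aU x in \<open>simp_all only: finite_lessThan card_lessThan\<close>)
      then show ?thesis
        by (simp add: cong_0_iff)
    qed
    moreover have "[\<Sum>S\<in>Pow {..<5}. (- 1) ^ card S * F (Z S) = \<Sum>S\<in>Pow {..<5}. (- 1) ^ card S * f (x + (\<Sum>j\<in>S. a j))] (mod int p)"
    proof (intro cong_sum cong_mult cong_refl)
      fix S :: "nat set" assume "S \<in> Pow {..<5}"
      then show "[F (Z S) = f (x + (\<Sum>j\<in>S. a j))] (mod int p)"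
        using F[OF vertex[of S]] QS by simp
    qed
    ultimately have "[\<Sum>S\<in>Pow {..<5}. (- 1) ^ card S * F (Z S) = 0] (mod int p)"
      by (rule cong_trans[rotated])
    then show ?thesis
      unfolding Z_def third_difference_on_cube by (simp add: cong_0_iff)
  qed
  then have "deg_lt p ?V (Suc 2) F"
    by (simp add: eval_nat_numeral)
  then obtain g where g: "is_poly I 2 g" "\<And>z. z \<in> ?V \<Longrightarrow> [F z = g (\<lambda>i. dlog p (z i))] (mod int p)"
    using polynomial_representation[OF p I] by blast
  from g(1) have "\<exists>c h. (\<forall>i\<in>I. is_poly I 1 (h i)) \<and> g = (\<lambda>x. c + (\<Sum>i\<in>I. x i * h i x))"
    unfolding numeral_2_eq_2 One_nat_def is_poly.simps(2)[of I "Suc 0"] .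
  then obtain c h where h: "\<And>i. i \<in> I \<Longrightarrow> is_poly I 1 (h i)" "g = (\<lambda>x. c + (\<Sum>i\<in>I. x i * h i x))"
    by blast
  have "[f x = c + (\<Sum>i\<in>I. q i x * h i (\<lambda>i. q i x))] (mod int p)" if x: "x \<in> U" for x
  proof -
    have "[f x = F (Q x)] (mod int p)"
      using F[OF x] by (rule cong_sym)
    also have "[F (Q x) = g (\<lambda>i. dlog p (Q x i))] (mod int p)"
      by (rule g(2)[OF QV])
    also have "[g (\<lambda>i. dlog p (Q x i)) = g (\<lambda>i. q i x)] (mod int p)"
      by (rule is_poly_cong[OF g(1)]) (use dlog_unit_root[OF p0] in \<open>simp add: Q_def cong_iff_dvd_diff\<close>)
    finally show ?thesis
      by (simp add: h(2))
  qed
  moreover have "deg_lt p U 3 (\<lambda>x. h i (\<lambda>i. q i x))" if "i \<in> I" for i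
    using linear_form_deg[OF h(1)[OF that], of p U 2 q] q by (simp add: eval_nat_numeral)
  ultimately show ?thesis
    by (intro exI[of _ c] exI[of _ "\<lambda>i x. h i (\<lambda>i. q i x)"]) blast
qed

text \<open>The constant \<open>c\<close> is stored as a product of a linear and a cubic function in
  the additional slot \<open>k\<close>.\<close>

lemma decomposes_quadratic_form:
  assumes U: "add_subgroup U" and J: "J \<subseteq> {..<k}"
    and q: "\<And>i. i \<in> J \<Longrightarrow> deg_lt p U 3 (q i)" "\<And>i. i \<in> J \<Longrightarrow> deg_lt p U 3 (q' i)"
    and f: "\<And>x. x \<in> U \<Longrightarrow> [f x = c + (\<Sum>i\<in>J. q i x * q' i x)] (mod int p)"
  shows "decomposes p U (Suc k) f"
proof (rule decomposesI[of "Suc k" p U "\<lambda>j x. if j = k then 1 else 0" "\<lambda>j x. if j = k then c else 0"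
      "\<lambda>j x. if j \<in> J then q j x else 0" "\<lambda>j x. if j \<in> J then q' j x else 0"])
  fix j
  show "deg_lt p U 2 (\<lambda>x. if j = k then 1 else 0)" "deg_lt p U 4 (\<lambda>x. if j = k then c else 0)"
    by (simp_all only: eval_nat_numeral deg_lt_const)
  show "deg_lt p U 3 (\<lambda>x. if j \<in> J then q j x else 0)" "deg_lt p U 3 (\<lambda>x. if j \<in> J then q' j x else 0)"
    using q by (cases "j \<in> J"; simp only: if_True if_False deg_lt_zero)+
next
  fix x assume x: "x \<in> U"
  have "(\<Sum>j<Suc k. (if j = k then 1 else 0) * (if j = k then c else 0)) = c"
    by (simp add: sum.delta' if_distrib cong: if_cong)
  moreover have "(\<Sum>j<Suc k. (if j \<in> J then q j x else 0) * (if j \<in> J then q' j x else 0)) =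
      (\<Sum>i\<in>J. q i x * q' i x)"
    using J by (intro sum.mono_neutral_cong_right) auto
  ultimately show "int p dvd f x - ((\<Sum>j<Suc k. (if j = k then 1 else 0) * (if j = k then c else 0)) +
      (\<Sum>j<Suc k. (if j \<in> J then q j x else 0) * (if j \<in> J then q' j x else 0)))"
    using f[OF x] by (simp only: cong_iff_dvd_diff)
qed

lemma biased_quartic_decomposes:
  fixes f :: "'a::ab_group_add \<Rightarrow> int"
  assumes "prime p" and V: "add_subgroup V" "finite V" "\<And>v. v \<in> V \<Longrightarrow> nat_mul p v = 0"
    and pN: "p \<le> N" and f: "deg_lt p V 5 f"
    and bias: "card V \<le> real N * cmod (\<Sum>x\<in>V. chr p (f x))"
  shows "\<exists>c\<le>10 ^ 9 * N ^ 26. decomposes p V c f"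
proof -
  have p2: "2 \<le> p"
    using assms(1) by (rule prime_ge_2_nat)
  define k where "k = 100 * p\<^sup>2 * N\<^sup>2"
  define r where "r = 2 * N\<^sup>2 + k * (6 * N\<^sup>2 * (402 * (2 * N\<^sup>2) ^ 10))"
  \<comment> \<open>Fixed before \<open>J\<close> is known; it suffices because \<open>J\<close> has
    at most \<open>k\<close> elements.\<close>
  define s where "s = 30 * k + 4"
  obtain U z q B where U: "index_le p r V U" "z \<in> V"
    and q: "\<And>i. i < k \<Longrightarrow> deg_lt p U 3 (q i)" and B: "B \<subseteq> U" "100 * card B \<le> card U"
    and det: "\<And>x y. x \<in> U - B \<Longrightarrow> y \<in> U - B \<Longrightarrow>
      (\<And>i. i < k \<Longrightarrow> int p dvd q i x - q i y) \<Longrightarrow> int p dvd f (z + x) - f (z + y)"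
    using quartic_determined_by_quadratics[OF V(1,2) p2 pN f bias] unfolding r_def k_def by blast
  have subU: "add_subgroup U" "U \<subseteq> V" "finite U"
    using U V(2) finite_subset by (auto simp: index_le_def)
  have "\<exists>U' z' J B'. index_le p (card {..<k} * Suc s) U U' \<and> z' \<in> U \<and> J \<subseteq> {..<k} \<and>
    B' \<subseteq> U' \<and> 100 * card B' \<le> card U' \<and> regular p s U' J (\<lambda>i x. q i (z' + x)) \<and>
    (\<forall>x\<in>U' - B'. \<forall>y\<in>U' - B'. (\<forall>i\<in>J. int p dvd q i (z' + x) - q i (z' + y)) \<longrightarrow>
      int p dvd f (z + (z' + x)) - f (z + (z' + y)))"
    by (rule regularise[where f = "\<lambda>x. f (z + x)"])
       (use assms(1) subU q B det in \<open>auto simp del: deg_lt.simps\<close>)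
  then obtain U' z' J B' where U': "index_le p (card {..<k} * Suc s) U U'" "z' \<in> U" and J: "J \<subseteq> {..<k}"
    and B': "B' \<subseteq> U'" "100 * card B' \<le> card U'" and reg: "regular p s U' J (\<lambda>i x. q i (z' + x))"
    and det': "\<forall>x\<in>U' - B'. \<forall>y\<in>U' - B'. (\<forall>i\<in>J. int p dvd q i (z' + x) - q i (z' + y)) \<longrightarrow>
      int p dvd f (z + (z' + x)) - f (z + (z' + y))"
    by blast
  have subU': "add_subgroup U'" "U' \<subseteq> U" "finite U'"
    using U' subU finite_subset by (auto simp: index_le_def)
  have finJ: "finite J" and cardJ: "card J \<le> k"
    using J finite_subset card_mono[OF finite_lessThan J] by auto
  have sJ: "30 * card J + 4 \<le> s"
    using cardJ by (simp add: s_def)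
  have zz: "z + z' \<in> V"
    using U U' subU by (auto intro: add_subgroup_add[OF V(1)])
  have q3: "deg_lt p U' 3 (\<lambda>x. q i (z' + x))" if "i \<in> J" for i
    using that J by (intro deg_lt_coset[OF q subU(1) subU'(1,2) U'(2)]) auto
  have f5: "deg_lt p U' 5 (\<lambda>x. f (z + (z' + x)))"
    using deg_lt_coset[OF f V(1) subU'(1) subset_trans[OF subU'(2) subU(2)] zz] by (simp only: add.assoc)
  have exact: "int p dvd f (z + (z' + x)) - f (z + (z' + y))"
    if "x \<in> U'" "y \<in> U'" "\<And>i. i \<in> J \<Longrightarrow> int p dvd q i (z' + x) - q i (z' + y)" for x y
  proof (rule determined_exactly[OF assms(1) subU'(1,3) finJ q3 reg sJ B' f5 _ that])
    fix x y
    assume xy: "x \<in> U' - B'" "y \<in> U' - B'"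
      and eq: "\<And>i. i \<in> J \<Longrightarrow> int p dvd q i (z' + x) - q i (z' + y)"
    show "int p dvd f (z + (z' + x)) - f (z + (z' + y))"
      by (rule det'[rule_format, OF xy eq])
  qed
  obtain c q' where q': "\<forall>i\<in>J. deg_lt p U' 3 (q' i)"
    "\<forall>x\<in>U'. [f (z + (z' + x)) = c + (\<Sum>i\<in>J. q i (z' + x) * q' i x)] (mod int p)"
    using function_of_quadratics[OF assms(1) subU'(1,3) finJ q3 reg sJ f5 exact] by blast
  have "decomposes p U' (Suc k) (\<lambda>x. f (z + (z' + x)))"
    by (rule decomposes_quadratic_form[OF subU'(1) J q3]) (use q' in blast)+
  then have dec: "decomposes p U' (Suc k) (\<lambda>x. f ((z + z') + x))"
    by (simp only: add.assoc)
  have "\<exists>c'\<le>Suc k + (r + card {..<k} * Suc s). decomposes p V c' (\<lambda>x. f ((z + z') + x))"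
    by (rule decomposes_lift[OF assms(1) V deg_lt_shift[OF f V(1) zz] index_le_trans[OF U(1) U'(1)] dec])
  then obtain c' where c': "c' \<le> Suc k + (r + k * Suc s)" "decomposes p V c' (\<lambda>x. f ((z + z') + x))"
    unfolding card_lessThan by blast
  \<comment> \<open>The bound \<open>r\<close> dominates: 100 N^4 functions, each costing 6 N^2
    times 402 (2 N^2)^10 dimensions, give 246988800 N^26.\<close>
  have "c' \<le> 10 ^ 9 * N ^ 26"
  proof -
    have "N > 0"
      using p2 pN by auto
    then have mono: "N ^ i \<le> N ^ 26" if "i \<le> 26" for i
      using that by (intro power_increasing) auto
    have "p\<^sup>2 \<le> N\<^sup>2"
      using pN by (intro power_mono) auto
    then have "100 * (p\<^sup>2 * N\<^sup>2) \<le> 100 * (N\<^sup>2 * N\<^sup>2)"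
      by (intro mult_le_mono) auto
    then have k: "k \<le> 100 * N ^ 4"
      by (simp add: k_def mult.assoc flip: power_add)
    have "k * (6 * N\<^sup>2 * (402 * (2 * N\<^sup>2) ^ 10)) \<le> (100 * N ^ 4) * (6 * N\<^sup>2 * (402 * (2 * N\<^sup>2) ^ 10))"
      by (intro mult_le_mono1 k)
    also have "\<dots> = 246988800 * N ^ 26"
      by (simp add: power_mult_distrib flip: power_mult power_add)
    finally have r: "r \<le> 246988802 * N ^ 26"
      using mono[of 2] by (simp add: r_def)
    have "k * Suc s = 30 * (k * k) + 5 * k"
      by (simp add: s_def algebra_simps)
    also have "\<dots> \<le> 30 * ((100 * N ^ 4) * (100 * N ^ 4)) + 5 * (100 * N ^ 4)"
      by (intro add_mono mult_le_mono k le_refl)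
    also have "\<dots> = 300000 * N ^ 8 + 500 * N ^ 4"
      by (simp flip: power_add)
    finally have "k * Suc s \<le> 300500 * N ^ 26"
      using mono[of 8] mono[of 4] by simp
    then show ?thesis
      using c'(1) k r mono[of 4] mono[of 0] by simp
  qed
  then show ?thesis
    using decomposes_shift[OF V(1) zz c'(2)] by blast
qed

subsection \<open>Formal polynomials\<close>

definition mon_val :: "(nat \<Rightarrow>\<^sub>0 nat) \<Rightarrow> (nat \<Rightarrow> int) \<Rightarrow> int" where
  "mon_val m x = (\<Prod>i\<in>Poly_Mapping.keys m. x i ^ Poly_Mapping.lookup m i)"

definition mdeg :: "(nat \<Rightarrow>\<^sub>0 nat) \<Rightarrow> nat" where
  "mdeg m = (\<Sum>i\<in>Poly_Mapping.keys m. Poly_Mapping.lookup m i)"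

definition raw_eval :: "((nat \<Rightarrow>\<^sub>0 nat) \<Rightarrow>\<^sub>0 int) \<Rightarrow> (nat \<Rightarrow> int) \<Rightarrow> int" where
  "raw_eval P x = (\<Sum>m\<in>Poly_Mapping.keys P. Poly_Mapping.lookup P m * mon_val m x)"

lemma mon_val_superset:
  assumes "finite A" "Poly_Mapping.keys m \<subseteq> A"
  shows "mon_val m x = (\<Prod>i\<in>A. x i ^ Poly_Mapping.lookup m i)"
  unfolding mon_val_def using assms by (intro prod.mono_neutral_left) (auto simp: in_keys_iff)

lemma mdeg_superset:
  assumes "finite A" "Poly_Mapping.keys m \<subseteq> A"
  shows "mdeg m = (\<Sum>i\<in>A. Poly_Mapping.lookup m i)"
  unfolding mdeg_def using assms by (intro sum.mono_neutral_left) (auto simp: in_keys_iff)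

lemma mon_val_times_var:
  "mon_val (m + Poly_Mapping.single i 1) x = x i * mon_val m x"
  "mdeg (m + Poly_Mapping.single i 1) = mdeg m + 1"
proof -
  let ?A = "insert i (Poly_Mapping.keys m)"
  have A: "finite ?A" "Poly_Mapping.keys m \<subseteq> ?A" "Poly_Mapping.keys (m + Poly_Mapping.single i 1) \<subseteq> ?A"
    using keys_add[of m "Poly_Mapping.single i 1"] by (auto split: if_splits)
  have "(\<Prod>j\<in>?A. x j ^ Poly_Mapping.lookup (m + Poly_Mapping.single i 1) j) =
      (\<Prod>j\<in>?A. x j ^ Poly_Mapping.lookup m j * (if j = i then x i else 1))"
    by (intro prod.cong) (auto simp: lookup_add lookup_single when_def)
  then show "mon_val (m + Poly_Mapping.single i 1) x = x i * mon_val m x"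
    by (simp only: mon_val_superset[OF A(1,2)] mon_val_superset[OF A(1,3)] prod.distrib)
       (simp add: prod.delta mult.commute)
  have "(\<Sum>j\<in>?A. Poly_Mapping.lookup (m + Poly_Mapping.single i 1) j) =
      (\<Sum>j\<in>?A. Poly_Mapping.lookup m j + (if j = i then 1 else 0))"
    by (intro sum.cong) (auto simp: lookup_add lookup_single when_def)
  then show "mdeg (m + Poly_Mapping.single i 1) = mdeg m + 1"
    by (simp only: mdeg_superset[OF A(1,2)] mdeg_superset[OF A(1,3)] sum.distrib)
       (simp add: sum.delta)
qed

lemma raw_eval_superset:
  assumes "finite A" "Poly_Mapping.keys P \<subseteq> A"
  shows "raw_eval P x = (\<Sum>m\<in>A. Poly_Mapping.lookup P m * mon_val m x)"
  unfolding raw_eval_def using assms by (intro sum.mono_neutral_left) (auto simp: in_keys_iff)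

lemma raw_eval_add: "raw_eval (P + Q) x = raw_eval P x + raw_eval Q x"
proof -
  let ?A = "Poly_Mapping.keys P \<union> Poly_Mapping.keys Q"
  have "finite ?A" "Poly_Mapping.keys P \<subseteq> ?A" "Poly_Mapping.keys Q \<subseteq> ?A"
    "Poly_Mapping.keys (P + Q) \<subseteq> ?A"
    using keys_add[of P Q] by auto
  then show ?thesis
    by (simp add: raw_eval_superset[of ?A] lookup_add distrib_right sum.distrib)
qed

lemma raw_eval_single: "raw_eval (Poly_Mapping.single m c) x = c * mon_val m x"
  by (simp add: raw_eval_def)

lemma raw_eval_sum: "raw_eval (sum P I) x = (\<Sum>i\<in>I. raw_eval (P i) x)"
  by (induction I rule: infinite_finite_induct) (simp_all add: raw_eval_add, simp_all add: raw_eval_def)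

definition polys_deg :: "nat set \<Rightarrow> nat \<Rightarrow> ((nat \<Rightarrow>\<^sub>0 nat) \<Rightarrow>\<^sub>0 int) set" where
  "polys_deg I d = {P. \<forall>m\<in>Poly_Mapping.keys P. Poly_Mapping.keys m \<subseteq> I \<and> mdeg m \<le> d}"

lemma polys_deg_add: "P \<in> polys_deg I d \<Longrightarrow> Q \<in> polys_deg I d \<Longrightarrow> P + Q \<in> polys_deg I d"
  unfolding polys_deg_def using keys_add[of P Q] by blast

lemma polys_deg_sum: "(\<And>i. i \<in> J \<Longrightarrow> P i \<in> polys_deg I d) \<Longrightarrow> sum P J \<in> polys_deg I d"
proof (induction J rule: infinite_finite_induct)
  case (insert j J)
  then show ?case
    by (simp add: polys_deg_add)
qed (simp_all add: polys_deg_def)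

lemma polys_deg_single:
  "Poly_Mapping.keys m \<subseteq> I \<Longrightarrow> mdeg m \<le> d \<Longrightarrow> Poly_Mapping.single m c \<in> polys_deg I d"
  by (auto simp: polys_deg_def)

lemma polynomial_of_is_poly:
  "is_poly I d g \<Longrightarrow> \<exists>P\<in>polys_deg I d. \<forall>x. raw_eval P x = g x"
proof (induction d arbitrary: g)
  case 0
  then obtain c where "g = (\<lambda>x. c)"
    by auto
  then show ?case
    by (intro bexI[of _ "Poly_Mapping.single 0 c"] polys_deg_single)
       (auto simp: raw_eval_single mon_val_def mdeg_def)
next
  case (Suc d)
  then obtain c h where h: "\<forall>i\<in>I. is_poly I d (h i)" "g = (\<lambda>x. c + (\<Sum>i\<in>I. x i * h i x))"
    by auto
  have "\<forall>i\<in>I. \<exists>P. P \<in> polys_deg I d \<and> (\<forall>x. raw_eval P x = h i x)"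
    using h(1) Suc.IH by blast
  then obtain P where P: "\<And>i. i \<in> I \<Longrightarrow> P i \<in> polys_deg I d" "\<And>i x. i \<in> I \<Longrightarrow> raw_eval (P i) x = h i x"
    by metis
  define Q where "Q i = (\<Sum>m\<in>Poly_Mapping.keys (P i).
    Poly_Mapping.single (m + Poly_Mapping.single i 1) (Poly_Mapping.lookup (P i) m))" for i
  have "Q i \<in> polys_deg I (Suc d)" if i: "i \<in> I" for i
    unfolding Q_def
  proof (intro polys_deg_sum polys_deg_single)
    fix m assume "m \<in> Poly_Mapping.keys (P i)"
    then have m: "Poly_Mapping.keys m \<subseteq> I" "mdeg m \<le> d"
      using P(1)[OF i] by (auto simp: polys_deg_def)
    then show "Poly_Mapping.keys (m + Poly_Mapping.single i 1) \<subseteq> I"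
      using i keys_add[of m "Poly_Mapping.single i 1"] by (auto split: if_splits)
    show "mdeg (m + Poly_Mapping.single i 1) \<le> Suc d"
      using m by (simp only: mon_val_times_var)
  qed
  then have "Poly_Mapping.single 0 c + sum Q I \<in> polys_deg I (Suc d)"
    by (intro polys_deg_add polys_deg_sum polys_deg_single) (auto simp: mdeg_def)
  moreover have "raw_eval (Q i) x = x i * h i x" if "i \<in> I" for i x
  proof -
    have "raw_eval (Q i) x = x i * raw_eval (P i) x"
      unfolding Q_def raw_eval_sum raw_eval_single mon_val_times_var
      by (simp add: raw_eval_def sum_distrib_left mult_ac)
    then show ?thesis
      using P(2)[OF that] by simp
  qed
  then have "raw_eval (Poly_Mapping.single 0 c + sum Q I) x = g x" for x
    by (simp add: raw_eval_add raw_eval_sum raw_eval_single h(2) mon_val_def)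
  ultimately show ?case
    by blast
qed

lemma is_poly_represented:
  assumes "p > 0" and g: "is_poly {..<n} d g"
  shows "\<exists>Q. represents p n Q (\<lambda>x. g x mod int p) \<and> total_degree Q \<le> d"
proof -
  obtain P where P: "P \<in> polys_deg {..<n} d" "\<And>x. raw_eval P x = g x"
    using polynomial_of_is_poly[OF g] by blast
  \<comment> \<open>\<open>mpolys\<close> demands reduced coefficients. Reduction can only remove
    monomials, so the degree bound survives.\<close>
  define Q where "Q = Poly_Mapping.map (\<lambda>k. k mod int p) P"
  have lookup: "Poly_Mapping.lookup Q m = Poly_Mapping.lookup P m mod int p" for m
    unfolding Q_def by transfer (simp add: when_def)
  have keys: "Poly_Mapping.keys Q \<subseteq> Poly_Mapping.keys P"
    by (auto simp: in_keys_iff lookup)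
  have "meval p Q x = g x mod int p" for x
  proof -
    have "meval p Q x = raw_eval Q x mod int p"
      by (simp add: meval_def raw_eval_def mon_val_def)
    also have "raw_eval Q x = (\<Sum>m\<in>Poly_Mapping.keys P. (Poly_Mapping.lookup P m mod int p) * mon_val m x)"
      using raw_eval_superset[OF finite_keys keys] by (simp add: lookup)
    also have "\<dots> mod int p = (\<Sum>m\<in>Poly_Mapping.keys P. Poly_Mapping.lookup P m * mon_val m x) mod int p"
      by (rule cong_sum[unfolded cong_def]) (simp add: mod_mult_left_eq)
    finally show ?thesis
      by (simp add: P(2)[of x, unfolded raw_eval_def])
  qed
  moreover have "Q \<in> mpolys p n"
    using P(1) keys assms(1) by (auto simp: mpolys_def polys_deg_def prime_field_def lookup)
  ultimately have rep: "represents p n Q (\<lambda>x. g x mod int p)"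
    by (simp add: represents_def)
  have "total_degree Q \<le> d"
    unfolding total_degree_def
    by (subst Max_le_iff) (use P(1) keys in \<open>auto simp: polys_deg_def mdeg_def\<close>)
  then show ?thesis
    using rep by blast
qed

lemma is_poly_in_funs_deg_le:
  assumes "p > 0" and g: "is_poly {..<n} d g"
  shows "(\<lambda>x. g x mod int p) \<in> funs_deg_le p n d"
proof -
  obtain Q where Q: "represents p n Q (\<lambda>x. g x mod int p)" "total_degree Q \<le> d"
    using is_poly_represented[OF assms] by blast
  then have "fun_degree p n (\<lambda>x. g x mod int p) \<le> total_degree Q"
    unfolding fun_degree_def by (intro Least_le) blast
  then show ?thesis
    using assms(1) Q(2) by (auto simp: funs_deg_le_def prime_field_def)
qed

lemma deg_lt_mon_val:
  assumes "p > 0" "Poly_Mapping.keys m \<subseteq> A"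
  shows "deg_lt p (fpspace p I) (Suc (mdeg m)) (\<lambda>z. mon_val m (\<lambda>i. dlog p (z i)))"
proof -
  note V = add_subgroup_fpspace[OF assms(1), of I]
  have pow: "deg_lt p (fpspace p I) (Suc e) (\<lambda>z. dlog p (z i) ^ e)" for i e
  proof -
    have "deg_lt p (fpspace p I) (Suc (card {..<e})) (\<lambda>z. \<Prod>j<e. dlog p (z i))"
      by (intro deg_lt_prod_linear V deg_lt_dlog assms) auto
    then show ?thesis
      by simp
  qed
  have "deg_lt p (fpspace p I) (Suc (\<Sum>i\<in>J. Poly_Mapping.lookup m i))
      (\<lambda>z. \<Prod>i\<in>J. dlog p (z i) ^ Poly_Mapping.lookup m i)" if "finite J" for J
    using that
  proof (induction J rule: finite_induct)
    case (insert i J)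
    have "deg_lt p (fpspace p I) (Suc (Poly_Mapping.lookup m i) + Suc (\<Sum>i\<in>J. Poly_Mapping.lookup m i) - 1)
        (\<lambda>z. dlog p (z i) ^ Poly_Mapping.lookup m i * (\<Prod>i\<in>J. dlog p (z i) ^ Poly_Mapping.lookup m i))"
      by (rule deg_lt_mult[OF V pow insert.IH])
    then show ?case
      using insert by (simp del: deg_lt.simps)
  qed (simp only: prod.empty deg_lt_const)
  then show ?thesis
    by (simp add: mon_val_def mdeg_def del: deg_lt.simps)
qed

text \<open>Together with \<open>polynomial_representation\<close> this identifies degrees defined
  by differences with degrees of representing polynomials.\<close>

lemma deg_lt_meval:
  assumes "p > 0" "total_degree P \<le> d"
  shows "deg_lt p (fpspace p I) (Suc d) (\<lambda>z. meval p P (\<lambda>i. dlog p (z i)))"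
proof -
  note V = add_subgroup_fpspace[OF assms(1), of I]
  have "mdeg m \<le> d" if "m \<in> Poly_Mapping.keys P" for m
  proof -
    have "mdeg m \<le> total_degree P"
      using that unfolding total_degree_def mdeg_def by (intro Max_ge) auto
    then show ?thesis
      using assms by simp
  qed
  then have "deg_lt p (fpspace p I) (Suc d)
      (\<lambda>z. \<Sum>m\<in>Poly_Mapping.keys P. Poly_Mapping.lookup P m * mon_val m (\<lambda>i. dlog p (z i)))"
    by (intro deg_lt_sum deg_lt_cmult deg_lt_mono[OF V deg_lt_mon_val[OF assms(1) order_refl]]) auto
  then show ?thesis
    by (rule deg_lt_congI[OF _ V]) (simp add: meval_def mon_val_def flip: mod_eq_dvd_iff)
qed

section \<open>Transfer between \<open>points\<close> and \<open>fpspace\<close>\<close>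

definition to_point :: "nat \<Rightarrow> nat \<Rightarrow> (nat \<Rightarrow> circle) \<Rightarrow> nat \<Rightarrow> int" where
  "to_point p n z = (\<lambda>i\<in>{..<n}. dlog p (z i))"

lemma to_point_mem: "p > 0 \<Longrightarrow> z \<in> fpspace p {..<n} \<Longrightarrow> to_point p n z \<in> points p n"
  using dlog(1)[OF _ fpspace_mem] by (auto simp: to_point_def points_def prime_field_def)

lemma to_point_surj:
  assumes "p > 0" and x: "x \<in> points p n"
  obtains z where "z \<in> fpspace p {..<n}" "to_point p n z = x" "\<And>i. i < n \<Longrightarrow> dlog p (z i) = x i"
proof -
  define z where "z i = (if i < n then unit_root p (x i) else 0)" for i
  have dl: "dlog p (z i) = x i" if i: "i < n" for i
  proof -
    have zi: "z i = unit_root p (x i)"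
      using i by (simp add: z_def)
    have "dlog p (z i) \<in> {0..<int p}"
      unfolding zi by (rule dlog(1)[OF assms(1) unit_root_mem[OF assms(1)]])
    moreover have "x i \<in> {0..<int p}"
      using PiE_mem[OF x[unfolded points_def], of i] i by (simp add: prime_field_def)
    moreover have "dlog p (z i) mod int p = x i mod int p"
      unfolding zi mod_eq_dvd_iff by (rule dlog_unit_root[OF assms(1)])
    ultimately show ?thesis
      by simp
  qed
  show ?thesis
  proof (rule that)
    show "z \<in> fpspace p {..<n}"
      by (rule fpspaceI[OF assms(1), where k = x]) (auto simp: z_def)
    show "to_point p n z = x"
    proof
      fix i
      show "to_point p n z i = x i"
        using dl PiE_arb[OF x[unfolded points_def], of i] by (cases "i < n") (simp_all add: to_point_def)
    qed
  qed (rule dl)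
qed

lemma bij_to_point:
  assumes "p > 0"
  shows "bij_betw (to_point p n) (fpspace p {..<n}) (points p n)"
  unfolding bij_betw_def
proof
  show "inj_on (to_point p n) (fpspace p {..<n})"
  proof (rule inj_onI)
    fix z z' assume z: "z \<in> fpspace p {..<n}" "z' \<in> fpspace p {..<n}" and eq: "to_point p n z = to_point p n z'"
    show "z = z'"
    proof
      fix i
      show "z i = z' i"
      proof (cases "i < n")
        case True
        then have "dlog p (z i) = dlog p (z' i)"
          using fun_cong[OF eq, of i] by (simp add: to_point_def)
        then show ?thesis
          using unit_root_dlog[OF assms z(1)] unit_root_dlog[OF assms z(2)] by metis
      qed (use z in \<open>auto simp: fpspace_def\<close>)
    qed
  qed
  show "to_point p n ` fpspace p {..<n} = points p n"
    using to_point_mem[OF assms] to_point_surj[OF assms] by (auto simp: image_iff) metis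
qed

lemma bias_eq:
  assumes "p > 0"
  shows "bias p n f = cmod (\<Sum>z\<in>fpspace p {..<n}. chr p (f (to_point p n z))) / card (fpspace p {..<n})"
proof -
  have chr: "exp (2 * complex_of_real pi * \<i> / of_nat p) powi k = chr p k" for k
  proof -
    have "2 * complex_of_real pi * \<i> / of_nat p = \<i> * complex_of_real (2 * pi / p)"
      by (simp add: mult_ac)
    then have "exp (2 * complex_of_real pi * \<i> / of_nat p) = cis (2 * pi / p)"
      by (simp only: cis_conv_exp)
    then show ?thesis
      by (simp add: cis_power_int chr_def mult_ac)
  qed
  have "(\<Sum>z\<in>fpspace p {..<n}. chr p (f (to_point p n z))) = (\<Sum>a\<in>points p n. chr p (f a))"
    by (rule sum.reindex_bij_betw[OF bij_to_point[OF assms]])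
  moreover have "card (fpspace p {..<n}) = card (points p n)"
    by (rule bij_betw_same_card[OF bij_to_point[OF assms]])
  ultimately show ?thesis
    unfolding bias_def chr by (simp add: norm_divide)
qed

lemma mod_eq_in_field:
  "[a = b] (mod int p) \<Longrightarrow> a \<in> prime_field p \<Longrightarrow> a = b mod int p"
  by (auto simp: cong_def prime_field_def)

text \<open>The Lagrange basis polynomials, normalised by an inverse modulo \<open>p\<close>. The
  degree bound \<open>p\<close> is generous; only its finiteness matters.\<close>

lemma lagrange_factor:
  assumes "prime p"
  obtains L :: "int \<Rightarrow> int \<Rightarrow> int" where
    "\<And>c. c \<in> {0..<int p} \<Longrightarrow> [L c c = 1] (mod int p)"
    "\<And>c x. x \<in> {0..<int p} \<Longrightarrow> x \<noteq> c \<Longrightarrow> L c x = 0"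
    "\<And>c I i. deg_lt p (fpspace p I) (Suc p) (\<lambda>z. L c (dlog p (z i)))"
proof -
  have p: "p > 0"
    using assms by (rule prime_gt_0_nat)
  let ?P = "\<lambda>c x. \<Prod>b\<in>{0..<int p} - {c}. x - b"
  have "\<exists>r. [?P c c * r = 1] (mod int p)" if c: "c \<in> {0..<int p}" for c
  proof (rule cong_solve_coprime_int)
    have "\<not> int p dvd c - b" if "b \<in> {0..<int p} - {c}" for b
    proof
      assume "int p dvd c - b"
      then have "int p dvd \<bar>c - b\<bar>"
        by simp
      then have "int p \<le> \<bar>c - b\<bar>"
        using that by (intro zdvd_imp_le) auto
      then show False
        using c that by auto
    qed
    then have "\<not> int p dvd ?P c c"
      using assms by (subst prime_dvd_prod_iff) auto
    then show "coprime (?P c c) (int p)"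
      using assms by (simp add: prime_imp_coprime coprime_commute)
  qed
  then obtain r where r: "\<And>c. c \<in> {0..<int p} \<Longrightarrow> [?P c c * r c = 1] (mod int p)"
    by metis
  show ?thesis
  proof (rule that[of "\<lambda>c x. r c * ?P c x"])
    show "[r c * ?P c c = 1] (mod int p)" if "c \<in> {0..<int p}" for c
      using r[OF that] by (simp only: mult.commute)
    show "r c * ?P c x = 0" if "x \<in> {0..<int p}" "x \<noteq> c" for c x
      using that by auto
    fix c I i
    note V = add_subgroup_fpspace[OF p, of I]
    have "deg_lt p (fpspace p I) 2 (\<lambda>z. dlog p (z i) - b)" for b
      using deg_lt_const[of p "fpspace p I" 1 b] deg_lt_dlog[OF p, of I i]
      by (intro deg_lt_diff) (simp_all only: numeral_2_eq_2 One_nat_def)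
    then have "deg_lt p (fpspace p I) (Suc (card ({0..<int p} - {c}))) (\<lambda>z. ?P c (dlog p (z i)))"
      by (intro deg_lt_prod_linear V) auto
    moreover have "card ({0..<int p} - {c}) \<le> p"
      using card_mono[of "{0..<int p}" "{0..<int p} - {c}"] by auto
    ultimately have "deg_lt p (fpspace p I) (Suc p) (\<lambda>z. ?P c (dlog p (z i)))"
      by (elim deg_lt_mono[OF V]) simp
    then show "deg_lt p (fpspace p I) (Suc p) (\<lambda>z. r c * ?P c (dlog p (z i)))"
      by (rule deg_lt_cmult)
  qed
qed

text \<open>Interpolation by products of Lagrange factors, one for each coordinate. It ensures that
  some polynomial represents a given function, without which the \<open>LEAST\<close> in
  \<open>fun_degree\<close> would carry no information.\<close>

lemma finite_degree:
  fixes F :: "(nat \<Rightarrow> circle) \<Rightarrow> int"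
  assumes "prime p" "finite I"
  shows "\<exists>d. deg_lt p (fpspace p I) (Suc d) F"
proof -
  let ?V = "fpspace p I"
  have p: "p > 0"
    using assms(1) by (rule prime_gt_0_nat)
  note V = add_subgroup_fpspace[OF p, of I]
  obtain L where L: "\<And>c. c \<in> {0..<int p} \<Longrightarrow> [L c c = 1] (mod int p)"
    "\<And>c x. x \<in> {0..<int p} \<Longrightarrow> x \<noteq> c \<Longrightarrow> L c x = 0"
    "\<And>c i. deg_lt p ?V (Suc p) (\<lambda>z. L c (dlog p (z i)))"
    using lagrange_factor[OF assms(1)] by metis
  define \<delta> where "\<delta> a J z = (\<Prod>i\<in>J. L (dlog p (a i)) (dlog p (z i)))" for a z :: "nat \<Rightarrow> circle" and J
  have \<delta>: "deg_lt p ?V (Suc (card J * p)) (\<delta> a J)" if "finite J" for a J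
    using that
  proof (induction J rule: finite_induct)
    case empty
    then show ?case
      unfolding \<delta>_def by (simp only: prod.empty deg_lt_const)
  next
    case (insert i J)
    have "deg_lt p ?V (Suc p + Suc (card J * p) - 1)
        (\<lambda>z. L (dlog p (a i)) (dlog p (z i)) * \<delta> a J z)"
      by (rule deg_lt_mult[OF V L(3) insert.IH])
    moreover have "Suc p + Suc (card J * p) - 1 = Suc (card (insert i J) * p)"
      using insert by simp
    moreover have "\<delta> a (insert i J) = (\<lambda>z. L (dlog p (a i)) (dlog p (z i)) * \<delta> a J z)"
      using insert by (simp add: \<delta>_def fun_eq_iff)
    ultimately show ?case
      by simp
  qed
  have deg: "deg_lt p ?V (Suc (card I * p)) (\<lambda>z. \<Sum>a\<in>?V. F a * \<delta> a I z)"
    by (intro deg_lt_sum deg_lt_cmult \<delta> assms)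
  have range: "dlog p (z i) \<in> {0..<int p}" if "z \<in> ?V" for z i
    by (rule dlog(1)[OF p fpspace_mem[OF p that]])
  have \<delta>_neq: "\<delta> a I z = 0" if az: "a \<in> ?V" "z \<in> ?V" "a \<noteq> z" for a z
  proof -
    obtain i where i: "a i \<noteq> z i"
      using az(3) by auto
    then have "i \<in> I"
      using az by (auto simp: fpspace_def)
    moreover have "dlog p (z i) \<noteq> dlog p (a i)"
      using i unit_root_dlog[OF p az(1), of i] unit_root_dlog[OF p az(2), of i] by metis
    ultimately show ?thesis
      unfolding \<delta>_def using assms(2) L(2)[OF range[OF az(2)]] by (intro prod_zero) auto
  qed
  have "int p dvd F z - (\<Sum>a\<in>?V. F a * \<delta> a I z)" if z: "z \<in> ?V" for z
  proof -
    have "(\<Sum>a\<in>?V - {z}. F a * \<delta> a I z) = 0"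
      using z \<delta>_neq by (intro sum.neutral) auto
    then have "(\<Sum>a\<in>?V. F a * \<delta> a I z) = F z * \<delta> z I z"
      using z assms(2) by (simp add: sum.remove finite_fpspace)
    moreover have "[\<delta> z I z = (\<Prod>i\<in>I. 1)] (mod int p)"
      unfolding \<delta>_def by (intro cong_prod L(1) range z)
    then have "[F z * \<delta> z I z = F z * 1] (mod int p)"
      by (intro cong_mult cong_refl) simp
    ultimately show ?thesis
      using cong_sym cong_iff_dvd_diff by fastforce
  qed
  then have "deg_lt p ?V (Suc (card I * p)) F"
    by (rule deg_lt_congI[OF deg V])
  then show ?thesis ..
qed

lemma fun_represented:
  assumes "prime p" and f: "f \<in> points p n \<rightarrow> prime_field p"
    and deg: "deg_lt p (fpspace p {..<n}) (Suc d) (\<lambda>z. f (to_point p n z))"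
  shows "\<exists>g. is_poly {..<n} d g \<and> (\<forall>x\<in>points p n. f x = g x mod int p)"
proof -
  have p: "p > 0"
    using assms(1) by (rule prime_gt_0_nat)
  obtain g where g: "is_poly {..<n} d g"
    "\<And>z. z \<in> fpspace p {..<n} \<Longrightarrow> [f (to_point p n z) = g (\<lambda>i. dlog p (z i))] (mod int p)"
    using polynomial_representation[OF assms(1) finite_lessThan deg] by blast
  have "f x = g x mod int p" if x: "x \<in> points p n" for x
  proof (rule mod_eq_in_field)
    obtain z where z: "z \<in> fpspace p {..<n}" "to_point p n z = x" "\<And>i. i < n \<Longrightarrow> dlog p (z i) = x i"
      using to_point_surj[OF p x] by blast
    have "[f x = g (\<lambda>i. dlog p (z i))] (mod int p)"
      using g(2)[OF z(1)] z(2) by simp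
    moreover have "[g (\<lambda>i. dlog p (z i)) = g x] (mod int p)"
      using z(3) by (intro is_poly_cong[OF g(1)]) simp
    ultimately show "[f x = g x] (mod int p)"
      by (rule cong_trans)
  qed (use f x in auto)
  then show ?thesis
    using g(1) by blast
qed

lemma fun_degree_attained:
  assumes "prime p" and f: "f \<in> points p n \<rightarrow> prime_field p"
  shows "\<exists>P. represents p n P f \<and> total_degree P = fun_degree p n f"
proof -
  obtain d where d: "deg_lt p (fpspace p {..<n}) (Suc d) (\<lambda>z. f (to_point p n z))"
    using finite_degree[OF assms(1) finite_lessThan] by blast
  obtain g where g: "is_poly {..<n} d g" "\<And>x. x \<in> points p n \<Longrightarrow> f x = g x mod int p"
    using fun_represented[OF assms d] by blast
  obtain P where "represents p n P (\<lambda>x. g x mod int p)"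
    using is_poly_represented[OF prime_gt_0_nat[OF assms(1)] g(1)] by blast
  then have "represents p n P f"
    using g(2) by (simp add: represents_def)
  then have "\<exists>d P. represents p n P f \<and> total_degree P = d"
    by blast
  then show ?thesis
    unfolding fun_degree_def by (rule LeastI_ex)
qed

lemma quartic_on_points:
  assumes "prime p" and f: "f \<in> points p n \<rightarrow> prime_field p" and deg: "fun_degree p n f = 4"
  shows "deg_lt p (fpspace p {..<n}) 5 (\<lambda>z. f (to_point p n z))"
proof -
  have p: "p > 0"
    using assms(1) by (rule prime_gt_0_nat)
  obtain P where P: "represents p n P f" "total_degree P = 4"
    using fun_degree_attained[OF assms(1) f] deg by auto
  have "f (to_point p n z) = meval p P (\<lambda>i. dlog p (z i))" if z: "z \<in> fpspace p {..<n}" for z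
  proof -
    have "meval p P (to_point p n z) = meval p P (\<lambda>i. dlog p (z i))"
      using P(1) unfolding meval_def represents_def mpolys_def
      by (intro arg_cong2[where f = "(mod)"] sum.cong prod.cong arg_cong2[where f = "(*)"] refl)
         (auto simp: to_point_def)
    then show ?thesis
      using P(1) to_point_mem[OF p z] by (simp add: represents_def)
  qed
  then have "deg_lt p (fpspace p {..<n}) (Suc 4) (\<lambda>z. f (to_point p n z))"
    using P(2) by (intro deg_lt_congI[OF deg_lt_meval[OF p, of P] add_subgroup_fpspace[OF p]]) simp_all
  then show ?thesis
    by (simp add: eval_nat_numeral)
qed

lemma function_on_points:
  assumes "prime p" and deg: "deg_lt p (fpspace p {..<n}) (Suc d) F"
  shows "\<exists>h\<in>funs_deg_le p n d. \<forall>z\<in>fpspace p {..<n}. [h (to_point p n z) = F z] (mod int p)"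
proof -
  have p: "p > 0"
    using assms(1) by (rule prime_gt_0_nat)
  obtain g where g: "is_poly {..<n} d g"
    "\<And>z. z \<in> fpspace p {..<n} \<Longrightarrow> [F z = g (\<lambda>i. dlog p (z i))] (mod int p)"
    using polynomial_representation[OF assms(1) finite_lessThan deg] by blast
  have "[g (to_point p n z) mod int p = F z] (mod int p)" if z: "z \<in> fpspace p {..<n}" for z
  proof -
    have "[g (to_point p n z) = g (\<lambda>i. dlog p (z i))] (mod int p)"
      by (rule is_poly_cong[OF g(1)]) (simp add: to_point_def)
    then show ?thesis
      using g(2)[OF z] by (simp add: cong_def)
  qed
  then show ?thesis
    by (intro bexI[OF _ is_poly_in_funs_deg_le[OF p g(1)]]) simp
qed

lemma functions_on_points:
  assumes "prime p" and deg: "\<And>j. j < c \<Longrightarrow> deg_lt p (fpspace p {..<n}) (Suc d) (F j)"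
  obtains h where "\<And>j. j < c \<Longrightarrow> h j \<in> funs_deg_le p n d"
    "\<And>j z. j < c \<Longrightarrow> z \<in> fpspace p {..<n} \<Longrightarrow> [h j (to_point p n z) = F j z] (mod int p)"
proof -
  have "\<forall>j\<in>{..<c}. \<exists>h. h \<in> funs_deg_le p n d \<and>
      (\<forall>z\<in>fpspace p {..<n}. [h (to_point p n z) = F j z] (mod int p))"
    using function_on_points[OF assms(1) deg] by (auto simp: Bex_def)
  from bchoice[OF this] show ?thesis
    using that by auto
qed

theorem theorem3:
  shows "\<exists>B :: real poly. \<forall>(p::nat) (n::nat) (f :: (nat \<Rightarrow> int) \<Rightarrow> int) (\<delta>::real).
    prime p \<longrightarrow> f \<in> points p n \<rightarrow> prime_field p \<longrightarrow> fun_degree p n f = 4 \<longrightarrow>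
    bias p n f = \<delta> \<longrightarrow> \<delta> > 0 \<longrightarrow>
    (\<exists>(c::nat) (l :: nat \<Rightarrow> (nat \<Rightarrow> int) \<Rightarrow> int) (q :: nat \<Rightarrow> (nat \<Rightarrow> int) \<Rightarrow> int)
        (q' :: nat \<Rightarrow> (nat \<Rightarrow> int) \<Rightarrow> int) (g :: nat \<Rightarrow> (nat \<Rightarrow> int) \<Rightarrow> int).
      4 * real c \<le> poly B (real p / \<delta>) \<and>
      (\<forall>j<c. l j \<in> funs_deg_le p n 1 \<and> q j \<in> funs_deg_le p n 2 \<and>
             q' j \<in> funs_deg_le p n 2 \<and> g j \<in> funs_deg_le p n 3) \<and>
      (\<forall>x\<in>points p n. [f x = (\<Sum>j<c. l j x * g j x) + (\<Sum>j<c. q j x * q' j x)] (mod int p)))"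
\<comment> \<open>The number of products is at most 10^9 N^26 with \<open>N\<close> at most twice
  \<open>p / \<delta>\<close>, which gives the factor 2^26; the factor 4 counts the four
  families.\<close>
proof (intro exI[of _ "monom (4 * (10 ^ 9 * 2 ^ 26)) 26 :: real poly"] allI impI)
  fix p n :: nat and f :: "(nat \<Rightarrow> int) \<Rightarrow> int" and \<delta> :: real
  assume p: "prime p" and f: "f \<in> points p n \<rightarrow> prime_field p" and deg: "fun_degree p n f = 4"
    and bias: "bias p n f = \<delta>" and \<delta>: "\<delta> > 0"
  have p0: "p > 0"
    using p by (rule prime_gt_0_nat)
  let ?V = "fpspace p {..<n}"
  define F where "F z = f (to_point p n z)" for z
  have V: "add_subgroup ?V" "finite ?V" "\<And>v. v \<in> ?V \<Longrightarrow> nat_mul p v = 0"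
    using p0 by (auto intro: add_subgroup_fpspace finite_fpspace fpspace_torsion)
  have cardV: "real (card ?V) > 0"
    using add_subgroup_card_pos[OF V(1,2)] by simp
  have \<delta>_eq: "cmod (\<Sum>z\<in>?V. chr p (F z)) = \<delta> * card ?V"
    using bias bias_eq[OF p0, of n f] cardV by (simp add: F_def field_simps)
  then have "\<delta> * real (card ?V) \<le> 1 * real (card ?V)"
    using cmod_chr_sum_le[of p F ?V] by simp
  then have \<delta>1: "\<delta> \<le> 1"
    using cardV by (simp only: mult_le_cancel_right_pos)
  define X where "X = real p / \<delta>"
  have X: "real p \<le> X" "1 \<le> X * \<delta>" "1 \<le> X"
    using \<delta> \<delta>1 p0 by (auto simp: X_def field_simps mult_left_le)
  \<comment> \<open>As \<open>\<delta> \<le> 1\<close>, this one integer bounds both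
    \<open>p\<close> and \<open>1 / \<delta>\<close>, as \<open>biased_quartic_decomposes\<close>
    requires.\<close>
  define N where "N = nat \<lceil>X\<rceil>"
  have N: "X \<le> N" "N \<le> 2 * X"
    using X(3) by (auto simp: N_def) linarith
  have "p \<le> N"
    using X(1) N(1) by linarith
  have "1 \<le> N * \<delta>"
    using X(2) mult_right_mono[OF N(1), of \<delta>] \<delta> by linarith
  then have "1 * real (card ?V) \<le> (N * \<delta>) * real (card ?V)"
    by (intro mult_right_mono) auto
  then have biasN: "card ?V \<le> real N * cmod (\<Sum>z\<in>?V. chr p (F z))"
    by (simp add: \<delta>_eq)
  have "deg_lt p ?V 5 F"
    unfolding F_def by (rule quartic_on_points[OF p f deg])
  then obtain c where c: "c \<le> 10 ^ 9 * N ^ 26" "decomposes p ?V c F"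
    using biased_quartic_decomposes[OF p V \<open>p \<le> N\<close> _ biasN] by blast
  then obtain l g q q' where
    deg: "\<forall>j<c. deg_lt p ?V 2 (l j) \<and> deg_lt p ?V 4 (g j) \<and> deg_lt p ?V 3 (q j) \<and> deg_lt p ?V 3 (q' j)"
    and F: "\<forall>z\<in>?V. int p dvd F z - ((\<Sum>j<c. l j z * g j z) + (\<Sum>j<c. q j z * q' j z))"
    unfolding decomposes_def by blast
  obtain L where L: "\<And>j. j < c \<Longrightarrow> L j \<in> funs_deg_le p n 1"
    "\<And>j z. j < c \<Longrightarrow> z \<in> ?V \<Longrightarrow> [L j (to_point p n z) = l j z] (mod int p)"
    using functions_on_points[OF p, of c n 1 l] deg by (auto simp: numeral_2_eq_2 simp del: deg_lt.simps)
  obtain G where G: "\<And>j. j < c \<Longrightarrow> G j \<in> funs_deg_le p n 3"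
    "\<And>j z. j < c \<Longrightarrow> z \<in> ?V \<Longrightarrow> [G j (to_point p n z) = g j z] (mod int p)"
    using functions_on_points[OF p, of c n 3 g] deg by (auto simp del: deg_lt.simps)
  obtain Q where Q: "\<And>j. j < c \<Longrightarrow> Q j \<in> funs_deg_le p n 2"
    "\<And>j z. j < c \<Longrightarrow> z \<in> ?V \<Longrightarrow> [Q j (to_point p n z) = q j z] (mod int p)"
    using functions_on_points[OF p, of c n 2 q] deg by (auto simp del: deg_lt.simps)
  obtain Q' where Q': "\<And>j. j < c \<Longrightarrow> Q' j \<in> funs_deg_le p n 2"
    "\<And>j z. j < c \<Longrightarrow> z \<in> ?V \<Longrightarrow> [Q' j (to_point p n z) = q' j z] (mod int p)"
    using functions_on_points[OF p, of c n 2 q'] deg by (auto simp del: deg_lt.simps)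
  have "[f x = (\<Sum>j<c. L j x * G j x) + (\<Sum>j<c. Q j x * Q' j x)] (mod int p)" if x: "x \<in> points p n" for x
  proof -
    obtain z where z: "z \<in> ?V" "to_point p n z = x"
      using to_point_surj[OF p0 x] by metis
    have "[f x = (\<Sum>j<c. l j z * g j z) + (\<Sum>j<c. q j z * q' j z)] (mod int p)"
      using F z by (auto simp: F_def cong_iff_dvd_diff)
    moreover have "[(\<Sum>j<c. L j x * G j x) + (\<Sum>j<c. Q j x * Q' j x) =
        (\<Sum>j<c. l j z * g j z) + (\<Sum>j<c. q j z * q' j z)] (mod int p)"
      unfolding z(2)[symmetric] by (intro cong_add cong_sum cong_mult L(2) G(2) Q(2) Q'(2) z(1)) simp_all
    ultimately show ?thesis
      using cong_sym cong_trans by blast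
  qed
  moreover have "4 * real c \<le> poly (monom (4 * (10 ^ 9 * 2 ^ 26)) 26) (real p / \<delta>)"
  proof -
    have "real c \<le> real (10 ^ 9 * N ^ 26)"
      using c(1) by (simp only: of_nat_le_iff)
    also have "\<dots> = 10 ^ 9 * real N ^ 26"
      by simp
    also have "\<dots> \<le> 10 ^ 9 * (2 * X) ^ 26"
      using N by (intro mult_left_mono power_mono) auto
    also have "\<dots> = (10 ^ 9 * 2 ^ 26) * X ^ 26"
      by (simp only: power_mult_distrib mult.assoc)
    finally show ?thesis
      by (simp add: poly_monom X_def)
  qed
  ultimately show "\<exists>c l q q' g. 4 * real c \<le> poly (monom (4 * (10 ^ 9 * 2 ^ 26)) 26) (real p / \<delta>) \<and>
      (\<forall>j<c. l j \<in> funs_deg_le p n 1 \<and> q j \<in> funs_deg_le p n 2 \<and>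
             q' j \<in> funs_deg_le p n 2 \<and> g j \<in> funs_deg_le p n 3) \<and>
      (\<forall>x\<in>points p n. [f x = (\<Sum>j<c. l j x * g j x) + (\<Sum>j<c. q j x * q' j x)] (mod int p))"
    using L(1) G(1) Q(1) Q'(1) by blast
qed

end
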